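(* Let $L>0$ be fixed. For $\omega_0>\frac18\left(\frac{\sqrt{L^2+16\pi}}{L}+\frac{8\pi}{L^2}-1\right)$, consider the unique $\alpha_{3,0}=\alpha_3(\omega_0)\in\left(\frac{\sqrt{1+4\omega_0}-1}{2},\frac{\sqrt{48\omega_0+9}-3}{4}\right)$ such that $\mathcal{T}_\phi(\alpha_{3,0},\omega_0)=L$. Then: (1) There exist an interval $I_1$ around $\omega_0$, an interval $I_2$ around $\alpha_{3,0}$ and a unique smooth function $\Lambda:I_1\to I_2$ such that $\Lambda(\omega_0)=\alpha_{3,0}$ and $$\mathcal{T}_\phi(\alpha_3(\omega),\omega)=\frac{\sqrt8\,3^{1/4}K(k)}{\sqrt{\alpha_3}\,(q(\alpha_3))^{1/4}}=L,$$ where $\omega\in I_1$, $\alpha_3=\alpha_3(\omega):=\Lambda(\omega)\in I_2$ and $k^2=k^2(\omega):=k^2(\alpha_3(\omega),\omega)\in(0,1)$. (2) The dnoidal wave $\phi_\omega:=\phi_\omega(\cdot,\alpha_3(\omega))$ determined by $\alpha_3(\omega)$ has fundamental period $L$ and satisfies $-\phi''+\omega\phi-\phi^3-\phi^5=0$. Moreover, the mapping $\omega\in I_1\mapsto\phi_\omega\in H^n_{per}([0,L])$ is a smooth function for all $n\in\mathbb{N}$. (3) The interval $I_1$ can be chosen as $\left(\frac{\sqrt{L^2+16\pi}}{8L}+\frac{\pi}{L^2}-\frac18,+\infty\right)$.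
   Context: $K(k)=\int_0^{\pi/2}(1-k^2\sin^2t)^{-1/2}dt$; $\mathrm{sn}(\cdot,k)$, $\mathrm{dn}(\cdot,k)$ are the Jacobi elliptic functions of modulus $k$. $H^n_{per}([0,L])$ is the $L$-periodic Sobolev space. For $\omega>0$ and $\alpha_3\in\left(\frac{\sqrt{1+4\omega}-1}{2},\frac{\sqrt{48\omega+9}-3}{4}\right)$ put $q(\alpha_3)=16\omega-4\alpha_3^2-4\alpha_3+3>0$, $$k^2(\alpha_3,\omega)=\frac{\sqrt3\,\alpha_3\sqrt{q(\alpha_3)}-12\omega+6\alpha_3^2+9\alpha_3}{2\sqrt3\,\alpha_3\sqrt{q(\alpha_3)}},\qquad \mathcal{T}_\phi(\alpha_3,\omega)=\frac{\sqrt8\,3^{1/4}K(k(\alpha_3,\omega))}{\sqrt{\alpha_3}\,(q(\alpha_3))^{1/4}}.$$ Put also $\alpha_1=-\frac{\sqrt3\sqrt{q(\alpha_3)}+2\alpha_3+3}{4}$, $\alpha_2=\frac{\sqrt3\sqrt{q(\alpha_3)}-2\alpha_3-3}{4}$, $g=\frac{2}{\sqrt{\alpha_3(\alpha_2-\alpha_1)}}$, $\beta^2=-\frac{\alpha_3}{\alpha_1}k^2$; one has $k^2=\frac{-\alpha_1(\alpha_3-\alpha_2)}{\alpha_3(\alpha_2-\alpha_1)}$. The dnoidal wave determined by $\alpha_3$ (and $\omega$) is $$\phi_\omega(x,\alpha_3)=\frac{\sqrt{\alpha_3}\,\mathrm{dn}\left(\frac{2}{\sqrt3 g}x,k\right)}{\sqrt{1+\beta^2\mathrm{sn}^2\left(\frac{2}{\sqrt3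 g}x,k\right)}}.$$
   Formalization: Both thresholds (hypothesis on ω_0 and interval I_1 in (3)) are proved with π² in place of the printed π; with π the claim fails, since for ω between the two values (e.g. L=2, 1.12<ω<3.13) no α_3 satisfies T_φ=L. *)

theory Defs
  imports "HOL-Analysis.Analysis"
begin

section \<open>Elliptic integrals and Jacobi elliptic functions of modulus \<open>k\<close>\<close>

definition elliptic_F :: "real \<Rightarrow> real \<Rightarrow> real" where
  "elliptic_F \<theta> k = (LBINT t=ereal 0..ereal \<theta>. 1 / sqrt (1 - k\<^sup>2 * (sin t)\<^sup>2))"

definition elliptic_K :: "real \<Rightarrow> real" where
  "elliptic_K k = (LBINT t=ereal 0..ereal (pi / 2). 1 / sqrt (1 - k\<^sup>2 * (sin t)\<^sup>2))"

text \<open>For \<open>0 \<le> k < 1\<close> the map \<open>\<theta> \<mapsto> elliptic_F \<theta> k\<close> is an increasing bijection of the real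
  line (the integral is signed), and the amplitude is its inverse.\<close>

definition jacobi_am :: "real \<Rightarrow> real \<Rightarrow> real" where
  "jacobi_am u k = (THE \<theta>. elliptic_F \<theta> k = u)"

definition jacobi_sn :: "real \<Rightarrow> real \<Rightarrow> real" where
  "jacobi_sn u k = sin (jacobi_am u k)"

definition jacobi_dn :: "real \<Rightarrow> real \<Rightarrow> real" where
  "jacobi_dn u k = sqrt (1 - k\<^sup>2 * (jacobi_sn u k)\<^sup>2)"

section \<open>Dnoidal waves\<close>

definition alpha3_range :: "real \<Rightarrow> real set" where
  "alpha3_range \<omega> = {(sqrt (1 + 4 * \<omega>) - 1) / 2 <..< (sqrt (48 * \<omega> + 9) - 3) / 4}"

definition dn_q :: "real \<Rightarrow> real \<Rightarrow> real" where
  "dn_q \<alpha>\<^sub>3 \<omega> = 16 * \<omega> - 4 * \<alpha>\<^sub>3\<^sup>2 - 4 * \<alpha>\<^sub>3 + 3"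

definition dn_ksq :: "real \<Rightarrow> real \<Rightarrow> real" where
  "dn_ksq \<alpha>\<^sub>3 \<omega> =
     (sqrt 3 * \<alpha>\<^sub>3 * sqrt (dn_q \<alpha>\<^sub>3 \<omega>) - 12 * \<omega> + 6 * \<alpha>\<^sub>3\<^sup>2 + 9 * \<alpha>\<^sub>3)
       / (2 * sqrt 3 * \<alpha>\<^sub>3 * sqrt (dn_q \<alpha>\<^sub>3 \<omega>))"

definition dn_k :: "real \<Rightarrow> real \<Rightarrow> real" where
  "dn_k \<alpha>\<^sub>3 \<omega> = sqrt (dn_ksq \<alpha>\<^sub>3 \<omega>)"

definition dn_T :: "real \<Rightarrow> real \<Rightarrow> real" where
  "dn_T \<alpha>\<^sub>3 \<omega> =
     sqrt 8 * 3 powr (1 / 4) * elliptic_K (dn_k \<alpha>\<^sub>3 \<omega>)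
       / (sqrt \<alpha>\<^sub>3 * dn_q \<alpha>\<^sub>3 \<omega> powr (1 / 4))"

definition dn_alpha1 :: "real \<Rightarrow> real \<Rightarrow> real" where
  "dn_alpha1 \<alpha>\<^sub>3 \<omega> = - (sqrt 3 * sqrt (dn_q \<alpha>\<^sub>3 \<omega>) + 2 * \<alpha>\<^sub>3 + 3) / 4"

definition dn_alpha2 :: "real \<Rightarrow> real \<Rightarrow> real" where
  "dn_alpha2 \<alpha>\<^sub>3 \<omega> = (sqrt 3 * sqrt (dn_q \<alpha>\<^sub>3 \<omega>) - 2 * \<alpha>\<^sub>3 - 3) / 4"

definition dn_g :: "real \<Rightarrow> real \<Rightarrow> real" where
  "dn_g \<alpha>\<^sub>3 \<omega> = 2 / sqrt (\<alpha>\<^sub>3 * (dn_alpha2 \<alpha>\<^sub>3 \<omega> - dn_alpha1 \<alpha>\<^sub>3 \<omega>))"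

definition dn_betasq :: "real \<Rightarrow> real \<Rightarrow> real" where
  "dn_betasq \<alpha>\<^sub>3 \<omega> = - (\<alpha>\<^sub>3 / dn_alpha1 \<alpha>\<^sub>3 \<omega>) * dn_ksq \<alpha>\<^sub>3 \<omega>"

definition dnoidal_wave :: "real \<Rightarrow> real \<Rightarrow> real \<Rightarrow> real" where
  "dnoidal_wave \<omega> \<alpha>\<^sub>3 x =
     sqrt \<alpha>\<^sub>3 * jacobi_dn (2 / (sqrt 3 * dn_g \<alpha>\<^sub>3 \<omega>) * x) (dn_k \<alpha>\<^sub>3 \<omega>)
       / sqrt (1 + dn_betasq \<alpha>\<^sub>3 \<omega> * (jacobi_sn (2 / (sqrt 3 * dn_g \<alpha>\<^sub>3 \<omega>) * x) (dn_k \<alpha>\<^sub>3 \<omega>))\<^sup>2)"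

definition fundamental_period :: "(real \<Rightarrow> real) \<Rightarrow> real \<Rightarrow> bool" where
  "fundamental_period f L \<longleftrightarrow>
     0 < L \<and> (\<forall>x. f (x + L) = f x) \<and> (\<forall>p. 0 < p \<and> p < L \<longrightarrow> \<not> (\<forall>x. f (x + p) = f x))"

definition solves_profile_ode :: "real \<Rightarrow> (real \<Rightarrow> real) \<Rightarrow> bool" where
  "solves_profile_ode \<omega> \<phi> \<longleftrightarrow>
     (\<forall>x. \<phi> differentiable (at x) \<and> deriv \<phi> differentiable (at x) \<and>
          - deriv (deriv \<phi>) x + \<omega> * \<phi> x - \<phi> x ^ 3 - \<phi> x ^ 5 = 0)"

section \<open>Periodic Sobolev spaces and smooth maps\<close>

definition fourier_coeff :: "real \<Rightarrow> (real \<Rightarrow> real) \<Rightarrow> int \<Rightarrow> complex" where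
  "fourier_coeff L f m =
     (1 / L) *\<^sub>R (LINT x:{0..L}|lborel. complex_of_real (f x) * cis (- (2 * pi * of_int m * x / L)))"

text \<open>\<open>Hper n L\<close> is the space of real-valued \<open>L\<close>-periodic functions with
  \<open>L * (\<Sum>m. (1 + m\<^sup>2)^n * |f^(m)|\<^sup>2) < \<infinity>\<close>, given by representatives rather than by almost-everywhere
  classes; \<open>Hper_norm\<close> is its norm, and is meaningful only on members of \<open>Hper n L\<close>.\<close>

definition Hper :: "nat \<Rightarrow> real \<Rightarrow> (real \<Rightarrow> real) set" where
  "Hper n L = {f. f \<in> borel_measurable lborel \<and> (\<forall>x. f (x + L) = f x) \<and>
     set_integrable lborel {0..L} (\<lambda>x. (f x)\<^sup>2) \<and>
     (\<lambda>m::int. (1 + (of_int m)\<^sup>2) ^ n * (cmod (fourier_coeff L f m))\<^sup>2) summable_on UNIV}"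

definition Hper_norm :: "nat \<Rightarrow> real \<Rightarrow> (real \<Rightarrow> real) \<Rightarrow> real" where
  "Hper_norm n L f =
     sqrt (L * (\<Sum>\<^sub>\<infinity>m::int. (1 + (of_int m)\<^sup>2) ^ n * (cmod (fourier_coeff L f m))\<^sup>2))"

definition has_Hper_derivative ::
  "nat \<Rightarrow> real \<Rightarrow> (real \<Rightarrow> real \<Rightarrow> real) \<Rightarrow> (real \<Rightarrow> real) \<Rightarrow> real \<Rightarrow> bool" where
  "has_Hper_derivative n L F D \<omega> \<longleftrightarrow>
     ((\<lambda>h. Hper_norm n L (\<lambda>x. (F (\<omega> + h) x - F \<omega> x) / h - D x)) \<longlongrightarrow> 0) (at 0)"

text \<open>Infinitely differentiable curves from an open set \<open>I\<close> of parameters into the normed space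
  \<open>Hper n L\<close>; \<open>\<Phi> j\<close> is the derivative of order \<open>j\<close>.\<close>

definition smooth_Hper_curve :: "nat \<Rightarrow> real \<Rightarrow> real set \<Rightarrow> (real \<Rightarrow> real \<Rightarrow> real) \<Rightarrow> bool" where
  "smooth_Hper_curve n L I F \<longleftrightarrow>
     (\<exists>\<Phi> :: nat \<Rightarrow> real \<Rightarrow> real \<Rightarrow> real. (\<forall>\<omega>\<in>I. \<Phi> 0 \<omega> = F \<omega>) \<and>
        (\<forall>j. \<forall>\<omega>\<in>I. \<Phi> j \<omega> \<in> Hper n L \<and> has_Hper_derivative n L (\<Phi> j) (\<Phi> (Suc j) \<omega>) \<omega>))"

definition smooth_real_on :: "real set \<Rightarrow> (real \<Rightarrow> real) \<Rightarrow> bool" where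
  "smooth_real_on I f \<longleftrightarrow> (\<forall>j. \<forall>x\<in>I. (deriv ^^ j) f differentiable (at x))"

section \<open>Branches of constant period\<close>

definition open_interval_around :: "real \<Rightarrow> real set \<Rightarrow> bool" where
  "open_interval_around c I \<longleftrightarrow> open I \<and> is_interval I \<and> c \<in> I"

text \<open>The condition \<open>\<Lambda> \<omega> \<in> alpha3_range \<omega>\<close> expresses that the pair \<open>(\<Lambda> \<omega>, \<omega>)\<close> lies in the domain on
  which \<open>dn_T\<close> and the dnoidal wave are defined.\<close>

definition period_branch ::
  "real \<Rightarrow> real \<Rightarrow> real \<Rightarrow> real set \<Rightarrow> real set \<Rightarrow> (real \<Rightarrow> real) \<Rightarrow> bool" where
  "period_branch L \<omega>\<^sub>0 a\<^sub>0 I\<^sub>1 I\<^sub>2 \<Lambda> \<longleftrightarrow>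
     \<Lambda> \<in> I\<^sub>1 \<rightarrow> I\<^sub>2 \<and> smooth_real_on I\<^sub>1 \<Lambda> \<and> \<Lambda> \<omega>\<^sub>0 = a\<^sub>0 \<and>
     (\<forall>\<omega>\<in>I\<^sub>1. \<Lambda> \<omega> \<in> alpha3_range \<omega> \<and> dn_T (\<Lambda> \<omega>) \<omega> = L \<and> dn_ksq (\<Lambda> \<omega>) \<omega> \<in> {0<..<1})"

definition unique_period_branch ::
  "real \<Rightarrow> real \<Rightarrow> real \<Rightarrow> real set \<Rightarrow> real set \<Rightarrow> (real \<Rightarrow> real) \<Rightarrow> bool" where
  "unique_period_branch L \<omega>\<^sub>0 a\<^sub>0 I\<^sub>1 I\<^sub>2 \<Lambda> \<longleftrightarrow>
     open_interval_around \<omega>\<^sub>0 I\<^sub>1 \<and> open_interval_around a\<^sub>0 I\<^sub>2 \<and>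
     period_branch L \<omega>\<^sub>0 a\<^sub>0 I\<^sub>1 I\<^sub>2 \<Lambda> \<and>
     (\<forall>\<Lambda>'. period_branch L \<omega>\<^sub>0 a\<^sub>0 I\<^sub>1 I\<^sub>2 \<Lambda>' \<longrightarrow> (\<forall>\<omega>\<in>I\<^sub>1. \<Lambda>' \<omega> = \<Lambda> \<omega>))"

definition smooth_dnoidal_family :: "real \<Rightarrow> real set \<Rightarrow> (real \<Rightarrow> real) \<Rightarrow> bool" where
  "smooth_dnoidal_family L I\<^sub>1 \<Lambda> \<longleftrightarrow>
     (\<forall>\<omega>\<in>I\<^sub>1. fundamental_period (dnoidal_wave \<omega> (\<Lambda> \<omega>)) L \<and>
              solves_profile_ode \<omega> (dnoidal_wave \<omega> (\<Lambda> \<omega>))) \<and>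
     (\<forall>n. smooth_Hper_curve n L I\<^sub>1 (\<lambda>\<omega>. dnoidal_wave \<omega> (\<Lambda> \<omega>)))"

text \<open>At the lower end of \<open>alpha3_range \<omega>\<close> the modulus vanishes, and there
  \<open>dn_T\<close> tends to \<open>sqrt 2 * pi / (sqrt a * (1 + 4 * \<omega>) powr (1/4)) = 2 * pi / sqrt (2 * a + 4 * a\<^sup>2)\<close> with
  \<open>a = (sqrt (1 + 4 * \<omega>) - 1) / 2\<close>. This limit equals \<open>L\<close> exactly when \<open>\<omega>\<close> is the number below; hence
  the squares on \<open>pi\<close>: with \<open>pi\<close> in place of \<open>pi\<^sup>2\<close> there would be values of \<open>\<omega>\<close> above the threshold
  without any wave of period \<open>L\<close>.\<close>

definition omega_threshold :: "real \<Rightarrow> real" where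
  "omega_threshold L = sqrt (L\<^sup>2 + 16 * pi\<^sup>2) / (8 * L) + pi\<^sup>2 / L\<^sup>2 - 1 / 8"

end

theory Submission
  imports Defs
begin

text \<open>
  With \<open>a = \<alpha>\<^sub>3\<close> and \<open>b = sqrt 3 * sqrt q\<close> the period is
  \<open>2 * sqrt 6 * J(S, D)\<close>, \<open>J(S, D)\<close> being the integral of \<open>1 / sqrt (S + D cos 2t)\<close> over \<open>[0, pi/2]\<close>,
  where \<open>S\<close> decreases and \<open>D > 0\<close> increases in \<open>a\<close>. As \<open>J\<close> decreases in \<open>S\<close> and increases in \<open>D\<close>,
  the period has a positive \<open>a\<close>-derivative. At the lower end of the range \<open>D = 0\<close> and the period
  is below \<open>L\<close> exactly above the threshold; at the upper end \<open>S - D\<close> tends to \<open>0\<close> and the period blows up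
  logarithmically. So there is exactly one \<open>a\<close> of period \<open>L\<close> for every admissible \<open>\<omega>\<close>, and the implicit
  function theorem makes it smooth on the whole half-line.

  The amplitude is smooth in its argument and the squared modulus, again by the implicit function theorem.
  Hence the wave is jointly smooth in \<open>(\<omega>, x)\<close>, and since Fourier coefficients of a periodic
  function are bounded by negative powers of their index times suprema of its derivatives, the locally uniform convergence
  of \<open>\<omega>\<close>-difference quotients of all \<open>x\<close>-derivatives gives smoothness into every Sobolev space.
\<close>

section \<open>Smooth functions of several variables\<close>

text \<open>In the formula \<open>K(k) / sqrt (a b)\<close> the factors compete: \<open>K\<close>
  grows with \<open>a\<close>, but near the lower end of the range \<open>a b\<close> grows as well,
  so the sign of the derivative cannot be read off. Absorbing the prefactor into the integrand
  resolves this, because \<open>S\<close> and \<open>D\<close> have derivatives of fixed sign. It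
  also makes the lower end an ordinary point: \<open>J\<close> is smooth on the whole cone
  \<open>|D| < S\<close>, which contains \<open>D = 0\<close>, so the endpoint period is a value of
  \<open>J\<close> and not merely a limit. Uniqueness of \<open>a\<close> is used twice. It
  identifies the local solutions of the implicit function theorem with one function defined
  beforehand, so no local branches have to be glued, and it yields uniqueness of the branch with the
  whole line as target interval. In the Sobolev part, mixed partial derivatives commute, so the
  \<open>x\<close>-derivatives of the remainder of an \<open>\<omega>\<close>-difference quotient
  are again such remainders. One estimate by suprema therefore serves all orders, in
  \<open>n\<close> and in \<open>\<omega>\<close>.\<close>

text \<open>Derivatives are required direction by direction, so every level of the recursion
  concerns functions with values in the same space \<open>'b\<close>, and no tower of spaces of
  linear maps arises.\<close>

primrec Ck_on :: "nat \<Rightarrow> 'a::real_normed_vector set \<Rightarrow> ('a \<Rightarrow> 'b::real_normed_vector) \<Rightarrow> bool" where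
  "Ck_on 0 U f \<longleftrightarrow> continuous_on U f"
| "Ck_on (Suc n) U f \<longleftrightarrow>
     (\<exists>f'. (\<forall>x\<in>U. (f has_derivative f' x) (at x)) \<and> (\<forall>v. Ck_on n U (\<lambda>x. f' x v)))"

definition smooth_on :: "'a::real_normed_vector set \<Rightarrow> ('a \<Rightarrow> 'b::real_normed_vector) \<Rightarrow> bool" where
  "smooth_on U f \<longleftrightarrow> (\<forall>n. Ck_on n U f)"

lemma Ck_on_continuous_on: "Ck_on n U f \<Longrightarrow> continuous_on U f"
  by (cases n) (auto intro!: continuous_at_imp_continuous_on dest: has_derivative_continuous)

lemma Ck_on_SucD: "Ck_on (Suc n) U f \<Longrightarrow> Ck_on n U f"
proof (induction n arbitrary: f)
  case 0
  then show ?case using Ck_on_continuous_on[of "Suc 0" U f] by simp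
next
  case (Suc n)
  from Suc.prems obtain f' where f': "\<forall>x\<in>U. (f has_derivative f' x) (at x)"
    "\<And>v. Ck_on (Suc n) U (\<lambda>x. f' x v)" unfolding Ck_on.simps(2)[of "Suc n"] by blast
  have "\<And>v. Ck_on n U (\<lambda>x. f' x v)" using Suc.IH f'(2) by blast
  with f'(1) show ?case unfolding Ck_on.simps by blast
qed

lemma Ck_on_cong:
  assumes "open U" "\<And>x. x \<in> U \<Longrightarrow> f x = g x" "Ck_on n U f"
  shows "Ck_on n U g"
proof (cases n)
  case 0
  then show ?thesis using assms continuous_on_cong[of U U f g] by simp
next
  case (Suc m)
  then obtain f' where f': "\<forall>x\<in>U. (f has_derivative f' x) (at x)" "\<forall>v. Ck_on m U (\<lambda>x. f' x v)"
    using assms(3) by auto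
  have "\<forall>x\<in>U. (g has_derivative f' x) (at x)"
    using has_derivative_transform_within_open[OF _ assms(1)] f'(1) assms(2) by blast
  then show ?thesis using f'(2) Suc by auto
qed

lemma Ck_on_const: "Ck_on n U (\<lambda>x. c)"
proof (induction n arbitrary: c)
  case (Suc n)
  have "\<forall>x\<in>U. ((\<lambda>x. c) has_derivative (\<lambda>v. 0)) (at x)" by simp
  then show ?case using Suc.IH[of 0] unfolding Ck_on.simps by (intro exI[of _ "\<lambda>x v. 0"]) simp
qed simp

lemma Ck_on_bounded_linear:
  assumes "bounded_linear f" shows "Ck_on n U f"
proof (cases n)
  case 0
  then show ?thesis using assms by (simp add: linear_continuous_on)
next
  case (Suc m)
  have "\<forall>x\<in>U. (f has_derivative f) (at x)" using assms bounded_linear_imp_has_derivative by blast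
  then show ?thesis unfolding Suc Ck_on.simps using Ck_on_const
    by (intro exI[of _ "\<lambda>x. f"]) blast
qed

lemma Ck_on_bounded_linear_compose:
  assumes "bounded_linear L"
  shows "Ck_on n U f \<Longrightarrow> Ck_on n U (\<lambda>x. L (f x))"
proof (induction n arbitrary: f)
  case 0
  then show ?case using assms by (simp add: bounded_linear.continuous_on)
next
  case (Suc n)
  then obtain f' where f': "\<forall>x\<in>U. (f has_derivative f' x) (at x)" "\<forall>v. Ck_on n U (\<lambda>x. f' x v)"
    by auto
  have "\<forall>x\<in>U. ((\<lambda>x. L (f x)) has_derivative (\<lambda>v. L (f' x v))) (at x)"
    using f'(1) bounded_linear.has_derivative[OF assms] by blast
  then show ?case unfolding Ck_on.simps using f'(2) Suc.IH by (intro exI[of _ "\<lambda>x v. L (f' x v)"]) blast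
qed

lemma Ck_on_add: "Ck_on n U f \<Longrightarrow> Ck_on n U g \<Longrightarrow> Ck_on n U (\<lambda>x. f x + g x)"
proof (induction n arbitrary: f g)
  case 0
  then show ?case by (simp add: continuous_on_add)
next
  case (Suc n)
  obtain f' g' where f': "\<forall>x\<in>U. (f has_derivative f' x) (at x)" "\<And>v. Ck_on n U (\<lambda>x. f' x v)"
    and g': "\<forall>x\<in>U. (g has_derivative g' x) (at x)" "\<And>v. Ck_on n U (\<lambda>x. g' x v)"
    using Suc.prems by auto
  have "\<forall>x\<in>U. ((\<lambda>x. f x + g x) has_derivative (\<lambda>v. f' x v + g' x v)) (at x)"
    using f'(1) g'(1) has_derivative_add by blast
  then show ?case unfolding Ck_on.simps using f'(2) g'(2) Suc.IH
    by (intro exI[of _ "\<lambda>x v. f' x v + g' x v"]) blast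
qed

lemma Ck_on_sum:
  "(\<And>i. i \<in> I \<Longrightarrow> Ck_on n U (f i)) \<Longrightarrow> Ck_on n U (\<lambda>x. \<Sum>i\<in>I. f i x)"
  by (induction I rule: infinite_finite_induct) (auto intro: Ck_on_const Ck_on_add)

lemma Ck_on_bilinear:
  assumes "bounded_bilinear B"
  shows "Ck_on n U f \<Longrightarrow> Ck_on n U g \<Longrightarrow> Ck_on n U (\<lambda>x. B (f x) (g x))"
proof (induction n arbitrary: f g)
  case 0
  then show ?case using bounded_bilinear.continuous_on[OF assms] by simp
next
  case (Suc n)
  obtain f' g' where f': "\<forall>x\<in>U. (f has_derivative f' x) (at x)" "\<And>v. Ck_on n U (\<lambda>x. f' x v)"
    and g': "\<forall>x\<in>U. (g has_derivative g' x) (at x)" "\<And>v. Ck_on n U (\<lambda>x. g' x v)"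
    using Suc.prems by auto
  have "\<forall>x\<in>U. ((\<lambda>x. B (f x) (g x)) has_derivative (\<lambda>v. B (f x) (g' x v) + B (f' x v) (g x))) (at x)"
    using f'(1) g'(1) bounded_bilinear.FDERIV[OF assms] by blast
  moreover have "Ck_on n U (\<lambda>x. B (f x) (g' x v) + B (f' x v) (g x))" for v
    using Suc.prems by (intro Ck_on_add Suc.IH Ck_on_SucD[of n] f'(2) g'(2))
  ultimately show ?case unfolding Ck_on.simps
    by (intro exI[of _ "\<lambda>x v. B (f x) (g' x v) + B (f' x v) (g x)"]) blast
qed

lemma Ck_on_Pair: "Ck_on n U f \<Longrightarrow> Ck_on n U g \<Longrightarrow> Ck_on n U (\<lambda>x. (f x, g x))"
proof (induction n arbitrary: f g)
  case 0
  then show ?case by (simp add: continuous_on_Pair)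
next
  case (Suc n)
  obtain f' g' where f': "\<forall>x\<in>U. (f has_derivative f' x) (at x)" "\<And>v. Ck_on n U (\<lambda>x. f' x v)"
    and g': "\<forall>x\<in>U. (g has_derivative g' x) (at x)" "\<And>v. Ck_on n U (\<lambda>x. g' x v)"
    using Suc.prems by auto
  have "\<forall>x\<in>U. ((\<lambda>x. (f x, g x)) has_derivative (\<lambda>v. (f' x v, g' x v))) (at x)"
    using f'(1) g'(1) has_derivative_Pair by blast
  then show ?case unfolding Ck_on.simps using f'(2) g'(2) Suc.IH
    by (intro exI[of _ "\<lambda>x v. (f' x v, g' x v)"]) blast
qed

text \<open>The chain rule produces \<open>F' (g x) (g' x v)\<close>, whose direction moves with
  \<open>x\<close>, whereas \<open>Ck_on\<close> controls \<open>F'\<close> only in fixed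
  directions. Expanding \<open>g' x v\<close> in \<open>Basis\<close> repairs this; hence the
  Euclidean middle space.\<close>

lemma Ck_on_compose:
  fixes F :: "'b::euclidean_space \<Rightarrow> 'c::real_normed_vector"
  shows "Ck_on n V F \<Longrightarrow> Ck_on n U g \<Longrightarrow> (\<And>x. x \<in> U \<Longrightarrow> g x \<in> V) \<Longrightarrow> Ck_on n U (\<lambda>x. F (g x))"
proof (induction n arbitrary: F)
  case 0
  then show ?case by (auto intro: continuous_on_compose2)
next
  case (Suc n)
  obtain F' g' where F': "\<forall>x\<in>V. (F has_derivative F' x) (at x)" "\<And>v. Ck_on n V (\<lambda>x. F' x v)"
    and g': "\<forall>x\<in>U. (g has_derivative g' x) (at x)" "\<And>v. Ck_on n U (\<lambda>x. g' x v)"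
    using Suc.prems by auto
  let ?D = "\<lambda>x v. \<Sum>i\<in>Basis. (g' x v \<bullet> i) *\<^sub>R F' (g x) i"
  have "((\<lambda>x. F (g x)) has_derivative ?D x) (at x)" if x: "x \<in> U" for x
  proof -
    have h: "(F has_derivative F' (g x)) (at (g x))" using F'(1) Suc.prems(3) x by blast
    have "((\<lambda>x. F (g x)) has_derivative (\<lambda>v. F' (g x) (g' x v))) (at x)"
      by (rule has_derivative_compose[where f = g and g = F, OF _ h]) (use g'(1) x in blast)
    moreover have "(\<lambda>v. F' (g x) (g' x v)) = ?D x"
    proof
      fix v
      define w where "w = g' x v"
      have l: "linear (F' (g x))" using h has_derivative_linear by blast
      have "F' (g x) w = F' (g x) (\<Sum>i\<in>Basis. (w \<bullet> i) *\<^sub>R i)" by (simp add: euclidean_representation)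
      also have "\<dots> = (\<Sum>i\<in>Basis. (w \<bullet> i) *\<^sub>R F' (g x) i)"
        by (simp add: linear_sum[OF l] linear_cmul[OF l])
      finally show "F' (g x) (g' x v) = ?D x v" unfolding w_def .
    qed
    ultimately show ?thesis by metis
  qed
  moreover have "Ck_on n U (\<lambda>x. ?D x v)" for v
    by (intro Ck_on_sum Ck_on_bilinear[OF bounded_bilinear_scaleR] Suc.IH F'(2) Suc.prems(3)
        Ck_on_SucD[OF Suc.prems(2)]
        Ck_on_bounded_linear_compose[OF bounded_linear_inner_left] g'(2))
  ultimately show ?case unfolding Ck_on.simps by (intro exI[of _ ?D]) blast
qed

lemma Ck_on_mult:
  fixes f g :: "'a::real_normed_vector \<Rightarrow> real"
  shows "Ck_on n U f \<Longrightarrow> Ck_on n U g \<Longrightarrow> Ck_on n U (\<lambda>x. f x * g x)"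
  by (rule Ck_on_bilinear[OF bounded_bilinear_mult])

lemma Ck_on_minus: "Ck_on n U f \<Longrightarrow> Ck_on n U (\<lambda>x. - f x)"
  by (rule Ck_on_bounded_linear_compose[OF bounded_linear_minus[OF bounded_linear_ident]])

text \<open>The induction closes because the derivative is a polynomial in \<open>inverse\<close>
  itself.\<close>

lemma Ck_on_inverse_real: "Ck_on n (- {0}) (inverse :: real \<Rightarrow> real)"
proof (induction n)
  case 0
  show ?case by (simp add: continuous_on_inverse)
next
  case (Suc n)
  have "\<forall>x\<in>-{0}. (inverse has_derivative (\<lambda>v::real. - (inverse x * v * inverse x))) (at x)"
    using has_derivative_inverse'[where S = UNIV] by auto
  moreover have "Ck_on n (-{0}) (\<lambda>x::real. - (inverse x * v * inverse x))" for v
    by (intro Ck_on_minus Ck_on_mult Suc Ck_on_const)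
  ultimately show ?case unfolding Ck_on.simps
    by (intro exI[of _ "\<lambda>x v. - (inverse x * v * inverse x)"]) blast
qed

lemma Ck_on_sqrt_real: "Ck_on n {0<..} sqrt"
proof (induction n)
  case 0
  show ?case by (simp add: continuous_on_real_sqrt)
next
  case (Suc n)
  have "\<forall>x\<in>{0<..}. (sqrt has_derivative (\<lambda>v. v * (inverse (sqrt x) / 2))) (at x)"
    by (auto intro!: has_derivative_eq_rhs[OF DERIV_real_sqrt[unfolded has_field_derivative_def]])
  moreover have "Ck_on n {0<..} (\<lambda>x. v * (inverse (sqrt x) / 2))" for v
    unfolding divide_inverse
    by (intro Ck_on_mult Ck_on_const Ck_on_compose[OF Ck_on_inverse_real] Suc) auto
  ultimately show ?case unfolding Ck_on.simps
    by (intro exI[of _ "\<lambda>x v. v * (inverse (sqrt x) / 2)"]) blast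
qed

text \<open>A joint induction, since each function is the derivative of the other up to
  sign.\<close>

lemma Ck_on_sin_cos_real: "Ck_on n UNIV (sin :: real \<Rightarrow> real) \<and> Ck_on n UNIV (cos :: real \<Rightarrow> real)"
proof (induction n)
  case 0
  show ?case by (simp add: continuous_on_sin continuous_on_cos)
next
  case (Suc n)
  have s: "\<forall>x\<in>UNIV. (sin has_derivative (\<lambda>v. v * cos x)) (at (x::real))"
    by (auto intro!: derivative_eq_intros)
  have c: "\<forall>x\<in>UNIV. (cos has_derivative (\<lambda>v. v * - sin x)) (at (x::real))"
    by (auto intro!: derivative_eq_intros)
  have s': "Ck_on n UNIV (\<lambda>x::real. v * cos x)" for v
    using Suc by (intro Ck_on_mult Ck_on_const) auto
  have c': "Ck_on n UNIV (\<lambda>x::real. v * - sin x)" for v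
    using Suc by (intro Ck_on_mult Ck_on_const Ck_on_minus) auto
  show ?case unfolding Ck_on.simps
    by (intro conjI exI[of _ "\<lambda>x v. v * cos x"] exI[of _ "\<lambda>x v. v * - sin x"] allI s s' c c')
qed

section \<open>Closure properties of infinitely differentiable maps\<close>

lemma smooth_on_continuous_on: "smooth_on U f \<Longrightarrow> continuous_on U f"
  unfolding smooth_on_def using Ck_on_continuous_on by blast

lemma smooth_on_cong:
  "open U \<Longrightarrow> (\<And>x. x \<in> U \<Longrightarrow> f x = g x) \<Longrightarrow> smooth_on U f \<Longrightarrow> smooth_on U g"
  unfolding smooth_on_def using Ck_on_cong by blast

lemma smooth_on_bounded_linear: "bounded_linear f \<Longrightarrow> smooth_on U f"
  unfolding smooth_on_def using Ck_on_bounded_linear by blast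

lemma smooth_on_compose:
  fixes F :: "'b::euclidean_space \<Rightarrow> 'c::real_normed_vector"
  assumes "smooth_on V F" "smooth_on U g" "\<And>x. x \<in> U \<Longrightarrow> g x \<in> V"
  shows "smooth_on U (\<lambda>x. F (g x))"
  using assms unfolding smooth_on_def by (metis Ck_on_compose)

named_theorems smooth_intros

lemma smooth_on_const [smooth_intros]: "smooth_on U (\<lambda>x. c)"
  unfolding smooth_on_def using Ck_on_const by blast

lemma smooth_on_ident [smooth_intros]: "smooth_on U (\<lambda>x. x)"
  by (rule smooth_on_bounded_linear[OF bounded_linear_ident])

lemma smooth_on_fst [smooth_intros]: "smooth_on U fst"
  and smooth_on_snd [smooth_intros]: "smooth_on U snd"
  by (auto intro!: smooth_on_bounded_linear bounded_linear_fst bounded_linear_snd)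

lemma smooth_on_fst' [smooth_intros]: "smooth_on U f \<Longrightarrow> smooth_on U (\<lambda>x. fst (f x))"
  and smooth_on_snd' [smooth_intros]: "smooth_on U f \<Longrightarrow> smooth_on U (\<lambda>x. snd (f x))"
  unfolding smooth_on_def
  by (auto intro!: Ck_on_bounded_linear_compose[OF bounded_linear_fst]
      Ck_on_bounded_linear_compose[OF bounded_linear_snd])

lemma smooth_on_Pair [smooth_intros]:
  "smooth_on U f \<Longrightarrow> smooth_on U g \<Longrightarrow> smooth_on U (\<lambda>x. (f x, g x))"
  unfolding smooth_on_def using Ck_on_Pair by blast

lemma smooth_on_add [smooth_intros]:
  "smooth_on U f \<Longrightarrow> smooth_on U g \<Longrightarrow> smooth_on U (\<lambda>x. f x + g x)"
  unfolding smooth_on_def using Ck_on_add by blast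

lemma smooth_on_minus [smooth_intros]: "smooth_on U f \<Longrightarrow> smooth_on U (\<lambda>x. - f x)"
  unfolding smooth_on_def using Ck_on_minus by blast

lemma smooth_on_diff [smooth_intros]:
  "smooth_on U f \<Longrightarrow> smooth_on U g \<Longrightarrow> smooth_on U (\<lambda>x. f x - g x)"
  using smooth_on_add[of U f "\<lambda>x. - g x"] smooth_on_minus[of U g] by simp

lemma smooth_on_mult [smooth_intros]:
  fixes f g :: "'a::real_normed_vector \<Rightarrow> real"
  shows "smooth_on U f \<Longrightarrow> smooth_on U g \<Longrightarrow> smooth_on U (\<lambda>x. f x * g x)"
  unfolding smooth_on_def using Ck_on_mult by blast

lemma smooth_on_power [smooth_intros]:
  fixes f :: "'a::real_normed_vector \<Rightarrow> real"
  shows "smooth_on U f \<Longrightarrow> smooth_on U (\<lambda>x. f x ^ n)"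
  by (induction n) (simp_all add: smooth_on_const smooth_on_mult)

lemma smooth_on_inverse [smooth_intros]:
  fixes f :: "'a::real_normed_vector \<Rightarrow> real"
  assumes "smooth_on U f" "\<And>x. x \<in> U \<Longrightarrow> f x \<noteq> 0"
  shows "smooth_on U (\<lambda>x. inverse (f x))"
  using assms smooth_on_compose[of "-{0}" inverse U f] Ck_on_inverse_real
  by (auto simp: smooth_on_def)

lemma smooth_on_divide [smooth_intros]:
  fixes f g :: "'a::real_normed_vector \<Rightarrow> real"
  assumes "smooth_on U f" "smooth_on U g" "\<And>x. x \<in> U \<Longrightarrow> g x \<noteq> 0"
  shows "smooth_on U (\<lambda>x. f x / g x)"
  unfolding divide_inverse by (intro smooth_intros assms)

lemma smooth_on_sqrt [smooth_intros]:
  assumes "smooth_on U f" "\<And>x. x \<in> U \<Longrightarrow> f x > 0"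
  shows "smooth_on U (\<lambda>x. sqrt (f x))"
  using assms smooth_on_compose[of "{0<..}" sqrt U f] Ck_on_sqrt_real
  by (auto simp: smooth_on_def)

lemma smooth_on_sin [smooth_intros]:
  fixes f :: "'a::real_normed_vector \<Rightarrow> real"
  assumes "smooth_on U f" shows "smooth_on U (\<lambda>x. sin (f x))"
  using assms smooth_on_compose[of UNIV sin U f] Ck_on_sin_cos_real by (auto simp: smooth_on_def)

lemma smooth_on_cos [smooth_intros]:
  fixes f :: "'a::real_normed_vector \<Rightarrow> real"
  assumes "smooth_on U f" shows "smooth_on U (\<lambda>x. cos (f x))"
  using assms smooth_on_compose[of UNIV cos U f] Ck_on_sin_cos_real by (auto simp: smooth_on_def)

text \<open>The direction comes first so that \<open>dir_deriv v\<close> is an operator on functions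
  and can be iterated with \<open>^^\<close>.\<close>

definition dir_deriv :: "'a \<Rightarrow> ('a::real_normed_vector \<Rightarrow> 'b::real_normed_vector) \<Rightarrow> 'a \<Rightarrow> 'b" where
  "dir_deriv v f x = frechet_derivative f (at x) v"

lemma smooth_on_has_derivative:
  assumes "smooth_on U f" "x \<in> U"
  shows "(f has_derivative (\<lambda>v. dir_deriv v f x)) (at x)"
proof -
  have "Ck_on (Suc 0) U f" using assms(1) unfolding smooth_on_def by blast
  then have "f differentiable (at x)" using assms(2) by (auto simp: differentiable_def)
  then show ?thesis unfolding dir_deriv_def using frechet_derivative_works by fastforce
qed

lemma dir_deriv_unique: "(f has_derivative f') (at x) \<Longrightarrow> dir_deriv v f x = f' v"
  unfolding dir_deriv_def using frechet_derivative_at by metis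

lemma smooth_on_dir_deriv [smooth_intros]:
  assumes "open U" "smooth_on U f" shows "smooth_on U (dir_deriv v f)"
  unfolding smooth_on_def
proof
  fix n
  have "Ck_on (Suc n) U f" using assms(2) unfolding smooth_on_def by blast
  then obtain f' where f': "\<forall>x\<in>U. (f has_derivative f' x) (at x)" "\<forall>v. Ck_on n U (\<lambda>x. f' x v)"
    by auto
  show "Ck_on n U (dir_deriv v f)"
    by (rule Ck_on_cong[OF assms(1) _ spec[OF f'(2), of v]]) (use f'(1) dir_deriv_unique in metis)
qed

section \<open>Integrals depending on a parameter\<close>

text \<open>On a finite-dimensional domain continuity in each fixed direction already gives
  continuity in operator norm, the form in which the Leibniz rule and the inverse function theorem
  expect derivatives.\<close>

lemma continuous_on_Blinfun:
  fixes f' :: "'c::t2_space \<Rightarrow> 'a::euclidean_space \<Rightarrow> 'b::real_normed_vector"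
  assumes "\<And>x. x \<in> U \<Longrightarrow> bounded_linear (f' x)" "\<And>v. continuous_on U (\<lambda>x. f' x v)"
  shows "continuous_on U (\<lambda>x. Blinfun (f' x))"
proof (rule continuous_on_blinfun_componentwise)
  fix i :: 'a assume "i \<in> Basis"
  show "continuous_on U (\<lambda>x. blinfun_apply (Blinfun (f' x)) i)"
    using assms(2)[of i] by (rule continuous_on_eq) (simp add: assms(1) bounded_linear_Blinfun_apply)
qed

text \<open>The Leibniz rule in directional form: a parameter direction \<open>v\<close> is the
  joint direction \<open>(v, 0)\<close>. The integration variable ranges over \<open>UNIV\<close>,
  so that derivatives of \<open>g\<close> are two-sided even at the limits \<open>a\<close> and
  \<open>b\<close>.\<close>

lemma has_derivative_parametric_integral:
  fixes g :: "'a::euclidean_space \<times> real \<Rightarrow> real"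
  assumes "open U" and d: "\<And>x. x \<in> U \<times> UNIV \<Longrightarrow> (g has_derivative g' x) (at x)"
    and c: "\<And>v. continuous_on (U \<times> UNIV) (\<lambda>x. g' x v)" and x0: "x0 \<in> U"
  shows "((\<lambda>x. integral {a..b} (\<lambda>t. g (x, t))) has_derivative
    (\<lambda>v. integral {a..b} (\<lambda>t. g' (x0, t) (v, 0)))) (at x0)"
proof -
  let ?D = "\<lambda>x v. integral {a..b} (\<lambda>t. g' (x, t) (v, 0))"
  have cg: "continuous_on (U \<times> UNIV) g"
    using d by (intro continuous_at_imp_continuous_on) (auto intro: has_derivative_continuous)
  obtain e where e: "e > 0" "ball x0 e \<subseteq> U" using assms x0 open_contains_ball by blast
  \<comment> \<open>The Leibniz rule asks for a convex parameter set, which \<open>U\<close> need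
    not be.\<close>
  let ?B = "ball x0 e"
  define h where "h = (\<lambda>x t. Blinfun (\<lambda>v. g' (x, t) (v, 0)))"
  have bl: "bounded_linear (\<lambda>v. g' (x, t) (v, 0))" if "x \<in> U" for x t
    using bounded_linear_compose[OF has_derivative_bounded_linear[OF d]
        bounded_linear_Pair[OF bounded_linear_ident bounded_linear_zero]] that by simp
  have app: "blinfun_apply (h x t) v = g' (x, t) (v, 0)" if "x \<in> U" for x t v
    unfolding h_def using bl[OF that] by (simp add: bounded_linear_Blinfun_apply)
  have cont: "continuous_on (U \<times> UNIV) (\<lambda>p. h (fst p) (snd p))"
    unfolding h_def
    using c bl
    by (intro continuous_on_Blinfun) auto
  have "((\<lambda>x. integral (cbox a b) (\<lambda>t. g (x, t))) has_derivative
      integral (cbox a b) (h x0)) (at x0 within ?B)"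
  proof (rule leibniz_rule)
    fix x t assume x: "x \<in> ?B"
    then have xU: "x \<in> U" using e by blast
    have "((\<lambda>x. g (x, t)) has_derivative (\<lambda>v. g' (x, t) (v, 0))) (at x)"
      by (rule has_derivative_compose[of "\<lambda>x. (x, t)" "\<lambda>v. (v, 0)" x UNIV g "g' (x, t)"])
        (use xU in \<open>auto intro!: derivative_eq_intros d\<close>)
    then show "((\<lambda>x. g (x, t)) has_derivative blinfun_apply (h x t)) (at x within ?B)"
      unfolding app[OF xU] by (rule has_derivative_at_withinI)
  next
    fix x assume x: "x \<in> ?B"
    then have "continuous_on (cbox a b) (\<lambda>t. g (x, t))"
      using e
      by (intro continuous_on_compose2[OF cg])
        (auto intro!: continuous_intros)
    then show "(\<lambda>t. g (x, t)) integrable_on cbox a b" by (rule integrable_continuous)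
  next
    show "continuous_on (?B \<times> cbox a b) (\<lambda>(x, t). h x t)"
      unfolding split_beta by (rule continuous_on_subset[OF cont]) (use e in auto)
  qed (use e in auto)
  then have "((\<lambda>x. integral {a..b} (\<lambda>t. g (x, t))) has_derivative
      integral {a..b} (h x0)) (at x0)"
    using e(1) by (simp add: at_within_open[OF _ open_ball])
  moreover have "blinfun_apply (integral {a..b} (h x0)) v = ?D x0 v" for v
  proof -
    have "continuous_on (cbox a b) (h x0)"
      using x0 continuous_on_compose2[OF cont continuous_on_Pair[OF continuous_on_const continuous_on_id],
          of x0 "cbox a b"]
      by auto
    then have "h x0 integrable_on {a..b}" using integrable_continuous by fastforce
    then show ?thesis
      using integral_linear[OF _ blinfun.bounded_linear_left, of "h x0" "{a..b}" v] app[OF x0]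
      by (simp add: o_def)
  qed
  then have "blinfun_apply (integral {a..b} (h x0)) = ?D x0" by (rule ext)
  ultimately show ?thesis by simp
qed

lemma Ck_on_integral:
  fixes g :: "'a::euclidean_space \<times> real \<Rightarrow> real"
  assumes "open U"
  shows "Ck_on n (U \<times> UNIV) g \<Longrightarrow> Ck_on n U (\<lambda>x. integral {a..b} (\<lambda>t. g (x, t)))"
proof (induction n arbitrary: g)
  case 0
  have "continuous_on (U \<times> cbox a b) (\<lambda>(x, t). g (x, t))"
    using 0 by (auto simp: split_beta intro: continuous_on_subset)
  then show ?case using integral_continuous_on_param[of U a b "\<lambda>x t. g (x, t)"] by simp
next
  case (Suc n)
  then obtain g' where g': "\<And>x. x \<in> U \<times> UNIV \<Longrightarrow> (g has_derivative g' x) (at x)"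
    "\<And>v. Ck_on n (U \<times> UNIV) (\<lambda>x. g' x v)" by auto
  let ?D = "\<lambda>x v. integral {a..b} (\<lambda>t. g' (x, t) (v, 0))"
  have "((\<lambda>x. integral {a..b} (\<lambda>t. g (x, t))) has_derivative ?D x0) (at x0)" if "x0 \<in> U" for x0
    by (rule has_derivative_parametric_integral[OF assms g'(1) Ck_on_continuous_on[OF g'(2)] that])
  moreover have "Ck_on n U (\<lambda>x. ?D x v)" for v
    by (rule Suc.IH) (rule g'(2))
  ultimately show ?case unfolding Ck_on.simps by (intro exI[of _ ?D]) blast
qed

lemma smooth_on_integral:
  fixes g :: "'a::euclidean_space \<times> real \<Rightarrow> real"
  assumes "open U" "smooth_on (U \<times> UNIV) g"
  shows "smooth_on U (\<lambda>x. integral {a..b} (\<lambda>t. g (x, t)))"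
  using assms Ck_on_integral unfolding smooth_on_def by blast

section \<open>The implicit function theorem for a given solution function\<close>

text \<open>The solution \<open>y\<close> is given on all of \<open>U\<close> and is the only zero
  over each point, so the conclusion is global. The inverse function theorem for
  \<open>(F, snd)\<close> gives differentiability of \<open>y\<close>; the formula for its
  derivative then gives all orders.\<close>

lemma smooth_on_implicit:
  fixes F :: "real \<times> 'a::euclidean_space \<Rightarrow> real"
  assumes U: "open U" and V: "open V" and F: "smooth_on V F"
    and y: "\<And>x. x \<in> U \<Longrightarrow> (y x, x) \<in> V" "\<And>x. x \<in> U \<Longrightarrow> F (y x, x) = 0"
    and uniq: "\<And>x t. x \<in> U \<Longrightarrow> (t, x) \<in> V \<Longrightarrow> F (t, x) = 0 \<Longrightarrow> t = y x"
    and nz: "\<And>x. x \<in> U \<Longrightarrow> dir_deriv (1, 0) F (y x, x) \<noteq> 0"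
  shows "smooth_on U y"
proof -
  let ?F' = "\<lambda>p v. dir_deriv v F p"
  have dF: "(F has_derivative ?F' p) (at p)" if "p \<in> V" for p
    by (rule smooth_on_has_derivative[OF F that])
  have split: "?F' p (s, v) = s * ?F' p (1, 0) + ?F' p (0, v)" if "p \<in> V" for p s v
  proof -
    have l: "linear (?F' p)" using dF[OF that] has_derivative_linear by blast
    have "?F' p (s, v) = ?F' p (s *\<^sub>R (1, 0) + (0, v))" by simp
    also have "\<dots> = s * ?F' p (1, 0) + ?F' p (0, v)"
      by (simp only: linear_add[OF l] linear_cmul[OF l] real_scaleR_def)
    finally show ?thesis .
  qed
  have ex: "\<exists>y'. (y has_derivative y') (at x0)" if x0: "x0 \<in> U" for x0
  proof -
    define p0 where "p0 = (y x0, x0)"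
    have p0: "p0 \<in> V" using y x0 p0_def by simp
    define f where "f = (\<lambda>p. (F p, snd p :: 'a))"
    define L where "L = (\<lambda>p v. (?F' p v, snd v :: 'a))"
    define a where "a = ?F' p0 (1, 0)"
    have a: "a \<noteq> 0" using nz[OF x0] by (simp add: a_def p0_def)
    have blF: "bounded_linear (?F' p)" if "p \<in> V" for p
      using dF[OF that] has_derivative_bounded_linear by blast
    have bl: "bounded_linear (L p)" if "p \<in> V" for p
      unfolding L_def by (intro bounded_linear_Pair bounded_linear_snd blF that)
    \<comment> \<open>\<open>M\<close> inverts \<open>L p0\<close>: the equation
      \<open>s * a + ?F' p0 (0, w) = r\<close> is solved for \<open>s\<close>, and this is where the
      nonvanishing partial derivative enters.\<close>
    define M where "M = (\<lambda>w :: real \<times> 'a. ((fst w - ?F' p0 (0, snd w)) / a, snd w))"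
    have "bounded_linear (\<lambda>w :: real \<times> 'a. ?F' p0 (0, snd w))"
      by (rule bounded_linear_compose[OF blF[OF p0]])
        (intro bounded_linear_Pair bounded_linear_snd bounded_linear_zero)
    then have blM: "bounded_linear M"
      unfolding M_def
      by (intro bounded_linear_Pair bounded_linear_snd
          bounded_linear_compose[OF bounded_linear_divide] bounded_linear_sub bounded_linear_fst)
    obtain U' W g g' where inv: "open U'" "U' \<subseteq> V" "p0 \<in> U'" "open W" "f p0 \<in> W"
        "homeomorphism U' W f g" "\<And>z. z \<in> W \<Longrightarrow> (g has_derivative (g' z)) (at z)"
    proof (rule inverse_function_theorem[of V f "\<lambda>p. Blinfun (L p)" p0 "Blinfun M"])
      show "(f has_derivative blinfun_apply (Blinfun (L p))) (at p)" if "p \<in> V" for p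
        unfolding bounded_linear_Blinfun_apply[OF bl[OF that]] unfolding L_def f_def
        by (intro has_derivative_Pair dF that bounded_linear_imp_has_derivative bounded_linear_snd)
      show "continuous_on V (\<lambda>p. Blinfun (L p))"
      proof (rule continuous_on_Blinfun)
        show "continuous_on V (\<lambda>p. L p v)" for v
          unfolding L_def
          by (intro continuous_on_Pair continuous_on_const smooth_on_continuous_on
              smooth_on_dir_deriv V F)
      qed (rule bl)
      show "Blinfun M o\<^sub>L Blinfun (L p0) = id_blinfun"
      proof (rule blinfun_eqI)
        fix v :: "real \<times> 'a"
        obtain s w where v: "v = (s, w)" by (cases v)
        show "blinfun_apply (Blinfun M o\<^sub>L Blinfun (L p0)) v = blinfun_apply id_blinfun v"
          using a split[OF p0, of s w]
          unfolding blinfun_apply_blinfun_compose bounded_linear_Blinfun_apply[OF bl[OF p0]]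
            bounded_linear_Blinfun_apply[OF blM]
          by (simp add: M_def L_def v a_def)
      qed
    qed (rule V, rule p0, rule that)
    have fp0: "f p0 = (0, x0)" using y(2)[OF x0] by (simp add: f_def p0_def)
    let ?N = "U \<inter> (\<lambda>x. (0, x)) -` W"
    have N: "open ?N"
      by (intro open_Int U open_vimage inv(4)) (auto intro!: continuous_intros)
    have "((\<lambda>x. fst (g (0, x))) has_derivative (\<lambda>v. fst (g' (0, x0) (0, v)))) (at x0)"
      by (intro has_derivative_fst has_derivative_compose[of "\<lambda>x. (0, x)" "\<lambda>v. (0, v)" x0 UNIV g])
        (use inv(5,7) fp0 in \<open>auto intro!: derivative_eq_intros\<close>)
    \<comment> \<open>The local inverse over the slice \<open>F = 0\<close> is a zero of
      \<open>F\<close>, so uniqueness identifies it with \<open>y\<close>. No prior continuity of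
      \<open>y\<close> enters.\<close>
    moreover have "fst (g (0, x)) = y x" if x: "x \<in> ?N" for x
    proof -
      have "g (0, x) \<in> U'" "f (g (0, x)) = (0, x)" using inv(6) x by (auto simp: homeomorphism_def)
      then have "(fst (g (0, x)), x) \<in> V" "F (fst (g (0, x)), x) = 0"
        using inv(2) by (auto simp: f_def prod_eq_iff) (metis prod.collapse subset_iff)+
      then show ?thesis using uniq x by blast
    qed
    moreover have "x0 \<in> ?N" using x0 inv(5) fp0 by simp
    ultimately have "(y has_derivative (\<lambda>v. fst (g' (0, x0) (0, v)))) (at x0)"
      using has_derivative_transform_within_open[OF _ N] by blast
    then show ?thesis by blast
  qed
  \<comment> \<open>Obtained by differentiating \<open>F (y x, x) = 0\<close>. The right-hand side
    involves \<open>y\<close> but not its derivative, so \<open>C^n\<close> regularity of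
    \<open>y\<close> makes \<open>Y\<close> of class \<open>C^n\<close> and hence \<open>y\<close>
    of class \<open>C^(n+1)\<close>.\<close>
  define Y where "Y = (\<lambda>x v. - ?F' (y x, x) (0, v) * inverse (?F' (y x, x) (1, 0)))"
  have dy: "(y has_derivative Y x) (at x)" if x: "x \<in> U" for x
  proof -
    obtain y' where y': "(y has_derivative y') (at x)" using ex x by blast
    have "((\<lambda>x. F (y x, x)) has_derivative (\<lambda>v. ?F' (y x, x) (y' v, v))) (at x)"
      by (rule has_derivative_compose[of "\<lambda>x. (y x, x)" "\<lambda>v. (y' v, v)" x UNIV F])
        (use y' dF y x in \<open>auto intro!: derivative_eq_intros\<close>)
    moreover have "((\<lambda>x. F (y x, x)) has_derivative (\<lambda>v. 0)) (at x)"
      by (rule has_derivative_transform_within_open[OF _ U x, of "\<lambda>x. 0"]) (auto simp: y)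
    ultimately have "(\<lambda>v. ?F' (y x, x) (y' v, v)) = (\<lambda>v. 0)"
      using has_derivative_unique by blast
    then have "?F' (y x, x) (y' v, v) = 0" for v by meson
    then have "y' v * ?F' (y x, x) (1, 0) + ?F' (y x, x) (0, v) = 0" for v
      using split[OF y(1)[OF x]] by metis
    then have "y' v = Y x v" for v
      unfolding Y_def using nz[OF x] by (simp add: field_simps eq_neg_iff_add_eq_0)
    then have "y' = Y x" by blast
    then show ?thesis using y' by simp
  qed
  have "Ck_on n U y" for n
  proof (induction n)
    case 0
    show ?case using dy by (auto intro!: continuous_at_imp_continuous_on has_derivative_continuous)
  next
    case (Suc n)
    have c: "Ck_on n U (\<lambda>x. ?F' (y x, x) v)" for v
    proof (rule Ck_on_compose[of n V])
      show "Ck_on n V (dir_deriv v F)" using smooth_on_dir_deriv[OF V F] smooth_on_def by blast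
      show "Ck_on n U (\<lambda>x. (y x, x))"
        by (intro Ck_on_Pair Suc Ck_on_bounded_linear bounded_linear_ident)
    qed (rule y)
    have "Ck_on n U (\<lambda>x. Y x v)" for v
      unfolding Y_def
      by (intro Ck_on_mult Ck_on_minus c Ck_on_compose[OF Ck_on_inverse_real]) (use nz in auto)
    then show ?case unfolding Ck_on.simps using dy by blast
  qed
  then show ?thesis unfolding smooth_on_def by blast
qed

section \<open>Smooth functions of a parameter and a space variable\<close>

abbreviation D1 :: "(real \<times> real \<Rightarrow> real) \<Rightarrow> real \<times> real \<Rightarrow> real" where
  "D1 \<equiv> dir_deriv (1, 0)"

abbreviation D2 :: "(real \<times> real \<Rightarrow> real) \<Rightarrow> real \<times> real \<Rightarrow> real" where
  "D2 \<equiv> dir_deriv (0, 1)"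

lemma smooth_on_partial1:
  assumes "smooth_on U f" "(a, x) \<in> U"
  shows "((\<lambda>a. f (a, x)) has_real_derivative D1 f (a, x)) (at a)"
proof -
  have l: "linear (\<lambda>v. dir_deriv v f (a, x))"
    using has_derivative_linear[OF smooth_on_has_derivative[OF assms]] .
  have "((\<lambda>a. f (a, x)) has_derivative (\<lambda>s. dir_deriv (s, 0) f (a, x))) (at a)"
    by (rule has_derivative_compose[of "\<lambda>a. (a, x)" "\<lambda>s. (s, 0)" a UNIV f])
      (use smooth_on_has_derivative[OF assms] in \<open>auto intro!: derivative_eq_intros\<close>)
  moreover have "dir_deriv (s, 0) f (a, x) = D1 f (a, x) * s" for s
    using linear_cmul[OF l, of s "(1, 0)"] by simp
  then have "(\<lambda>s. dir_deriv (s, 0) f (a, x)) = (*) (D1 f (a, x))" by (rule ext)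
  ultimately show ?thesis unfolding has_field_derivative_def by (rule has_derivative_eq_rhs)
qed

lemma smooth_on_partial2:
  assumes "smooth_on U f" "(a, x) \<in> U"
  shows "((\<lambda>x. f (a, x)) has_real_derivative D2 f (a, x)) (at x)"
proof -
  have l: "linear (\<lambda>v. dir_deriv v f (a, x))"
    using has_derivative_linear[OF smooth_on_has_derivative[OF assms]] .
  have "((\<lambda>x. f (a, x)) has_derivative (\<lambda>s. dir_deriv (0, s) f (a, x))) (at x)"
    by (rule has_derivative_compose[of "\<lambda>x. (a, x)" "\<lambda>s. (0, s)" x UNIV f])
      (use smooth_on_has_derivative[OF assms] in \<open>auto intro!: derivative_eq_intros\<close>)
  moreover have "dir_deriv (0, s) f (a, x) = D2 f (a, x) * s" for s
    using linear_cmul[OF l, of s "(0, 1)"] by simp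
  then have "(\<lambda>s. dir_deriv (0, s) f (a, x)) = (*) (D2 f (a, x))" by (rule ext)
  ultimately show ?thesis unfolding has_field_derivative_def by (rule has_derivative_eq_rhs)
qed

lemma smooth_on_continuous_partial:
  fixes u :: "real \<times> real \<Rightarrow> real"
  assumes "smooth_on (I \<times> UNIV) u" "\<omega> \<in> I"
  shows "continuous_on S (\<lambda>x. u (\<omega>, x))"
  by (rule continuous_on_compose2[OF smooth_on_continuous_on[OF assms(1)]])
    (use assms(2) in \<open>auto intro!: continuous_intros\<close>)

text \<open>Integrating \<open>D2 u\<close> over space recovers increments of \<open>u\<close>.
  Differentiating this identity under the integral in the parameter expresses increments of
  \<open>D1 u\<close> as integrals of \<open>D1 (D2 u)\<close>, and the fundamental theorem of
  calculus concludes.\<close>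

lemma D1_D2_commute:
  fixes u :: "real \<times> real \<Rightarrow> real"
  assumes I: "open I" and u: "smooth_on (I \<times> UNIV) u" and \<omega>: "\<omega> \<in> I"
  shows "D2 (D1 u) (\<omega>, x\<^sub>0) = D1 (D2 u) (\<omega>, x\<^sub>0)"
proof -
  \<comment> \<open>A base point strictly to the left, so that \<open>x\<^sub>0\<close> is interior
    to the interval of integration and the one-sided derivatives become two-sided.\<close>
  let ?b = "x\<^sub>0 - 1"
  have IU: "open (I \<times> (UNIV :: real set))" using I by (simp add: open_Times)
  have u2: "smooth_on (I \<times> UNIV) (D2 u)" and u1: "smooth_on (I \<times> UNIV) (D1 u)"
    using smooth_on_dir_deriv[OF IU u] by auto
  have u12: "smooth_on (I \<times> UNIV) (D1 (D2 u))" using smooth_on_dir_deriv[OF IU u2] .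
  obtain e where e: "e > 0" "ball \<omega> e \<subseteq> I" using I \<omega> open_contains_ball by blast
  have ftc: "integral {?b..x} (\<lambda>t. D2 u (a, t)) = u (a, x) - u (a, ?b)" if "a \<in> I" "?b \<le> x" for a x
  proof (rule integral_unique, rule fundamental_theorem_of_calculus[OF that(2)])
    fix t
    show "((\<lambda>t. u (a, t)) has_vector_derivative D2 u (a, t)) (at t within {?b..x})"
      using smooth_on_partial2[OF u, of a t] that(1)
      by (simp add: has_real_derivative_iff_has_vector_derivative has_vector_derivative_at_within)
  qed
  have int: "integral {?b..x} (\<lambda>t. D1 (D2 u) (\<omega>, t)) = D1 u (\<omega>, x) - D1 u (\<omega>, ?b)"
    if x: "?b \<le> x" for x
  proof -
    have "((\<lambda>a. integral (cbox ?b x) (\<lambda>t. D2 u (a, t))) has_field_derivative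
        integral (cbox ?b x) (\<lambda>t. D1 (D2 u) (\<omega>, t))) (at \<omega> within ball \<omega> e)"
    proof (rule leibniz_rule_field_derivative)
      fix a t assume "a \<in> ball \<omega> e"
      then show "((\<lambda>a. D2 u (a, t)) has_field_derivative D1 (D2 u) (a, t)) (at a within ball \<omega> e)"
        using smooth_on_partial1[OF u2, of a t] e has_field_derivative_at_within by blast
    next
      fix a assume "a \<in> ball \<omega> e"
      then show "(\<lambda>t. D2 u (a, t)) integrable_on cbox ?b x"
        using e by (intro integrable_continuous smooth_on_continuous_partial[OF u2]) auto
    next
      show "continuous_on (ball \<omega> e \<times> cbox ?b x) (\<lambda>(a, t). D1 (D2 u) (a, t))"
        using continuous_on_subset[OF smooth_on_continuous_on[OF u12], of "ball \<omega> e \<times> cbox ?b x"] e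
        by (auto simp: split_beta)
    qed (use e in auto)
    then have d: "((\<lambda>a. integral {?b..x} (\<lambda>t. D2 u (a, t))) has_field_derivative
        integral {?b..x} (\<lambda>t. D1 (D2 u) (\<omega>, t))) (at \<omega>)"
      using e(1) by (simp add: at_within_open[OF _ open_ball])
    have "((\<lambda>a. u (a, x) - u (a, ?b)) has_field_derivative
        integral {?b..x} (\<lambda>t. D1 (D2 u) (\<omega>, t))) (at \<omega>)"
      by (rule has_field_derivative_transform_within_open[OF d I \<omega>]) (use ftc x in auto)
    moreover have "((\<lambda>a. u (a, x) - u (a, ?b)) has_field_derivative
        (D1 u (\<omega>, x) - D1 u (\<omega>, ?b))) (at \<omega>)"
      by (intro DERIV_diff smooth_on_partial1[OF u]) (use \<omega> in auto)
    ultimately show ?thesis using DERIV_unique by blast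
  qed
  let ?S = "{?b<..<x\<^sub>0 + 1}"
  have "((\<lambda>x. integral {?b..x} (\<lambda>t. D1 (D2 u) (\<omega>, t))) has_real_derivative D1 (D2 u) (\<omega>, x\<^sub>0))
      (at x\<^sub>0 within {?b..x\<^sub>0 + 1})"
    by (rule integral_has_real_derivative) (use smooth_on_continuous_partial[OF u12 \<omega>] in auto)
  then have "((\<lambda>x. integral {?b..x} (\<lambda>t. D1 (D2 u) (\<omega>, t))) has_real_derivative D1 (D2 u) (\<omega>, x\<^sub>0))
      (at x\<^sub>0)"
    using at_within_Icc_at[of ?b x\<^sub>0 "x\<^sub>0 + 1"] by simp
  then have "((\<lambda>x. D1 u (\<omega>, x) - D1 u (\<omega>, ?b)) has_real_derivative D1 (D2 u) (\<omega>, x\<^sub>0)) (at x\<^sub>0)"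
    by (rule has_field_derivative_transform_within_open[of _ _ _ ?S]) (use int in auto)
  moreover have "((\<lambda>x. D1 u (\<omega>, x) - D1 u (\<omega>, ?b)) has_real_derivative D2 (D1 u) (\<omega>, x\<^sub>0) - 0) (at x\<^sub>0)"
    by (intro DERIV_diff smooth_on_partial2[OF u1] DERIV_const) (use \<omega> in auto)
  ultimately show ?thesis using DERIV_unique by fastforce
qed

text \<open>Both derivatives belong to the same function near \<open>(\<omega>, x)\<close>, namely
  \<open>u\<close> precomposed with the translation by \<open>(0, L)\<close>.\<close>

lemma dir_deriv_periodic:
  fixes u :: "real \<times> real \<Rightarrow> real"
  assumes I: "open I" and u: "smooth_on (I \<times> UNIV) u" and \<omega>: "\<omega> \<in> I"
    and per: "\<And>\<omega> x. \<omega> \<in> I \<Longrightarrow> u (\<omega>, x + L) = u (\<omega>, x)"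
  shows "dir_deriv v u (\<omega>, x + L) = dir_deriv v u (\<omega>, x)"
proof -
  have IU: "open (I \<times> (UNIV :: real set))" using I by (simp add: open_Times)
  have "((\<lambda>p. u (p + (0, L))) has_derivative (\<lambda>v. dir_deriv v u (\<omega>, x + L))) (at (\<omega>, x))"
    by (rule has_derivative_compose[of "\<lambda>p. p + (0, L)" "\<lambda>v. v" "(\<omega>, x)" UNIV u])
      (use smooth_on_has_derivative[OF u, of "(\<omega>, x + L)"] \<omega>
        in \<open>auto intro!: derivative_eq_intros\<close>)
  then have "(u has_derivative (\<lambda>v. dir_deriv v u (\<omega>, x + L))) (at (\<omega>, x))"
    by (rule has_derivative_transform_within_open[OF _ IU]) (use \<omega> per in auto)
  then show ?thesis using dir_deriv_unique by metis
qed

text \<open>By the mean value theorem the quotient is \<open>D1 u\<close> at an intermediate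
  parameter; uniform continuity of \<open>D1 u\<close> on a compact rectangle gives one bound on
  \<open>h\<close> for all \<open>x\<close>.\<close>

lemma uniform_difference_quotient:
  fixes u :: "real \<times> real \<Rightarrow> real"
  assumes I: "open I" and u: "smooth_on (I \<times> UNIV) u" and \<omega>: "\<omega> \<in> I" and e: "e > 0"
  shows "\<forall>\<^sub>F h in at 0. \<forall>x\<in>{0..L}. \<bar>(u (\<omega> + h, x) - u (\<omega>, x)) / h - D1 u (\<omega>, x)\<bar> \<le> e"
proof -
  obtain r where r: "r > 0" "cball \<omega> r \<subseteq> I" using I \<omega> open_contains_cball by blast
  have IU: "open (I \<times> (UNIV :: real set))" using I by (simp add: open_Times)
  let ?K = "cball \<omega> r \<times> {0..L}"
  have "continuous_on ?K (D1 u)"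
    using continuous_on_subset[OF smooth_on_continuous_on[OF smooth_on_dir_deriv[OF IU u]]] r
    by blast
  then have "uniformly_continuous_on ?K (D1 u)"
    by (intro compact_uniformly_continuous compact_Times) auto
  then obtain d where d: "d > 0"
    "\<And>p p'. p \<in> ?K \<Longrightarrow> p' \<in> ?K \<Longrightarrow> dist p' p < d \<Longrightarrow> dist (D1 u p') (D1 u p) < e"
    unfolding uniformly_continuous_on_def using e by meson
  have key: "\<bar>(u (\<omega> + h, x) - u (\<omega>, x)) / h - D1 u (\<omega>, x)\<bar> \<le> e"
    if h: "h \<noteq> 0" "\<bar>h\<bar> < min d r" and x: "x \<in> {0..L}" for h x
  proof -
    \<comment> \<open>Moving along \<open>s\<close> in \<open>[0, 1]\<close> treats positive and
      negative \<open>h\<close> at once.\<close>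
    have der: "((\<lambda>s. u (\<omega> + s * h, x)) has_real_derivative D1 u (\<omega> + s * h, x) * h) (at s)"
      if "0 \<le> s" "s \<le> 1" for s
    proof -
      have "\<bar>s * h\<bar> \<le> 1 * \<bar>h\<bar>" unfolding abs_mult by (rule mult_right_mono) (use that in auto)
      then have "\<omega> + s * h \<in> I" using h r by (auto simp: subset_iff dist_real_def)
      then show ?thesis
        by (intro DERIV_chain2[where f = "\<lambda>a. u (a, x)" and g = "\<lambda>s. \<omega> + s * h"]
            smooth_on_partial1[OF u]) (auto intro!: derivative_eq_intros)
    qed
    obtain s where s: "0 < s" "s < 1" "u (\<omega> + 1 * h, x) - u (\<omega> + 0 * h, x) = (1 - 0) * (D1 u (\<omega> + s * h, x) * h)"
      using MVT2[of 0 1 "\<lambda>s. u (\<omega> + s * h, x)", OF _ der] by auto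
    then have q: "(u (\<omega> + h, x) - u (\<omega>, x)) / h = D1 u (\<omega> + s * h, x)" using h by simp
    have "\<bar>s * h\<bar> \<le> 1 * \<bar>h\<bar>" unfolding abs_mult by (rule mult_right_mono) (use s in auto)
    then have "dist (D1 u (\<omega> + s * h, x)) (D1 u (\<omega>, x)) < e"
      using h x r by (intro d(2)) (auto simp: dist_Pair_Pair dist_real_def)
    then show ?thesis unfolding q by (simp add: dist_real_def)
  qed
  show ?thesis unfolding eventually_at
    using key d(1) r(1) by (intro exI[of _ "min d r"]) (auto simp: dist_real_def)
qed

text \<open>Each iterate of \<open>deriv\<close> is known only on \<open>I\<close>; openness of
  \<open>I\<close> allows it to be replaced there by the derivative in direction 1.\<close>

lemma smooth_on_imp_smooth_real_on:
  assumes "open I" "smooth_on I f" shows "smooth_real_on I f"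
proof -
  have d: "(g has_real_derivative dir_deriv 1 g x) (at x)" if "smooth_on I g" "x \<in> I" for g x
  proof -
    have h: "(g has_derivative (\<lambda>v. dir_deriv v g x)) (at x)"
      by (rule smooth_on_has_derivative[OF that])
    have "dir_deriv v g x = dir_deriv 1 g x * v" for v
      using linear_cmul[OF has_derivative_linear[OF h], of v 1] by simp
    then have "(\<lambda>v. dir_deriv v g x) = (*) (dir_deriv 1 g x)" by (rule ext)
    with h show ?thesis unfolding has_field_derivative_def by (rule has_derivative_eq_rhs)
  qed
  have "smooth_on I ((deriv ^^ j) f)" for j
  proof (induction j)
    case (Suc j)
    show ?case
      by (rule smooth_on_cong[OF assms(1) _ smooth_on_dir_deriv[OF assms(1) Suc, of 1]])
        (use DERIV_imp_deriv[OF d[OF Suc]] in simp)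
  qed (use assms(2) in simp)
  then show ?thesis
    unfolding smooth_real_on_def using d real_differentiable_def by blast
qed

section \<open>Sobolev norms of smooth periodic functions\<close>

lemma summable_on_inverse_one_plus_square: "(\<lambda>m::int. 1 / (1 + (of_int m :: real)\<^sup>2)) summable_on UNIV"
proof -
  let ?w = "\<lambda>m::int. 1 / (1 + (of_int m :: real)\<^sup>2)"
  have "summable (\<lambda>n::nat. 1 / (1 + (real n)\<^sup>2))"
  proof (rule summable_comparison_test')
    show "summable (\<lambda>n. inverse (real n ^ 2))" using inverse_power_summable[of 2, where ?'a = real] by simp
    show "norm (1 / (1 + (real n)\<^sup>2)) \<le> inverse (real n ^ 2)" if "n \<ge> 1" for n
      using that by (auto simp: inverse_eq_divide intro!: frac_le)
  qed
  then have "(\<lambda>n::nat. 1 / (1 + (real n)\<^sup>2)) summable_on UNIV"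
    by (intro norm_summable_imp_summable_on) simp
  then have "?w summable_on range int" "?w summable_on range (\<lambda>n. - int n)"
    by (subst summable_on_reindex; simp add: inj_on_def o_def)+
  then have "?w summable_on (range int \<union> range (\<lambda>n. - int n))"
    by (rule summable_on_union)
  moreover have "range int \<union> range (\<lambda>n. - int n) = UNIV"
    by (metis (mono_tags, lifting) UNIV_eq_I UnCI int_cases2 rangeI)
  ultimately show ?thesis by simp
qed

lemma norm_fourier_coeff_le:
  assumes L: "L > 0" and f: "continuous_on {0..L} f" and M: "\<And>x. x \<in> {0..L} \<Longrightarrow> \<bar>f x\<bar> \<le> M"
  shows "cmod (fourier_coeff L f m) \<le> M"
proof -
  let ?g = "\<lambda>x. complex_of_real (f x) * cis (- (2 * pi * of_int m * x / L))"
  have "continuous_on {0..L} ?g" using f L by (auto intro!: continuous_intros simp: cis_conv_exp)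
  then have si: "set_integrable lborel {0..L} ?g" by (rule borel_integrable_atLeastAtMost')
  have "cmod (LINT x:{0..L}|lborel. ?g x) \<le> (LINT x:{0..L}|lborel. M)"
    by (rule order_trans[OF set_integral_norm_bound[OF si]], rule set_integral_mono)
      (use M in \<open>auto simp: norm_mult intro!: set_integrable_abs borel_integrable_atLeastAtMost'
        continuous_intros f\<close>)
  also have "\<dots> = L * M" using L by (simp add: set_integral_const)
  finally show ?thesis unfolding fourier_coeff_def using L by (simp add: field_simps)
qed

text \<open>Integration by parts: \<open>f\<close> times the exponential takes equal values at
  \<open>0\<close> and \<open>L\<close>, so its derivative has integral zero over the
  period.\<close>

lemma fourier_coeff_derivative:
  assumes L: "L > 0" and d: "\<And>x. (f has_real_derivative f' x) (at x)"
    and c: "continuous_on {0..L} f'" and per: "f L = f 0"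
  shows "fourier_coeff L f' m = \<i> * of_real (2 * pi * of_int m / L) * fourier_coeff L f m"
proof -
  let ?c = "2 * pi * of_int m / L"
  let ?e = "\<lambda>x. cis (- (2 * pi * of_int m * x / L))"
  have cf: "continuous_on {0..L} f"
    using d by (intro continuous_at_imp_continuous_on) (auto intro: DERIV_isCont)
  have ce: "continuous_on {0..L} ?e" using L by (auto intro!: continuous_intros simp: cis_conv_exp)
  have s: "set_integrable lborel {0..L} (\<lambda>x. complex_of_real (f x) * ?e x)"
    "set_integrable lborel {0..L} (\<lambda>x. complex_of_real (f' x) * ?e x)"
    by (intro borel_integrable_atLeastAtMost' continuous_intros ce cf c)+
  let ?G = "\<lambda>x. complex_of_real (f x) * ?e x"
  let ?g = "\<lambda>x. complex_of_real (f' x) * ?e x - \<i> * ?c * (complex_of_real (f x) * ?e x)"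
  have der: "(?G has_vector_derivative ?g x) (at x within {0..L})" for x
  proof -
    have e: "(?e has_vector_derivative (- \<i> * ?c * ?e x)) (at x within {0..L})"
    proof -
      have "((\<lambda>x. - (2 * pi * of_int m * x / L)) has_derivative (\<lambda>t. - (?c * t))) (at x within {0..L})"
        using L by (auto intro!: derivative_eq_intros)
      from has_derivative_cis[OF this] show ?thesis
        unfolding has_vector_derivative_def
        by (rule has_derivative_eq_rhs) (simp add: fun_eq_iff scaleR_conv_of_real)
    qed
    have f: "((\<lambda>x. complex_of_real (f x)) has_vector_derivative complex_of_real (f' x)) (at x within {0..L})"
      using d[of x] has_vector_derivative_of_real has_vector_derivative_at_within
        has_real_derivative_iff_has_vector_derivative by blast
    have alg: "a * (- \<i> * c * E) + b * E = b * E - \<i> * c * (a * E)" for a b c E :: complex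
      by (simp add: algebra_simps)
    show "(?G has_vector_derivative ?g x) (at x within {0..L})"
      by (rule has_vector_derivative_eq_rhs[OF has_vector_derivative_mult[OF f e] alg])
  qed
  have "has_bochner_integral lborel (\<lambda>x. indicator {0..L} x *\<^sub>R ?g x) (?G L - ?G 0)"
  proof (rule has_bochner_integral_FTC_Icc[where F = ?G and f = ?g])
    show "continuous_on {0..L} ?g"
      by (intro continuous_on_diff continuous_on_mult[OF continuous_on_const]
          continuous_on_mult[OF continuous_on_of_real] ce cf c)
  qed (use L der in auto)
  moreover have "?G L - ?G 0 = 0"
  proof -
    have "- (2 * pi * of_int m * L / L) = 2 * pi * of_int (- m)" using L by simp
    then have "?e L = 1" using cis_multiple_2pi[of "of_int (- m)"] by (metis Ints_of_int)
    then show ?thesis using per by simp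
  qed
  ultimately have "(LINT x:{0..L}|lborel. ?g x) = 0"
    unfolding set_lebesgue_integral_def by (simp only: has_bochner_integral_integral_eq)
  then have "(LINT x:{0..L}|lborel. complex_of_real (f' x) * ?e x) =
      \<i> * ?c * (LINT x:{0..L}|lborel. complex_of_real (f x) * ?e x)"
    using set_integral_diff(2)[OF s(2) set_integrable_mult_right[of "\<i> * ?c", OF s(1)]] by simp
  then show ?thesis unfolding fourier_coeff_def by (simp add: scaleR_conv_of_real)
qed

text \<open>One derivative more than \<open>n\<close> bounds \<open>(1 + m^2)^(n+1)\<close> times
  the squared coefficient, which leaves the summable factor \<open>1 / (1 + m^2)\<close> for the
  norm of order \<open>n\<close>. \<open>C\<close> is chosen before \<open>g\<close> and
  \<open>M\<close>, so that a whole family of difference quotients can share it.\<close>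

lemma smooth_periodic_Hper_bound:
  assumes L: "L > 0"
  shows "\<exists>C\<ge>0. \<forall>g M. (\<forall>i x. (g i has_real_derivative g (Suc i) x) (at x)) \<longrightarrow>
      (\<forall>i x. g i (x + L) = g i x) \<longrightarrow>
      (\<forall>x\<in>{0..L}. \<bar>g 0 x\<bar> \<le> M \<and> \<bar>g (Suc n) x\<bar> \<le> M) \<longrightarrow>
      g 0 \<in> Hper n L \<and> Hper_norm n L (g 0) \<le> C * M"
proof -
  let ?w = "\<lambda>m::int. 1 / (1 + (of_int m :: real)\<^sup>2)"
  \<comment> \<open>For \<open>m \<noteq> 0\<close>,
    \<open>1 + m^2 \<le> 2 m^2 = 2 (L / 2 pi)^2 (2 pi m / L)^2\<close>, and the last factor is the
    one produced by differentiation; its power \<open>Suc n\<close> gives the second summand. The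
    summand \<open>1\<close> covers \<open>m = 0\<close>.\<close>
  define K where "K = 1 + (2 * (L / (2 * pi))\<^sup>2) ^ Suc n"
  define W where "W = infsum ?w UNIV"
  have K: "K \<ge> 0" unfolding K_def by (intro add_nonneg_nonneg zero_le_power) auto
  have W: "W \<ge> 0" unfolding W_def by (rule infsum_nonneg) auto
  show ?thesis
  proof (intro exI[of _ "sqrt (L * K * W)"] conjI allI impI)
    fix g :: "nat \<Rightarrow> real \<Rightarrow> real" and M
    assume d: "\<forall>i x. (g i has_real_derivative g (Suc i) x) (at x)"
      and per: "\<forall>i x. g i (x + L) = g i x"
      and M: "\<forall>x\<in>{0..L}. \<bar>g 0 x\<bar> \<le> M \<and> \<bar>g (Suc n) x\<bar> \<le> M"
    let ?c = "\<lambda>i m. fourier_coeff L (g i) m"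
    let ?t = "\<lambda>m::int. (1 + (of_int m)\<^sup>2) ^ n * (cmod (?c 0 m))\<^sup>2"
    have cont: "continuous_on S (g i)" for i S
      using d by (intro continuous_at_imp_continuous_on) (auto intro: DERIV_isCont)
    have M0: "M \<ge> 0" using M L by force
    have rec: "cmod (?c i m) = (2 * pi * \<bar>of_int m\<bar> / L) ^ i * cmod (?c 0 m)" for i m
    proof (induction i)
      case (Suc i)
      have "g i L = g i 0" using per[rule_format, of i 0] by simp
      then have "?c (Suc i) m = \<i> * of_real (2 * pi * of_int m / L) * ?c i m"
        using fourier_coeff_derivative[OF L _ cont] d by blast
      then have "cmod (?c (Suc i) m) = 2 * pi * \<bar>of_int m\<bar> / L * cmod (?c i m)"
        using L by (simp add: norm_mult norm_divide abs_mult)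
      then show ?case using Suc by simp
    qed simp
    have b: "(1 + (of_int m)\<^sup>2) ^ Suc n * (cmod (?c 0 m))\<^sup>2 \<le> K * M\<^sup>2" for m :: int
    proof (cases "m = 0")
      case True
      have "(cmod (?c 0 m))\<^sup>2 \<le> M\<^sup>2"
        using norm_fourier_coeff_le[OF L cont, of 0 M m] M by (intro power_mono) auto
      also have "\<dots> \<le> K * M\<^sup>2" unfolding K_def by (simp add: distrib_right)
      finally show ?thesis using True by simp
    next
      case False
      have pow: "(a * b\<^sup>2) ^ N * c\<^sup>2 = a ^ N * (b ^ N * c)\<^sup>2" for a b c :: real and N
        by (simp add: power_mult_distrib power_mult[symmetric] mult.commute)
      define x where "x = \<bar>of_int m :: real\<bar>"
      have x: "x \<ge> 1" using False unfolding x_def by linarith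
      have "(cmod (?c (Suc n) m))\<^sup>2 \<le> M\<^sup>2"
        using norm_fourier_coeff_le[OF L cont, of "Suc n" M m] M by (intro power_mono) auto
      then have i: "((2 * pi * x / L) ^ Suc n * cmod (?c 0 m))\<^sup>2 \<le> M\<^sup>2"
        unfolding rec[of "Suc n"] x_def .
      have "1 + (of_int m)\<^sup>2 \<le> 2 * x\<^sup>2" using one_le_power[OF x, of 2] unfolding x_def by simp
      also have "\<dots> = 2 * (L / (2 * pi))\<^sup>2 * (2 * pi * x / L)\<^sup>2"
        using L by (simp add: power_divide power_mult_distrib)
      finally have "(1 + (of_int m)\<^sup>2) ^ Suc n \<le> (2 * (L / (2 * pi))\<^sup>2 * (2 * pi * x / L)\<^sup>2) ^ Suc n"
        by (intro power_mono) auto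
      then have "(1 + (of_int m)\<^sup>2) ^ Suc n * (cmod (?c 0 m))\<^sup>2
          \<le> (2 * (L / (2 * pi))\<^sup>2 * (2 * pi * x / L)\<^sup>2) ^ Suc n * (cmod (?c 0 m))\<^sup>2"
        by (rule mult_right_mono) simp
      also have "\<dots> = (2 * (L / (2 * pi))\<^sup>2) ^ Suc n * ((2 * pi * x / L) ^ Suc n * cmod (?c 0 m))\<^sup>2"
        by (rule pow)
      also have "\<dots> \<le> (2 * (L / (2 * pi))\<^sup>2) ^ Suc n * M\<^sup>2"
        by (rule mult_left_mono[OF i]) simp
      also have "\<dots> \<le> K * M\<^sup>2" unfolding K_def by (simp add: distrib_right)
      finally show ?thesis .
    qed
    have t: "?t m \<le> K * M\<^sup>2 * ?w m" for m
    proof -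
      have "1 + (of_int m :: real)\<^sup>2 > 0" by (simp add: add_pos_nonneg)
      then show ?thesis using b[of m] by (simp add: field_simps)
    qed
    have sw: "(\<lambda>m. K * M\<^sup>2 * ?w m) summable_on UNIV"
      by (rule summable_on_cmult_right[OF summable_on_inverse_one_plus_square])
    have st: "?t summable_on UNIV"
      by (rule summable_on_comparison_test[OF sw]) (use t in auto)
    have "g 0 \<in> borel_measurable lborel"
      using borel_measurable_continuous_onI[OF cont] by simp
    moreover have "set_integrable lborel {0..L} (\<lambda>x. (g 0 x)\<^sup>2)"
      by (intro borel_integrable_atLeastAtMost' continuous_intros cont)
    ultimately show "g 0 \<in> Hper n L" unfolding Hper_def using per st by auto
    have "infsum ?t UNIV \<le> infsum (\<lambda>m. K * M\<^sup>2 * ?w m) UNIV"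
      by (rule infsum_mono[OF st sw]) (rule t)
    also have "\<dots> = K * M\<^sup>2 * W" unfolding W_def
      by (rule infsum_cmult_right[OF summable_on_inverse_one_plus_square])
    finally have "L * infsum ?t UNIV \<le> L * K * W * M\<^sup>2"
      using L by (simp add: mult.assoc mult.commute[of W])
    then have "Hper_norm n L (g 0) \<le> sqrt (L * K * W * M\<^sup>2)"
      unfolding Hper_norm_def by (rule real_sqrt_le_mono)
    also have "\<dots> = sqrt (L * K * W) * M" using M0 by (simp add: real_sqrt_mult)
    finally show "Hper_norm n L (g 0) \<le> sqrt (L * K * W) * M" .
  qed (use L K W in simp)
qed

text \<open>The parameter derivatives of the curve are the functions \<open>D1^j u\<close>.
  Convergence of the quotients in \<open>Hper n L\<close> needs only uniform convergence of the
  quotients of \<open>D1^j u\<close> and of its \<open>x\<close>-derivative of order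
  \<open>n + 1\<close>.\<close>

lemma smooth_Hper_curveI:
  fixes u :: "real \<times> real \<Rightarrow> real"
  assumes L: "L > 0" and I: "open I" and u: "smooth_on (I \<times> UNIV) u"
    and per: "\<And>\<omega> x. \<omega> \<in> I \<Longrightarrow> u (\<omega>, x + L) = u (\<omega>, x)"
    and F: "\<And>\<omega> x. \<omega> \<in> I \<Longrightarrow> F \<omega> x = u (\<omega>, x)"
  shows "smooth_Hper_curve n L I F"
proof -
  have IU: "open (I \<times> (UNIV :: real set))" using I by (simp add: open_Times)
  have it: "smooth_on (I \<times> UNIV) ((dir_deriv v ^^ j) f) \<and>
      (\<forall>\<omega>\<in>I. \<forall>x. (dir_deriv v ^^ j) f (\<omega>, x + L) = (dir_deriv v ^^ j) f (\<omega>, x))"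
    if "smooth_on (I \<times> UNIV) f" "\<forall>\<omega>\<in>I. \<forall>x. f (\<omega>, x + L) = f (\<omega>, x)"
    for v j and f :: "real \<times> real \<Rightarrow> real"
  proof (induction j)
    case (Suc j)
    then show ?case
      using smooth_on_dir_deriv[OF IU, of "(dir_deriv v ^^ j) f" v] dir_deriv_periodic[OF I] by simp
  qed (use that in simp)
  define \<Phi> where "\<Phi> = (\<lambda>j \<omega> x. (D1 ^^ j) u (\<omega>, x))"
  obtain C where C: "C \<ge> 0" "\<And>g M. \<lbrakk>\<forall>i x. (g i has_real_derivative g (Suc i) x) (at x);
      \<forall>i x. g i (x + L) = g i x; \<forall>x\<in>{0..L}. \<bar>g 0 x\<bar> \<le> M \<and> \<bar>g (Suc n) x\<bar> \<le> M\<rbrakk> \<Longrightarrow>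
      g 0 \<in> Hper n L \<and> Hper_norm n L (g 0) \<le> C * M"
    using smooth_periodic_Hper_bound[OF L, of n] by blast
  have main: "\<Phi> j \<omega> \<in> Hper n L \<and> has_Hper_derivative n L (\<Phi> j) (\<Phi> (Suc j) \<omega>) \<omega>"
    if \<omega>: "\<omega> \<in> I" for j \<omega>
  proof
    define v where "v = (\<lambda>i. (D2 ^^ i) ((D1 ^^ j) u))"
    have v: "smooth_on (I \<times> UNIV) (v i)" "\<And>\<omega> x. \<omega> \<in> I \<Longrightarrow> v i (\<omega>, x + L) = v i (\<omega>, x)" for i
      unfolding v_def using it[OF conjunct1[OF it[OF u]] conjunct2[OF it[OF u]]] per by blast+
    have vS: "v (Suc i) = D2 (v i)" for i by (simp add: v_def)
    have dv: "((\<lambda>x. v i (a, x)) has_real_derivative v (Suc i) (a, x)) (at x)" if "a \<in> I" for i x a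
      using smooth_on_partial2[OF v(1), of a x i] that by (simp add: vS)
    have v1: "smooth_on (I \<times> UNIV) (D1 (v i))" for i using smooth_on_dir_deriv[OF IU v(1)] .
    have \<Phi>0: "\<Phi> j a x = v 0 (a, x)" for a x by (simp add: \<Phi>_def v_def)
    have \<Phi>1: "\<Phi> (Suc j) a x = D1 (v 0) (a, x)" for a x by (simp add: \<Phi>_def v_def)
    obtain M where M: "\<forall>x\<in>{0..L}. \<bar>v 0 (\<omega>, x)\<bar> \<le> M \<and> \<bar>v (Suc n) (\<omega>, x)\<bar> \<le> M"
    proof -
      have "\<exists>B. \<forall>x\<in>{0..L}. \<bar>v i (\<omega>, x)\<bar> \<le> B" for i
        using compact_imp_bounded[OF compact_continuous_image[OF
            smooth_on_continuous_partial[OF v(1)[of i] \<omega>, of "{0..L}"] compact_Icc]]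
        by (auto simp: bounded_iff)
      then obtain B1 B2 where "\<forall>x\<in>{0..L}. \<bar>v 0 (\<omega>, x)\<bar> \<le> B1" "\<forall>x\<in>{0..L}. \<bar>v (Suc n) (\<omega>, x)\<bar> \<le> B2"
        by meson
      then show ?thesis using that[of "max B1 B2"] by fastforce
    qed
    have "(\<lambda>x. v 0 (\<omega>, x)) \<in> Hper n L"
      using C(2)[of "\<lambda>i x. v i (\<omega>, x)" M] dv[OF \<omega>] v(2)[OF \<omega>] M by simp
    then show "\<Phi> j \<omega> \<in> Hper n L" unfolding \<Phi>0 .
    \<comment> \<open>The remainder of the quotient at the \<open>i\<close>-th
      \<open>x\<close>-derivative. Since \<open>D1\<close> and \<open>D2\<close> commute,
      \<open>?r h (Suc i)\<close> is the derivative of \<open>?r h i\<close>, so \<open>?r h\<close>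
      has the shape of the family \<open>g\<close> in the norm bound.\<close>
    let ?r = "\<lambda>h i x. (v i (\<omega> + h, x) - v i (\<omega>, x)) / h - D1 (v i) (\<omega>, x)"
    have small: "\<forall>\<^sub>F h in at 0. Hper_norm n L (?r h 0) \<le> C * e" if e: "e > 0" for e
    proof -
      have "\<forall>\<^sub>F h in at 0. \<omega> + h \<in> I"
      proof -
        have "((\<lambda>h. \<omega> + h) \<longlongrightarrow> \<omega> + 0) (at 0)" by (intro tendsto_intros)
        then show ?thesis using topological_tendstoD[OF _ I] \<omega> by fastforce
      qed
      then show ?thesis
        using uniform_difference_quotient[OF I v(1)[of 0] \<omega> e, of L]
          uniform_difference_quotient[OF I v(1)[of "Suc n"] \<omega> e, of L]
      proof eventually_elim
        case (elim h)
        have "\<forall>i x. (?r h i has_real_derivative ?r h (Suc i) x) (at x)"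
        proof (intro allI)
          fix i x
          have "((\<lambda>x. D1 (v i) (\<omega>, x)) has_real_derivative D1 (v (Suc i)) (\<omega>, x)) (at x)"
            using smooth_on_partial2[OF v1[of i], of \<omega> x] \<omega> D1_D2_commute[OF I v(1) \<omega>, of i x]
            by (simp add: vS)
          then show "(?r h i has_real_derivative ?r h (Suc i) x) (at x)"
            using dv[OF elim(1)] dv[OF \<omega>] by (intro DERIV_diff DERIV_cdivide) auto
        qed
        moreover have "\<forall>i x. ?r h i (x + L) = ?r h i x"
          using v(2)[OF \<omega>] v(2)[OF elim(1)] dir_deriv_periodic[OF I v(1) \<omega> v(2)] by simp
        ultimately show ?case using C(2)[of "?r h" e] elim by blast
      qed
    qed
    have "((\<lambda>h. Hper_norm n L (?r h 0)) \<longlongrightarrow> 0) (at 0)"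
    proof (rule tendstoI)
      fix e :: real assume e: "e > 0"
      \<comment> \<open>\<open>C + 1\<close> instead of \<open>C\<close>, because \<open>C\<close>
        may be zero.\<close>
      have "C * (e / (C + 1)) < e"
        using e C(1) by (simp add: field_simps)
      moreover have "Hper_norm n L f \<ge> 0" for f
        unfolding Hper_norm_def using L
        by (intro real_sqrt_ge_zero mult_nonneg_nonneg infsum_nonneg) auto
      ultimately show "\<forall>\<^sub>F h in at 0. dist (Hper_norm n L (?r h 0)) 0 < e"
        using small[of "e / (C + 1)"] e C(1)
        by (auto elim!: eventually_mono simp: dist_real_def)
    qed
    then show "has_Hper_derivative n L (\<Phi> j) (\<Phi> (Suc j) \<omega>) \<omega>"
      unfolding has_Hper_derivative_def \<Phi>0 \<Phi>1 .
  qed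
  show ?thesis unfolding smooth_Hper_curve_def
  proof (intro exI[of _ \<Phi>] conjI)
    show "\<forall>\<omega>\<in>I. \<Phi> 0 \<omega> = F \<omega>" using F by (auto simp: \<Phi>_def fun_eq_iff)
  qed (use main in blast)
qed

section \<open>The Jacobi amplitude\<close>

lemma elliptic_integrand_pos: "k\<^sup>2 < 1 \<Longrightarrow> 0 < 1 - k\<^sup>2 * (sin t)\<^sup>2"
  for k t :: real
proof -
  assume "k\<^sup>2 < 1"
  moreover have "k\<^sup>2 * (sin t)\<^sup>2 \<le> k\<^sup>2 * 1" by (intro mult_left_mono) (auto simp: abs_square_le_1)
  ultimately show ?thesis by linarith
qed

lemma elliptic_integrand_continuous:
  assumes "k\<^sup>2 < 1" shows "continuous_on S (\<lambda>t::real. 1 / sqrt (1 - k\<^sup>2 * (sin t)\<^sup>2))"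
proof -
  have "sqrt (1 - k\<^sup>2 * (sin t)\<^sup>2) \<noteq> 0" for t using elliptic_integrand_pos[OF assms, of t] by simp
  then show ?thesis by (intro continuous_intros ballI)
qed

lemma elliptic_F_0 [simp]: "elliptic_F 0 k = 0"
  by (simp add: elliptic_F_def)

lemma elliptic_K_eq_F: "elliptic_K k = elliptic_F (pi / 2) k"
  by (simp add: elliptic_F_def elliptic_K_def)

lemma elliptic_F_deriv:
  assumes "k\<^sup>2 < 1"
  shows "((\<lambda>\<theta>. elliptic_F \<theta> k) has_real_derivative 1 / sqrt (1 - k\<^sup>2 * (sin \<theta>)\<^sup>2)) (at \<theta>)"
proof -
  \<comment> \<open>A symmetric interval holding both \<open>0\<close> and \<open>\<theta>\<close>
    in its interior, so negative amplitudes are included and the derivative is two-sided.\<close>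
  let ?r = "\<bar>\<theta>\<bar> + 1"
  have "((\<lambda>u. LBINT t=ereal 0..ereal u. 1 / sqrt (1 - k\<^sup>2 * (sin t)\<^sup>2)) has_vector_derivative
      1 / sqrt (1 - k\<^sup>2 * (sin \<theta>)\<^sup>2)) (at \<theta> within {- ?r..?r})"
    by (rule interval_integral_FTC2) (auto intro: elliptic_integrand_continuous assms)
  then show ?thesis
    using at_within_Icc_at[of "- ?r" \<theta> ?r]
    by (simp add: elliptic_F_def[abs_def] has_real_derivative_iff_has_vector_derivative)
qed

lemma elliptic_F_strict_mono:
  assumes "k\<^sup>2 < 1" "\<theta> < \<theta>'" shows "elliptic_F \<theta> k < elliptic_F \<theta>' k"
  by (rule DERIV_pos_imp_increasing[OF assms(2)])
    (metis elliptic_F_deriv[OF assms(1)] elliptic_integrand_pos[OF assms(1)] real_sqrt_gt_0_iff zero_less_divide_1_iff)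

lemma elliptic_F_uminus:
  assumes "k\<^sup>2 < 1" shows "elliptic_F (- \<theta>) k = - elliptic_F \<theta> k"
proof -
  let ?w = "\<lambda>\<theta>. 1 / sqrt (1 - k\<^sup>2 * (sin \<theta>)\<^sup>2)"
  have "((\<lambda>\<theta>. elliptic_F (- \<theta>) k + elliptic_F \<theta> k) has_real_derivative ?w (- x) * - 1 + ?w x) (at x)" for x
    by (intro DERIV_add elliptic_F_deriv[OF assms] DERIV_chain2[OF elliptic_F_deriv[OF assms]] DERIV_minus DERIV_ident)
  then have "\<forall>x. ((\<lambda>\<theta>. elliptic_F (- \<theta>) k + elliptic_F \<theta> k) has_real_derivative 0) (at x)" by simp
  from DERIV_isconst_all[OF this, of \<theta> 0] show ?thesis by simp
qed

lemma elliptic_F_add_pi: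
  assumes "k\<^sup>2 < 1" shows "elliptic_F (\<theta> + pi) k = elliptic_F \<theta> k + 2 * elliptic_K k"
proof -
  let ?w = "\<lambda>\<theta>. 1 / sqrt (1 - k\<^sup>2 * (sin \<theta>)\<^sup>2)"
  have "((\<lambda>\<theta>. elliptic_F (\<theta> + pi) k - elliptic_F \<theta> k) has_real_derivative ?w (x + pi) * (1 + 0) - ?w x) (at x)" for x
    by (intro DERIV_diff elliptic_F_deriv[OF assms] DERIV_chain2[OF elliptic_F_deriv[OF assms]] DERIV_add DERIV_ident DERIV_const)
  then have "\<forall>x. ((\<lambda>\<theta>. elliptic_F (\<theta> + pi) k - elliptic_F \<theta> k) has_real_derivative 0) (at x)" by simp
  \<comment> \<open>At \<open>-pi/2\<close> the constant is \<open>F(pi/2) - F(-pi/2)\<close>, which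
    is \<open>2 K\<close> by oddness.\<close>
  from DERIV_isconst_all[OF this, of \<theta> "- (pi / 2)"] show ?thesis
    by (simp add: elliptic_F_uminus[OF assms] elliptic_K_eq_F)
qed

text \<open>The integrand is at least 1. The resulting linear growth makes \<open>elliptic_F\<close>
  surjective.\<close>

lemma elliptic_F_ge:
  assumes "k\<^sup>2 < 1" "\<theta> \<ge> 0" shows "\<theta> \<le> elliptic_F \<theta> k"
proof -
  have "1 / sqrt (1 - k\<^sup>2 * (sin x)\<^sup>2) - 1 \<ge> 0" for x
    using elliptic_integrand_pos[OF assms(1), of x] by (simp add: divide_simps)
  then have "elliptic_F 0 k - 0 \<le> elliptic_F \<theta> k - \<theta>"
    by (intro DERIV_nonneg_imp_nondecreasing[OF assms(2)])
      (metis DERIV_diff[OF elliptic_F_deriv[OF assms(1)] DERIV_ident])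
  then show ?thesis by simp
qed

lemma ex1_elliptic_F:
  assumes "k\<^sup>2 < 1" shows "\<exists>!\<theta>. elliptic_F \<theta> k = u"
proof (rule ex_ex1I)
  have c: "continuous_on S (\<lambda>\<theta>. elliptic_F \<theta> k)" for S
    using elliptic_F_deriv[OF assms] DERIV_isCont continuous_at_imp_continuous_on by blast
  have "elliptic_F (- \<bar>u\<bar>) k \<le> u" "u \<le> elliptic_F \<bar>u\<bar> k"
    using elliptic_F_ge[OF assms, of "\<bar>u\<bar>"] by (auto simp: elliptic_F_uminus[OF assms])
  then show "\<exists>\<theta>. elliptic_F \<theta> k = u"
    using IVT'[of "\<lambda>\<theta>. elliptic_F \<theta> k" "- \<bar>u\<bar>" u "\<bar>u\<bar>", OF _ _ _ c] by auto
  show "\<theta> = \<theta>'" if "elliptic_F \<theta> k = u" "elliptic_F \<theta>' k = u" for \<theta> \<theta>'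
    using elliptic_F_strict_mono[OF assms] that by (metis less_irrefl linorder_neqE_linordered_idom)
qed

lemma elliptic_F_jacobi_am: "k\<^sup>2 < 1 \<Longrightarrow> elliptic_F (jacobi_am u k) k = u"
  unfolding jacobi_am_def by (rule theI'[OF ex1_elliptic_F])

lemma jacobi_am_unique: "k\<^sup>2 < 1 \<Longrightarrow> elliptic_F \<theta> k = u \<Longrightarrow> jacobi_am u k = \<theta>"
  using ex1_elliptic_F[of k u] elliptic_F_jacobi_am[of k u] by blast

lemma jacobi_am_add_period:
  "k\<^sup>2 < 1 \<Longrightarrow> jacobi_am (u + 2 * elliptic_K k) k = jacobi_am u k + pi"
  by (rule jacobi_am_unique) (simp_all add: elliptic_F_add_pi elliptic_F_jacobi_am)

lemma jacobi_am_strict_mono: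
  assumes "k\<^sup>2 < 1" "u < u'" shows "jacobi_am u k < jacobi_am u' k"
  using elliptic_F_strict_mono[OF assms(1), of "jacobi_am u' k" "jacobi_am u k"] assms
    elliptic_F_jacobi_am[OF assms(1)]
  by (metis less_asym' linorder_neqE_linordered_idom)

lemma jacobi_am_0: "k\<^sup>2 < 1 \<Longrightarrow> jacobi_am 0 k = 0"
  by (rule jacobi_am_unique) simp_all

text \<open>Rescaling moves \<open>\<theta>\<close> from the limit of integration into the
  integrand, so that smoothness of integrals over a fixed interval applies, for either sign of
  \<open>\<theta>\<close>.\<close>

lemma elliptic_F_eq_integral:
  assumes "k\<^sup>2 < 1"
  shows "elliptic_F \<theta> k = \<theta> * integral {0..1} (\<lambda>s. 1 / sqrt (1 - k\<^sup>2 * (sin (\<theta> * s))\<^sup>2))"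
proof -
  let ?w = "\<lambda>\<theta>. 1 / sqrt (1 - k\<^sup>2 * (sin \<theta>)\<^sup>2)"
  have "((\<lambda>s. ?w (\<theta> * s) * (\<theta> * 1)) has_integral (elliptic_F (\<theta> * 1) k - elliptic_F (\<theta> * 0) k)) {0..1}"
  proof (rule fundamental_theorem_of_calculus)
    fix s :: real
    have "((\<lambda>s. elliptic_F (\<theta> * s) k) has_real_derivative ?w (\<theta> * s) * (\<theta> * 1)) (at s)"
      by (intro DERIV_chain2[OF elliptic_F_deriv[OF assms]] DERIV_cmult DERIV_ident)
    then show "((\<lambda>s. elliptic_F (\<theta> * s) k) has_vector_derivative ?w (\<theta> * s) * (\<theta> * 1)) (at s within {0..1})"
      by (simp add: has_real_derivative_iff_has_vector_derivative has_vector_derivative_at_within)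
  qed simp
  then have "integral {0..1} (\<lambda>s. ?w (\<theta> * s) * \<theta>) = elliptic_F \<theta> k" by (simp add: integral_unique)
  moreover have "integral {0..1} (\<lambda>s. ?w (\<theta> * s) * \<theta>) = integral {0..1} (\<lambda>s. ?w (\<theta> * s)) * \<theta>"
    by (rule integral_mult_left)
  ultimately show ?thesis by (simp only: mult.commute[of \<theta> "integral _ _"])
qed

text \<open>The amplitude is the unique zero of \<open>elliptic_F \<theta> k - u\<close>, whose
  \<open>\<theta>\<close>-derivative is the positive integrand. The second variable is the squared
  modulus, which is what the integrand contains.\<close>

lemma smooth_on_jacobi_am:
  "smooth_on (UNIV \<times> {0<..<1}) (\<lambda>p. jacobi_am (fst p) (sqrt (snd p)))"
proof (rule smooth_on_implicit[where V = "UNIV \<times> (UNIV \<times> {0<..<1})" and F =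
      "\<lambda>p. fst p * integral {0..1} (\<lambda>s. 1 / sqrt (1 - snd (snd p) * (sin (fst p * s))\<^sup>2)) - fst (snd p)"])
  let ?V = "UNIV \<times> (UNIV \<times> {0<..<1}) :: (real \<times> real \<times> real) set"
  let ?F = "\<lambda>p :: real \<times> real \<times> real. fst p * integral {0..1} (\<lambda>s. 1 / sqrt (1 - snd (snd p) * (sin (fst p * s))\<^sup>2)) - fst (snd p)"
  show o: "open ?V" by (intro open_Times) auto
  have pos: "0 < 1 - snd (snd (fst q)) * (sin (fst (fst q) * snd q))\<^sup>2"
    if "q \<in> ?V \<times> UNIV" for q :: "(real \<times> real \<times> real) \<times> real"
    using elliptic_integrand_pos[of "sqrt (snd (snd (fst q)))"] that by auto
  have "smooth_on ?V (\<lambda>p. integral {0..1}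
      (\<lambda>s. 1 / sqrt (1 - snd (snd (fst (p, s))) * (sin (fst (fst (p, s)) * snd (p, s)))\<^sup>2)))"
    by (rule smooth_on_integral[OF o, where g =
          "\<lambda>q. 1 / sqrt (1 - snd (snd (fst q)) * (sin (fst (fst q) * snd q))\<^sup>2)"])
      (intro smooth_intros pos; metis pos less_irrefl real_sqrt_gt_0_iff)
  then have i: "smooth_on ?V (\<lambda>p. integral {0..1} (\<lambda>s. 1 / sqrt (1 - snd (snd p) * (sin (fst p * s))\<^sup>2)))"
    by simp
  show sm: "smooth_on ?V ?F" by (intro smooth_intros i)
  fix x :: "real \<times> real" assume x: "x \<in> UNIV \<times> {0<..<1}"
  then have k: "(sqrt (snd x))\<^sup>2 < 1" "(sqrt (snd x))\<^sup>2 = snd x" by auto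
  have F: "?F (t, x) = elliptic_F t (sqrt (snd x)) - fst x" for t
    unfolding elliptic_F_eq_integral[OF k(1)] k(2) by simp
  show "(jacobi_am (fst x) (sqrt (snd x)), x) \<in> ?V" using x by auto
  show "?F (jacobi_am (fst x) (sqrt (snd x)), x) = 0"
    unfolding F by (simp add: elliptic_F_jacobi_am[OF k(1)])
  show "t = jacobi_am (fst x) (sqrt (snd x))" if "?F (t, x) = 0" for t
    using jacobi_am_unique[OF k(1), of t "fst x"] that unfolding F by simp
  let ?t = "jacobi_am (fst x) (sqrt (snd x))"
  have xV: "(?t, x) \<in> ?V" using x by auto
  have "(?F has_derivative (\<lambda>v. dir_deriv v ?F (?t, x))) (at (?t, x))"
    by (rule smooth_on_has_derivative[OF sm xV])
  moreover have "((\<lambda>t. (t, x)) has_derivative (\<lambda>s. (s, 0))) (at ?t)"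
    by (auto intro!: derivative_eq_intros)
  ultimately have "((\<lambda>t. ?F (t, x)) has_derivative (\<lambda>s. dir_deriv (s, 0) ?F (?t, x))) (at ?t)"
    by (rule has_derivative_compose[of "\<lambda>t. (t, x)" "\<lambda>s. (s, 0)" ?t UNIV ?F, rotated])
  \<comment> \<open>The partial derivative is computed on the unscaled \<open>elliptic_F\<close>,
    where it is just the integrand; uniqueness of derivatives transfers it to the rescaled
    form.\<close>
  moreover have "((\<lambda>t. ?F (t, x)) has_derivative (*) (1 / sqrt (1 - (sqrt (snd x))\<^sup>2 * (sin ?t)\<^sup>2) - 0)) (at ?t)"
    unfolding F has_field_derivative_def[symmetric]
    by (intro DERIV_diff elliptic_F_deriv[OF k(1)] DERIV_const)
  ultimately have "(\<lambda>s. dir_deriv (s, 0) ?F (?t, x)) = (*) (1 / sqrt (1 - (sqrt (snd x))\<^sup>2 * (sin ?t)\<^sup>2) - 0)"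
    using has_derivative_unique by blast
  then have "dir_deriv (1, 0) ?F (?t, x) = 1 / sqrt (1 - (sqrt (snd x))\<^sup>2 * (sin ?t)\<^sup>2)"
    by (drule_tac fun_cong[of _ _ 1]) simp
  then show "dir_deriv (1, 0) ?F (?t, x) \<noteq> 0"
    using elliptic_integrand_pos[OF k(1), of ?t] by simp
qed (auto intro: open_Times)

lemma jacobi_am_deriv:
  assumes "0 < k" "k < 1"
  shows "((\<lambda>u. jacobi_am u k) has_real_derivative sqrt (1 - k\<^sup>2 * (sin (jacobi_am u k))\<^sup>2)) (at u)"
proof -
  have k: "0 < k\<^sup>2" "k\<^sup>2 < 1" "sqrt (k\<^sup>2) = k" using assms by (auto simp: power2_less_1_iff)
  have "continuous_on UNIV (\<lambda>u. jacobi_am (fst (u, k\<^sup>2)) (sqrt (snd (u, k\<^sup>2))))"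
    by (rule continuous_on_compose2[OF smooth_on_continuous_on[OF smooth_on_jacobi_am]])
      (use k in \<open>auto intro!: continuous_intros\<close>)
  \<comment> \<open>The rule for derivatives of inverse functions presupposes continuity of the
    inverse.\<close>
  then have c: "isCont (\<lambda>u. jacobi_am u k) u" using k by (simp add: continuous_on_eq_continuous_at)
  have p: "0 < 1 - k\<^sup>2 * (sin (jacobi_am u k))\<^sup>2" by (rule elliptic_integrand_pos[OF k(2)])
  have "((\<lambda>u. jacobi_am u k) has_real_derivative inverse (1 / sqrt (1 - k\<^sup>2 * (sin (jacobi_am u k))\<^sup>2))) (at u)"
    by (rule DERIV_inverse_function[of "\<lambda>\<theta>. elliptic_F \<theta> k" _ _ _ "u - 1" "u + 1"])
      (use p c elliptic_F_deriv[OF k(2)] elliptic_F_jacobi_am[OF k(2)] in auto)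
  then show ?thesis by simp
qed

section \<open>The period function\<close>

definition elliptic_J :: "real \<times> real \<Rightarrow> real" where
  "elliptic_J p = integral {0..pi/2} (\<lambda>t. 1 / sqrt (fst p + snd p * cos (2 * t)))"

text \<open>Exactly the coefficients for which the radicand is positive for every \<open>t\<close>;
  the half-line \<open>D = 0\<close> of zero modulus lies inside.\<close>

definition period_cone :: "(real \<times> real) set" where
  "period_cone = {p. \<bar>snd p\<bar> < fst p}"

lemma open_period_cone: "open period_cone"
  unfolding period_cone_def by (intro open_Collect_less continuous_intros)

lemma period_cone_pos: "p \<in> period_cone \<Longrightarrow> fst p + snd p * cos t > 0"
proof -
  assume "p \<in> period_cone"
  moreover have "\<bar>snd p * cos t\<bar> \<le> \<bar>snd p\<bar> * 1"
    unfolding abs_mult by (rule mult_left_mono) auto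
  ultimately show ?thesis by (auto simp: period_cone_def)
qed

lemma smooth_on_elliptic_J: "smooth_on period_cone elliptic_J"
proof -
  have pos: "fst (fst q) + snd (fst q) * cos (2 * snd q) > 0"
    if "q \<in> period_cone \<times> UNIV" for q :: "(real \<times> real) \<times> real"
    using that period_cone_pos by auto
  have "smooth_on period_cone (\<lambda>p. integral {0..pi/2}
      (\<lambda>t. 1 / sqrt (fst (fst (p, t)) + snd (fst (p, t)) * cos (2 * snd (p, t)))))"
    by (rule smooth_on_integral[OF open_period_cone, where g =
          "\<lambda>q. 1 / sqrt (fst (fst q) + snd (fst q) * cos (2 * snd q))"])
      (intro smooth_intros pos; metis pos less_irrefl real_sqrt_gt_0_iff)
  then show ?thesis by (simp add: elliptic_J_def[abs_def])
qed

lemma has_derivative_elliptic_J: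
  assumes "p \<in> period_cone"
  shows "(elliptic_J has_derivative (\<lambda>v. integral {0..pi/2} (\<lambda>t.
      - (fst v + snd v * cos (2 * t))
        / (2 * (fst p + snd p * cos (2 * t)) * sqrt (fst p + snd p * cos (2 * t)))))) (at p)"
proof -
  let ?X = "\<lambda>q :: (real \<times> real) \<times> real. fst (fst q) + snd (fst q) * cos (2 * snd q)"
  \<comment> \<open>The full derivative, including the direction of \<open>t\<close>; that part
    vanishes on the directions \<open>(v, 0)\<close>.\<close>
  define g' where "g' = (\<lambda>q (v :: (real \<times> real) \<times> real).
      - (fst (fst v) + (snd (fst v) * cos (2 * snd q) - snd (fst q) * (2 * snd v * sin (2 * snd q))))
        / (2 * ?X q * sqrt (?X q)))"
  have pos: "?X q > 0" if "q \<in> period_cone \<times> UNIV" for q using that period_cone_pos by auto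
  have "((\<lambda>p. integral {0..pi/2} (\<lambda>t. 1 / sqrt (?X (p, t)))) has_derivative
      (\<lambda>v. integral {0..pi/2} (\<lambda>t. g' (p, t) (v, 0)))) (at p)"
  proof (rule has_derivative_parametric_integral[OF open_period_cone _ _ assms,
        where g = "\<lambda>q. 1 / sqrt (?X q)"])
    fix q :: "(real \<times> real) \<times> real" assume q: "q \<in> period_cone \<times> UNIV"
    have X: "(?X has_derivative (\<lambda>v. fst (fst v) +
        (snd (fst q) * (- (2 * snd v) * sin (2 * snd q)) + snd (fst v) * cos (2 * snd q)))) (at q)"
      by (auto intro!: derivative_eq_intros)
    have "((\<lambda>y. 1 / sqrt y) has_real_derivative - (1 / (2 * ?X q * sqrt (?X q)))) (at (?X q))"
      using pos[OF q] by (auto intro!: derivative_eq_intros simp: field_simps)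
    then have "((\<lambda>y. 1 / sqrt y) has_derivative (*) (- (1 / (2 * ?X q * sqrt (?X q))))) (at (?X q))"
      by (simp add: has_field_derivative_def)
    from has_derivative_compose[OF X this]
    show "((\<lambda>q. 1 / sqrt (?X q)) has_derivative g' q) (at q)"
      by (rule has_derivative_eq_rhs) (auto simp: g'_def fun_eq_iff divide_inverse algebra_simps)
  next
    fix v :: "(real \<times> real) \<times> real"
    show "continuous_on (period_cone \<times> UNIV) (\<lambda>x. g' x v)"
      unfolding g'_def using pos
      by (intro continuous_intros ballI) (metis less_irrefl mult_eq_0_iff real_sqrt_gt_0_iff zero_neq_numeral)
  qed
  moreover have "(\<lambda>p. integral {0..pi/2} (\<lambda>t. 1 / sqrt (?X (p, t)))) = elliptic_J"
    by (simp add: fun_eq_iff elliptic_J_def)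
  moreover have "g' (p, t) (v, 0) = - (fst v + snd v * cos (2 * t))
        / (2 * (fst p + snd p * cos (2 * t)) * sqrt (fst p + snd p * cos (2 * t)))" for v t
    by (simp add: g'_def)
  ultimately show ?thesis by simp
qed

lemma integral_cos_double: "integral {0..pi/2} (\<lambda>t. cos (2 * t)) = (0::real)"
proof -
  have "((\<lambda>t. cos (2 * t)) has_integral (sin (2 * (pi/2)) / 2 - sin (2 * 0) / 2)) {0..pi/2}"
    by (rule fundamental_theorem_of_calculus)
      (auto intro!: derivative_eq_intros simp flip: has_real_derivative_iff_has_vector_derivative)
  then show ?thesis by (simp add: integral_unique)
qed

text \<open>Replacing \<open>(S + D cos 2t) powr (-3/2)\<close> by \<open>S powr (-3/2)\<close> in the \<open>D\<close>-derivative only decreases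
  it, and afterwards that term integrates to zero.\<close>

lemma elliptic_J_derivative_pos:
  assumes p: "p \<in> period_cone" and D: "snd p \<ge> 0" and v: "fst v < 0" "snd v \<ge> 0"
  shows "integral {0..pi/2} (\<lambda>t. - (fst v + snd v * cos (2 * t))
        / (2 * (fst p + snd p * cos (2 * t)) * sqrt (fst p + snd p * cos (2 * t)))) > 0"
proof -
  define X where "X = (\<lambda>t. fst p + snd p * cos (2 * t))"
  define R where "R = (\<lambda>x::real. 1 / (2 * x * sqrt x))"
  have X: "X t > 0" for t unfolding X_def using period_cone_pos[OF p] .
  have R: "R y \<le> R x" if "0 < x" "x \<le> y" for x y
    unfolding R_def using that by (intro divide_left_mono mult_mono) auto
  have S: "fst p > 0" using p by (auto simp: period_cone_def)
  \<comment> \<open>In the first term \<open>X t\<close> is replaced by its maximum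
    \<open>S + D\<close>. This leaves a positive constant, which is all that survives
    integration.\<close>
  define low where "low = (\<lambda>t. (- fst v * R (fst p + snd p)) - (snd v * R (fst p)) * cos (2 * t))"
  have le: "low t \<le> - (fst v + snd v * cos (2 * t)) / (2 * X t * sqrt (X t))" for t
  proof -
    have "snd p * cos (2 * t) \<le> snd p * 1" by (rule mult_left_mono) (use D in auto)
    then have "R (fst p + snd p) \<le> R (X t)" by (intro R X) (simp add: X_def)
    then have 1: "- fst v * R (fst p + snd p) \<le> - fst v * R (X t)" using v by (intro mult_left_mono) auto
    \<comment> \<open>Where the cosine is nonnegative, \<open>X t \<ge> S\<close> makes
      \<open>R (X t)\<close> the smaller factor; where it is negative, the factor is larger but the
      product is again smaller.\<close>
    have 2: "cos (2 * t) * R (X t) \<le> cos (2 * t) * R (fst p)"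
    proof (cases "cos (2 * t) \<ge> 0")
      case True
      then have "R (X t) \<le> R (fst p)" using D S by (intro R) (auto simp: X_def)
      then show ?thesis using True by (rule mult_left_mono)
    next
      case False
      then have "R (fst p) \<le> R (X t)" using D by (intro R X) (auto simp: X_def mult_nonneg_nonpos)
      then show ?thesis using False by (intro mult_left_mono_neg) auto
    qed
    have "snd v * (cos (2 * t) * R (X t)) \<le> snd v * (cos (2 * t) * R (fst p))"
      by (rule mult_left_mono[OF 2 v(2)])
    with 1 have "low t \<le> - fst v * R (X t) - snd v * (cos (2 * t) * R (X t))"
      by (simp add: low_def mult_ac)
    also have "\<dots> = - (fst v + snd v * cos (2 * t)) / (2 * X t * sqrt (X t))"
      by (simp add: R_def diff_divide_distrib)
    finally show ?thesis .
  qed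
  have "0 < - fst v * R (fst p + snd p) * (pi/2)"
    using v S D by (intro mult_pos_pos) (auto simp: R_def)
  also have "\<dots> = integral {0..pi/2} low"
  proof -
    have "integral {0..pi/2} low = integral {0..pi/2} (\<lambda>t. - fst v * R (fst p + snd p))
        - integral {0..pi/2} (\<lambda>t. (snd v * R (fst p)) * cos (2 * t))"
      unfolding low_def
      by (intro integral_diff integrable_continuous_real continuous_intros)
    then show ?thesis by (simp add: integral_cos_double)
  qed
  also have "\<dots> \<le> integral {0..pi/2} (\<lambda>t. - (fst v + snd v * cos (2 * t)) / (2 * X t * sqrt (X t)))"
  proof (rule integral_le)
    show "low integrable_on {0..pi/2}"
      unfolding low_def by (intro integrable_continuous_real continuous_intros)
    have cX: "continuous_on {0..pi/2} X" unfolding X_def by (intro continuous_intros)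
    have "2 * X t * sqrt (X t) \<noteq> 0" for t using X[of t] by simp
    then show "(\<lambda>t. - (fst v + snd v * cos (2 * t)) / (2 * X t * sqrt (X t))) integrable_on {0..pi/2}"
      by (intro integrable_continuous_real continuous_on_divide continuous_intros cX ballI)
  qed (use le in blast)
  finally show ?thesis unfolding X_def .
qed

text \<open>With \<open>s = pi/2 - t\<close> the radicand is \<open>S - D + 2 D (sin s)^2\<close>,
  at most \<open>S - D + 2 D s^2\<close>. Where \<open>s\<close> exceeds a cutoff, the smallness of
  \<open>S - D\<close> bounds this by \<open>4 D s^2\<close>, and \<open>1/s\<close> integrates to a
  logarithm.\<close>

lemma elliptic_J_ge:
  assumes p: "p \<in> period_cone" and D: "snd p > 0" and N: "N \<ge> 0"
    and small: "fst p - snd p \<le> 2 * snd p * (pi / 2 * exp (- N))\<^sup>2"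
  shows "elliptic_J p \<ge> N / (2 * sqrt (snd p))"
proof -
  \<comment> \<open>The cutoff for which \<open>ln (pi/2) - ln d = N\<close>.\<close>
  define d where "d = pi / 2 * exp (- N)"
  have d: "0 < d" "d \<le> pi/2" using N by (auto simp: d_def)
  let ?f = "\<lambda>t. 1 / sqrt (fst p + snd p * cos (2 * t))"
  let ?h = "\<lambda>t. 1 / (2 * sqrt (snd p) * (pi / 2 - t))"
  have cf: "continuous_on T ?f" for T
    using period_cone_pos[OF p] by (intro continuous_intros ballI) (metis less_irrefl real_sqrt_gt_0_iff)
  have h: "(?h has_integral (- ln (pi / 2 - (pi / 2 - d)) / (2 * sqrt (snd p))
      - (- ln (pi / 2 - 0) / (2 * sqrt (snd p))))) {0..pi/2 - d}"
    by (rule fundamental_theorem_of_calculus)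
      (use d D in \<open>auto intro!: derivative_eq_intros
        simp: field_simps simp flip: has_real_derivative_iff_has_vector_derivative\<close>)
  have "ln d = ln (pi/2) - N" unfolding d_def by (subst ln_mult) auto
  then have "N / (2 * sqrt (snd p)) = integral {0..pi/2 - d} ?h"
    using integral_unique[OF h] by (simp add: diff_divide_distrib)
  also have "\<dots> \<le> integral {0..pi/2 - d} ?f"
  proof (rule integral_le)
    show "?h integrable_on {0..pi/2 - d}" using h by blast
    show "?f integrable_on {0..pi/2 - d}" by (intro integrable_continuous_real cf)
    fix t assume t: "t \<in> {0..pi/2 - d}"
    define s where "s = pi/2 - t"
    have s: "d \<le> s" "0 < s" using t d by (auto simp: s_def)
    have "cos (2 * t) = 2 * (sin s)\<^sup>2 - 1"
      unfolding s_def by (simp add: cos_double_cos sin_diff)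
    moreover have "(sin s)\<^sup>2 \<le> s\<^sup>2"
      using abs_sin_x_le_abs_x[of s] abs_le_square_iff by blast
    then have "snd p * (2 * (sin s)\<^sup>2) \<le> snd p * (2 * s\<^sup>2)" using D by (intro mult_left_mono) auto
    moreover have "2 * snd p * d\<^sup>2 \<le> 2 * snd p * s\<^sup>2"
      using s d D by (intro mult_left_mono power_mono) auto
    ultimately have "fst p + snd p * cos (2 * t) \<le> 4 * (snd p * s\<^sup>2)"
      using small unfolding d_def[symmetric] by (simp only: right_diff_distrib)
    then have "sqrt (fst p + snd p * cos (2 * t)) \<le> sqrt (4 * (snd p * s\<^sup>2))"
      by (rule real_sqrt_le_mono)
    also have "\<dots> = 2 * sqrt (snd p) * s" using s by (simp add: real_sqrt_mult)
    finally show "?h t \<le> ?f t"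
      using period_cone_pos[OF p, of "2 * t"] unfolding s_def by (intro frac_le) auto
  qed
  also have "\<dots> \<le> integral {0..pi/2} ?f"
    by (rule integral_subset_le)
      (use d period_cone_pos[OF p] in \<open>auto intro!: integrable_continuous_real cf simp: less_imp_le\<close>)
  finally show ?thesis unfolding elliptic_J_def .
qed

text \<open>The coefficients below come from \<open>S + D cos 2t = a b (1 - k\<^sup>2 (sin t)\<^sup>2)\<close>.\<close>

definition wave_dom :: "(real \<times> real) set" where
  "wave_dom = {p. 0 < fst p \<and> snd p < fst p + (fst p)\<^sup>2 \<and> 2 * (fst p)\<^sup>2 + 3 * fst p < 6 * snd p}"

definition wave_b :: "real \<times> real \<Rightarrow> real" where
  "wave_b p = sqrt (48 * snd p - 12 * (fst p)\<^sup>2 - 12 * fst p + 9)"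

definition wave_S :: "real \<times> real \<Rightarrow> real" where
  "wave_S p = (3 * (fst p * wave_b p) - (6 * (fst p)\<^sup>2 + 9 * fst p - 12 * snd p)) / 4"

definition wave_D :: "real \<times> real \<Rightarrow> real" where
  "wave_D p = (fst p * wave_b p + (6 * (fst p)\<^sup>2 + 9 * fst p - 12 * snd p)) / 4"

section \<open>The parameter domain and the signs of \<open>S\<close> and \<open>D\<close>\<close>

lemma open_wave_dom: "open wave_dom"
  unfolding wave_dom_def by (intro open_Collect_conj open_Collect_less continuous_intros)

lemma alpha3_lower_iff:
  assumes "\<omega> > 0" shows "(sqrt (1 + 4 * \<omega>) - 1) / 2 < a \<longleftrightarrow> 0 < a \<and> \<omega> < a + a\<^sup>2"
proof -
  have "1 < sqrt (1 + 4 * \<omega>)" using assms by simp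
  moreover have "sqrt (1 + 4 * \<omega>) < 2 * a + 1 \<longleftrightarrow> 1 + 4 * \<omega> < (2 * a + 1)\<^sup>2" if "a > 0"
  proof -
    have "sqrt ((2 * a + 1)\<^sup>2) = 2 * a + 1" using that by simp
    then show ?thesis by (metis real_sqrt_less_iff)
  qed
  moreover have "a > 0" if "sqrt (1 + 4 * \<omega>) < 2 * a + 1"
    using that \<open>1 < sqrt (1 + 4 * \<omega>)\<close> by linarith
  moreover have "(2 * a + 1)\<^sup>2 = 1 + 4 * (a + a\<^sup>2)" by (simp add: power2_eq_square algebra_simps)
  ultimately show ?thesis by auto
qed

lemma alpha3_upper_iff:
  assumes "a > 0" shows "a < (sqrt (48 * \<omega> + 9) - 3) / 4 \<longleftrightarrow> 2 * a\<^sup>2 + 3 * a < 6 * \<omega>"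
proof -
  have "sqrt ((4 * a + 3)\<^sup>2) = 4 * a + 3" using assms by simp
  then have "4 * a + 3 < sqrt (48 * \<omega> + 9) \<longleftrightarrow> (4 * a + 3)\<^sup>2 < 48 * \<omega> + 9"
    by (metis real_sqrt_less_iff)
  moreover have "(4 * a + 3)\<^sup>2 = 9 + 8 * (2 * a\<^sup>2 + 3 * a)" by (simp add: power2_eq_square algebra_simps)
  ultimately show ?thesis by auto
qed

text \<open>Squaring turns both endpoints into polynomial inequalities, which describe an open set
  in the plane of \<open>(a, \<omega>)\<close>, as required for the implicit function
  theorem.\<close>

lemma alpha3_range_iff:
  assumes "\<omega> > 0" shows "a \<in> alpha3_range \<omega> \<longleftrightarrow> (a, \<omega>) \<in> wave_dom"
  using alpha3_lower_iff[OF assms] alpha3_upper_iff unfolding alpha3_range_def wave_dom_def by auto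

lemma wave_dom_pos: "p \<in> wave_dom \<Longrightarrow> 0 < fst p \<and> 0 < snd p"
  unfolding wave_dom_def using zero_le_power2[of "fst p"] by (auto simp del: zero_le_power2)

text \<open>\<open>b^2 - (2a+3)^2 = 8 (6 \<omega> - 2a^2 - 3a)\<close> and
  \<open>(6a+3)^2 - b^2 = 48 (a + a^2 - \<omega>)\<close>, so the two bounds on \<open>b\<close> are
  the two ends of the range. In terms of the roots they say
  \<open>0 < \<alpha>2 < \<alpha>3\<close>.\<close>

lemma wave_b_bounds:
  assumes "p \<in> wave_dom"
  shows "(wave_b p)\<^sup>2 = 48 * snd p - 12 * (fst p)\<^sup>2 - 12 * fst p + 9"
    and "2 * fst p + 3 < wave_b p" and "wave_b p < 6 * fst p + 3"
    and "0 < 48 * snd p - 12 * (fst p)\<^sup>2 - 12 * fst p + 9"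
proof -
  let ?r = "48 * snd p - 12 * (fst p)\<^sup>2 - 12 * fst p + 9"
  have a: "fst p > 0" using assms by (simp add: wave_dom_def)
  have lo: "(2 * fst p + 3)\<^sup>2 < ?r" and hi: "?r < (6 * fst p + 3)\<^sup>2"
    using assms by (auto simp: wave_dom_def power2_eq_square algebra_simps)
  then show "0 < ?r" using zero_le_power2[of "2 * fst p + 3"] by linarith
  then show "(wave_b p)\<^sup>2 = ?r" by (simp add: wave_b_def)
  show "2 * fst p + 3 < wave_b p" unfolding wave_b_def by (rule real_less_rsqrt[OF lo])
  show "wave_b p < 6 * fst p + 3"
    unfolding wave_b_def using real_sqrt_less_mono[OF hi] a by simp
qed

text \<open>In terms of the roots: \<open>D = -\<alpha>1 (\<alpha>3 - \<alpha>2)\<close> and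
  \<open>S - D = 2 \<alpha>2 (\<alpha>3 - \<alpha>1)\<close>. Thus \<open>D\<close> vanishes at the
  lower end, where \<open>\<alpha>2 = \<alpha>3\<close>, and \<open>S - D\<close> at the upper end,
  where \<open>\<alpha>2 = 0\<close>.\<close>

lemma wave_SD_identities:
  assumes "p \<in> wave_dom"
  shows "16 * wave_D p = (wave_b p + 2 * fst p + 3) * (6 * fst p + 3 - wave_b p)"
    and "8 * (wave_S p - wave_D p) = (wave_b p - (2 * fst p + 3)) * (wave_b p + 6 * fst p + 3)"
    and "wave_S p + wave_D p = fst p * wave_b p"
proof -
  have b: "wave_b p * wave_b p = 48 * snd p - 12 * (fst p)\<^sup>2 - 12 * fst p + 9"
    using wave_b_bounds(1)[OF assms] by (simp add: power2_eq_square)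
  have "16 * wave_D p = 4 * (fst p * wave_b p + (6 * (fst p)\<^sup>2 + 9 * fst p - 12 * snd p))"
    by (simp add: wave_D_def)
  with b show "16 * wave_D p = (wave_b p + 2 * fst p + 3) * (6 * fst p + 3 - wave_b p)"
    by (simp add: power2_eq_square algebra_simps)
  have "8 * (wave_S p - wave_D p) = 4 * (fst p * wave_b p - (6 * (fst p)\<^sup>2 + 9 * fst p - 12 * snd p))"
    by (simp add: wave_S_def wave_D_def field_simps)
  with b show "8 * (wave_S p - wave_D p) = (wave_b p - (2 * fst p + 3)) * (wave_b p + 6 * fst p + 3)"
    by (simp add: power2_eq_square algebra_simps)
  show "wave_S p + wave_D p = fst p * wave_b p" by (simp add: wave_S_def wave_D_def field_simps)
qed

lemma wave_SD_cone:
  assumes "p \<in> wave_dom"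
  shows "wave_D p > 0" "(wave_S p, wave_D p) \<in> period_cone"
proof -
  note b = wave_b_bounds[OF assms]
  have a: "fst p > 0" using wave_dom_pos assms by blast
  have "16 * wave_D p > 0" "8 * (wave_S p - wave_D p) > 0"
    unfolding wave_SD_identities[OF assms] using a b by auto
  then show "wave_D p > 0" "(wave_S p, wave_D p) \<in> period_cone" by (auto simp: period_cone_def)
qed

lemma smooth_on_wave_b [smooth_intros]: "smooth_on wave_dom wave_b"
  unfolding wave_b_def[abs_def] by (intro smooth_intros) (rule wave_b_bounds(4))

lemma smooth_on_wave_S [smooth_intros]: "smooth_on wave_dom wave_S"
  and smooth_on_wave_D [smooth_intros]: "smooth_on wave_dom wave_D"
  unfolding wave_S_def[abs_def] wave_D_def[abs_def] by (intro smooth_intros; simp)+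

lemma smooth_on_wave_period: "smooth_on wave_dom (\<lambda>p. elliptic_J (wave_S p, wave_D p))"
  by (rule smooth_on_compose[OF smooth_on_elliptic_J]) (intro smooth_intros, rule wave_SD_cone(2))

text \<open>The vector \<open>(S', D')\<close> of \<open>a\<close>-derivatives satisfies
  \<open>S' < 0 < D'\<close>, and \<open>J\<close> increases in such directions.\<close>

lemma wave_period_partial_pos:
  assumes "(a, \<omega>) \<in> wave_dom"
  shows "\<exists>d>0. ((\<lambda>a. elliptic_J (wave_S (a, \<omega>), wave_D (a, \<omega>))) has_real_derivative d) (at a)"
proof -
  note b = wave_b_bounds[OF assms, simplified]
  have a: "a > 0" using wave_dom_pos[OF assms] by simp
  let ?b = "wave_b (a, \<omega>)"
  have bp: "?b > 0" using a b by linarith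
  define b' where "b' = - (12 * a + 6) / ?b"
  have "((\<lambda>a. 48 * \<omega> - 12 * a\<^sup>2 - 12 * a + 9) has_real_derivative (- (24 * a) - 12)) (at a)"
    by (auto intro!: derivative_eq_intros)
  from DERIV_chain2[OF DERIV_real_sqrt[OF b(4)] this]
  have "((\<lambda>a. wave_b (a, \<omega>)) has_real_derivative inverse ?b / 2 * (- (24 * a) - 12)) (at a)"
    by (simp add: wave_b_def)
  moreover have "inverse ?b / 2 * (- (24 * a) - 12) = b'"
    using bp by (simp add: b'_def field_simps)
  ultimately have "((\<lambda>a. wave_b (a, \<omega>)) has_real_derivative b') (at a)" by simp
  note db = DERIV_mult[OF DERIV_ident this]
  define S' where "S' = (3 * (?b + a * b') - (12 * a + 9)) / 4"
  define D' where "D' = (?b + a * b' + (12 * a + 9)) / 4"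
  have dM: "((\<lambda>a. 6 * a\<^sup>2 + 9 * a - 12 * \<omega>) has_real_derivative (12 * a + 9)) (at a)"
    by (auto intro!: derivative_eq_intros)
  have dS: "((\<lambda>a. wave_S (a, \<omega>)) has_real_derivative S') (at a)"
    unfolding wave_S_def S'_def fst_conv snd_conv
    by (rule DERIV_cdivide, rule DERIV_diff[OF _ dM], rule DERIV_cmult)
      (use db in \<open>simp add: mult.commute add.commute\<close>)
  have dD: "((\<lambda>a. wave_D (a, \<omega>)) has_real_derivative D') (at a)"
    unfolding wave_D_def D'_def fst_conv snd_conv
    by (rule DERIV_cdivide, rule DERIV_add[OF _ dM])
      (use db in \<open>simp add: mult.commute add.commute\<close>)
  have bb': "?b * b' = - (12 * a + 6)" unfolding b'_def using bp by simp
  \<comment> \<open>Multiplication by \<open>b\<close> clears the denominator of \<open>b'\<close>.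
    The factorisation is negative because \<open>b < 6a + 3\<close>; for \<open>D'\<close> below,
    the bound \<open>b > 2a + 3\<close> is used.\<close>
  have "?b * (4 * S') = 3 * ((?b - (6 * a + 3)) * (?b + 2 * a))"
  proof -
    have "?b * (4 * S') = 3 * (?b * ?b + a * (?b * b')) - ?b * (12 * a + 9)"
      unfolding S'_def by (simp add: field_simps)
    then show ?thesis unfolding bb' by (simp add: algebra_simps)
  qed
  moreover have "(?b - (6 * a + 3)) * (?b + 2 * a) < 0"
    using b a bp by (intro mult_neg_pos) auto
  ultimately have "?b * (4 * S') < 0" by linarith
  then have S': "S' < 0" using bp by (simp add: mult_less_0_iff)
  have "?b * (4 * D') = ?b * ?b - 12 * a\<^sup>2 - 6 * a + ?b * (12 * a + 9)"
  proof -
    have "?b * (4 * D') = ?b * ?b + a * (?b * b') + ?b * (12 * a + 9)"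
      unfolding D'_def by (simp add: field_simps)
    then show ?thesis unfolding bb' by (simp add: algebra_simps power2_eq_square)
  qed
  moreover have "(2 * a + 3) * (12 * a + 9) < ?b * (12 * a + 9)"
    using b a by (intro mult_strict_right_mono) auto
  moreover have "12 * a\<^sup>2 + 6 * a < (2 * a + 3) * (12 * a + 9)" "0 < ?b * ?b"
    using a bp by (auto simp: power2_eq_square algebra_simps)
      (smt (verit) mult_pos_pos)
  ultimately have "?b * (4 * D') > 0" by linarith
  then have D': "D' > 0" using bp by (simp add: zero_less_mult_iff)
  let ?p = "(wave_S (a, \<omega>), wave_D (a, \<omega>))"
  let ?d = "integral {0..pi/2} (\<lambda>t. - (S' + D' * cos (2 * t))
        / (2 * (fst ?p + snd ?p * cos (2 * t)) * sqrt (fst ?p + snd ?p * cos (2 * t))))"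
  have J: "(elliptic_J has_derivative (\<lambda>v. integral {0..pi/2} (\<lambda>t.
      - (fst v + snd v * cos (2 * t))
        / (2 * (fst ?p + snd ?p * cos (2 * t)) * sqrt (fst ?p + snd ?p * cos (2 * t)))))) (at ?p)"
    by (rule has_derivative_elliptic_J[OF wave_SD_cone(2)[OF assms]])
  have "((\<lambda>a. (wave_S (a, \<omega>), wave_D (a, \<omega>))) has_derivative (\<lambda>h. (S' * h, D' * h))) (at a)"
    using dS dD by (auto intro!: has_derivative_Pair simp: has_field_derivative_def)
  from has_derivative_compose[OF this J]
  have "((\<lambda>a. elliptic_J (wave_S (a, \<omega>), wave_D (a, \<omega>))) has_derivative
     (\<lambda>h. integral {0..pi/2} (\<lambda>t. - (S' * h + D' * h * cos (2 * t))
        / (2 * (fst ?p + snd ?p * cos (2 * t)) * sqrt (fst ?p + snd ?p * cos (2 * t)))))) (at a)"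
    by simp
  moreover have "(\<lambda>h. integral {0..pi/2} (\<lambda>t. - (S' * h + D' * h * cos (2 * t))
        / (2 * (fst ?p + snd ?p * cos (2 * t)) * sqrt (fst ?p + snd ?p * cos (2 * t))))) = (*) ?d"
  proof
    fix h
    have "(\<lambda>t. - (S' * h + D' * h * cos (2 * t))
        / (2 * (fst ?p + snd ?p * cos (2 * t)) * sqrt (fst ?p + snd ?p * cos (2 * t)))) =
      (\<lambda>t. - (S' + D' * cos (2 * t))
        / (2 * (fst ?p + snd ?p * cos (2 * t)) * sqrt (fst ?p + snd ?p * cos (2 * t))) * h)"
      by (simp add: fun_eq_iff algebra_simps flip: add_divide_distrib)
    then show "integral {0..pi/2} (\<lambda>t. - (S' * h + D' * h * cos (2 * t))
        / (2 * (fst ?p + snd ?p * cos (2 * t)) * sqrt (fst ?p + snd ?p * cos (2 * t)))) = ?d * h"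
      by (simp only: integral_mult_left)
  qed
  ultimately have "((\<lambda>a. elliptic_J (wave_S (a, \<omega>), wave_D (a, \<omega>))) has_real_derivative ?d) (at a)"
    unfolding has_field_derivative_def by (rule has_derivative_eq_rhs)
  moreover have "?d > 0"
    using elliptic_J_derivative_pos[OF wave_SD_cone(2)[OF assms], of "(S', D')"]
      wave_SD_cone(1)[OF assms] S' D' by simp
  ultimately show ?thesis by blast
qed

section \<open>The period in terms of \<open>K\<close> and of \<open>J\<close>\<close>

lemma elliptic_K_eq_integral:
  assumes "k\<^sup>2 < 1"
  shows "elliptic_K k = integral {0..pi/2} (\<lambda>t. 1 / sqrt (1 - k\<^sup>2 * (sin t)\<^sup>2))"
  unfolding elliptic_K_def
  by (intro interval_integral_eq_integral borel_integrable_atLeastAtMost'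
      elliptic_integrand_continuous assms) simp

lemma dn_q_eq_wave_b: "sqrt 3 * sqrt (dn_q a \<omega>) = wave_b (a, \<omega>)"
  by (simp add: dn_q_def wave_b_def flip: real_sqrt_mult)

lemma dn_ksq_eq:
  assumes "(a, \<omega>) \<in> wave_dom"
  shows "dn_ksq a \<omega> = 2 * wave_D (a, \<omega>) / (a * wave_b (a, \<omega>))"
proof -
  have e: "sqrt 3 * a * sqrt (dn_q a \<omega>) = a * wave_b (a, \<omega>)"
    "2 * sqrt 3 * a * sqrt (dn_q a \<omega>) = 2 * (a * wave_b (a, \<omega>))"
    by (simp_all flip: dn_q_eq_wave_b)
  have h: "2 * (z / 4) / x = z / (2 * x)" for x z :: real by simp
  show ?thesis unfolding dn_ksq_def wave_D_def e h by (simp add: algebra_simps)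
qed

lemma wave_ab_pos: "p \<in> wave_dom \<Longrightarrow> 0 < fst p * wave_b p"
  using wave_dom_pos[of p] wave_b_bounds(2)[of p] by (intro mult_pos_pos) auto

lemma dn_ksq_bounds:
  assumes "(a, \<omega>) \<in> wave_dom"
  shows "0 < dn_ksq a \<omega>" "dn_ksq a \<omega> < 1"
  using wave_SD_cone[OF assms] wave_SD_identities(3)[OF assms] wave_ab_pos[OF assms]
  unfolding dn_ksq_eq[OF assms] period_cone_def by (auto simp: divide_less_eq)

text \<open>The first form is matched with the period \<open>2 K\<close> of the squared sine; the
  second is used for monotonicity and for the implicit function theorem.\<close>

lemma dn_T_eq:
  assumes "(a, \<omega>) \<in> wave_dom"
  shows "dn_T a \<omega> = 2 * sqrt 6 * elliptic_K (dn_k a \<omega>) / sqrt (a * wave_b (a, \<omega>))"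
    and "dn_T a \<omega> = 2 * sqrt 6 * elliptic_J (wave_S (a, \<omega>), wave_D (a, \<omega>))"
proof -
  let ?P = "a * wave_b (a, \<omega>)" and ?m = "dn_ksq a \<omega>"
  have P: "?P > 0" using wave_ab_pos[OF assms] by simp
  have a: "a > 0" using wave_dom_pos[OF assms] by simp
  have q: "dn_q a \<omega> > 0" using wave_b_bounds(4)[OF assms] by (simp add: dn_q_def)
  have r: "x powr (1/4) = sqrt (sqrt x)" if "x > 0" for x :: real
    using that by (simp add: powr_half_sqrt[symmetric] powr_powr)
  have "sqrt ?P = sqrt a * (sqrt (sqrt 3) * sqrt (sqrt (dn_q a \<omega>)))"
    by (simp add: real_sqrt_mult flip: dn_q_eq_wave_b)
  moreover have "sqrt 8 * sqrt (sqrt 3) * sqrt (sqrt 3) = 2 * sqrt 6"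
  proof -
    have "sqrt 8 * sqrt (sqrt 3) * sqrt (sqrt 3) = sqrt 8 * sqrt 3" by simp
    also have "\<dots> = sqrt (2\<^sup>2 * 6)" by (simp flip: real_sqrt_mult)
    also have "\<dots> = 2 * sqrt 6" by (subst real_sqrt_mult) simp
    finally show ?thesis .
  qed
  ultimately show K: "dn_T a \<omega> = 2 * sqrt 6 * elliptic_K (dn_k a \<omega>) / sqrt ?P"
    unfolding dn_T_def using q a by (simp add: r field_simps)
  have k2: "(dn_k a \<omega>)\<^sup>2 = ?m" using dn_ksq_bounds(1)[OF assms] by (simp add: dn_k_def)
  have "elliptic_K (dn_k a \<omega>) / sqrt ?P = integral {0..pi/2} (\<lambda>t. 1 / sqrt (1 - ?m * (sin t)\<^sup>2) / sqrt ?P)"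
    using elliptic_K_eq_integral[of "dn_k a \<omega>"] dn_ksq_bounds(2)[OF assms] k2
    by (simp only: integral_divide)
  also have "\<dots> = integral {0..pi/2} (\<lambda>t. 1 / sqrt (wave_S (a, \<omega>) + wave_D (a, \<omega>) * cos (2 * t)))"
  proof (rule integral_cong)
    fix t
    have "?P \<noteq> 0" using P by linarith
    then have "?P * ?m = 2 * wave_D (a, \<omega>)"
      unfolding dn_ksq_eq[OF assms] times_divide_eq_right by (rule nonzero_mult_div_cancel_left)
    then have "?P * (1 - ?m * (sin t)\<^sup>2) = ?P - 2 * wave_D (a, \<omega>) * (sin t)\<^sup>2"
      by (simp only: right_diff_distrib mult.assoc[symmetric] mult_1_right)
    also have "\<dots> = wave_S (a, \<omega>) + wave_D (a, \<omega>) * cos (2 * t)"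
      unfolding wave_SD_identities(3)[OF assms, simplified, symmetric] cos_double_sin
      by (simp add: right_diff_distrib)
    finally have "sqrt ?P * sqrt (1 - ?m * (sin t)\<^sup>2) = sqrt (wave_S (a, \<omega>) + wave_D (a, \<omega>) * cos (2 * t))"
      by (simp flip: real_sqrt_mult)
    then show "1 / sqrt (1 - ?m * (sin t)\<^sup>2) / sqrt ?P =
        1 / sqrt (wave_S (a, \<omega>) + wave_D (a, \<omega>) * cos (2 * t))"
      by (simp add: mult.commute)
  qed
  finally show "dn_T a \<omega> = 2 * sqrt 6 * elliptic_J (wave_S (a, \<omega>), wave_D (a, \<omega>))"
    unfolding K elliptic_J_def fst_conv snd_conv by (simp only: times_divide_eq_right[symmetric])
qed

lemma dn_T_strict_mono:
  assumes "\<omega> > 0" "a \<in> alpha3_range \<omega>" "a' \<in> alpha3_range \<omega>" "a < a'"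
  shows "dn_T a \<omega> < dn_T a' \<omega>"
proof -
  have dom: "(x, \<omega>) \<in> wave_dom" if "a \<le> x" "x \<le> a'" for x
  proof -
    have "x \<in> alpha3_range \<omega>" using that assms by (auto simp: alpha3_range_def)
    then show ?thesis using alpha3_range_iff[OF assms(1)] by blast
  qed
  have "elliptic_J (wave_S (a, \<omega>), wave_D (a, \<omega>)) < elliptic_J (wave_S (a', \<omega>), wave_D (a', \<omega>))"
    using wave_period_partial_pos[OF dom] by (intro DERIV_pos_imp_increasing[OF assms(4)]) blast
  then show ?thesis using dn_T_eq(2)[OF dom] assms(4) by simp
qed

section \<open>Existence of exactly one wave of prescribed period\<close>

text \<open>At the upper end \<open>b = 2a + 3\<close>, hence \<open>S = D\<close>, so the
  logarithmic lower bound for \<open>J\<close> becomes arbitrarily large nearby. The domain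
  condition stays as a premise because \<open>a\<^sub>0\<close> may lie below the lower end.\<close>

lemma ex_long_period:
  assumes \<omega>: "\<omega> > 0" and a0: "a\<^sub>0 < (sqrt (48 * \<omega> + 9) - 3) / 4"
  shows "\<exists>a. a\<^sub>0 < a \<and> a < (sqrt (48 * \<omega> + 9) - 3) / 4 \<and>
    ((a, \<omega>) \<in> wave_dom \<longrightarrow> B < elliptic_J (wave_S (a, \<omega>), wave_D (a, \<omega>)))"
proof -
  define a1 where "a1 = (sqrt (48 * \<omega> + 9) - 3) / 4"
  have "3 < sqrt (48 * \<omega> + 9)" using \<omega> by (intro real_less_rsqrt) auto
  then have a1: "a1 > 0" by (simp add: a1_def)
  have "4 * a1 + 3 = sqrt (48 * \<omega> + 9)" by (simp add: a1_def field_simps)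
  then have "(4 * a1 + 3)\<^sup>2 = 48 * \<omega> + 9" using \<omega> by simp
  then have w: "12 * \<omega> = 4 * a1\<^sup>2 + 6 * a1" by (simp add: power2_eq_square algebra_simps)
  have "48 * \<omega> - 12 * a1\<^sup>2 - 12 * a1 + 9 = (2 * a1 + 3)\<^sup>2"
    using w by (simp add: power2_eq_square algebra_simps)
  then have b1: "wave_b (a1, \<omega>) = 2 * a1 + 3" unfolding wave_b_def using a1 by simp
  define d where "d = (2 * a1\<^sup>2 + 3 * a1) / 2"
  have d: "d > 0" using a1 by (simp add: d_def add_pos_pos)
  have D1: "wave_D (a1, \<omega>) = d" and S1: "wave_S (a1, \<omega>) = d"
    unfolding wave_D_def wave_S_def d_def fst_conv snd_conv b1 w
    by (simp_all add: power2_eq_square field_simps)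
  \<comment> \<open>Near the endpoint \<open>D < 2 d\<close>, so \<open>J\<close> is at least
    \<open>N / (2 sqrt (2 d))\<close>, which this choice puts above \<open>B\<close>;
    \<open>max 0 B\<close> keeps \<open>N\<close> nonnegative.\<close>
  define N where "N = max 0 B * (2 * sqrt (2 * d)) + 1"
  have N: "N \<ge> 0" using d by (simp add: N_def)
  define c where "c = (pi / 2 * exp (- N))\<^sup>2"
  have c: "c > 0" by (simp add: c_def)
  have "isCont (\<lambda>a. wave_D (a, \<omega>)) a1" "isCont (\<lambda>a. wave_S (a, \<omega>)) a1"
    unfolding wave_D_def wave_S_def wave_b_def fst_conv snd_conv by (intro continuous_intros; simp)+
  then have tD: "((\<lambda>a. wave_D (a, \<omega>)) \<longlongrightarrow> d) (at_left a1)"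
    and tS: "((\<lambda>a. wave_S (a, \<omega>)) \<longlongrightarrow> d) (at_left a1)"
    unfolding isCont_def D1 S1 by (auto intro: tendsto_mono[OF at_le])
  have "\<forall>\<^sub>F a in at_left a1. wave_D (a, \<omega>) < 2 * d"
    using order_tendstoD(2)[OF tD, of "2 * d"] d by simp
  moreover have "\<forall>\<^sub>F a in at_left a1. 0 < 2 * wave_D (a, \<omega>) * c - (wave_S (a, \<omega>) - wave_D (a, \<omega>))"
  proof -
    have "((\<lambda>a. 2 * wave_D (a, \<omega>) * c - (wave_S (a, \<omega>) - wave_D (a, \<omega>))) \<longlongrightarrow> 2 * d * c - (d - d)) (at_left a1)"
      by (intro tendsto_intros tD tS)
    from order_tendstoD(1)[OF this, of 0] show ?thesis using c d by simp
  qed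
  moreover have "\<forall>\<^sub>F a in at_left a1. a \<in> {a\<^sub>0<..<a1}"
    using a0 eventually_at_left_real unfolding a1_def by blast
  ultimately have "\<forall>\<^sub>F a in at_left a1. a \<in> {a\<^sub>0<..<a1} \<and> wave_D (a, \<omega>) < 2 * d \<and>
      wave_S (a, \<omega>) - wave_D (a, \<omega>) \<le> 2 * wave_D (a, \<omega>) * c"
    by eventually_elim auto
  then obtain a where a: "a\<^sub>0 < a" "a < a1" "wave_D (a, \<omega>) < 2 * d"
    "wave_S (a, \<omega>) - wave_D (a, \<omega>) \<le> 2 * wave_D (a, \<omega>) * c"
    using eventually_happens[of _ "at_left a1"] by (auto simp: trivial_limit_at_left_real)
  have "B < elliptic_J (wave_S (a, \<omega>), wave_D (a, \<omega>))" if dom: "(a, \<omega>) \<in> wave_dom"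
  proof -
    note SD = wave_SD_cone[OF dom]
    have "N / (2 * sqrt (wave_D (a, \<omega>))) \<le> elliptic_J (wave_S (a, \<omega>), wave_D (a, \<omega>))"
      using elliptic_J_ge[OF SD(2) _ N] SD(1) a(4) unfolding c_def by simp
    moreover have "N / (2 * sqrt (2 * d)) \<le> N / (2 * sqrt (wave_D (a, \<omega>)))"
      using SD(1) a(3) N by (intro divide_left_mono) auto
    moreover have "B < N / (2 * sqrt (2 * d))"
    proof -
      have "N / (2 * sqrt (2 * d)) = max 0 B + 1 / (2 * sqrt (2 * d))"
        unfolding N_def add_divide_distrib using d by simp
      moreover have "1 / (2 * sqrt (2 * d)) > 0" using d by simp
      ultimately show ?thesis by linarith
    qed
    ultimately show ?thesis by linarith
  qed
  then show ?thesis using a unfolding a1_def by blast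
qed

lemma omega_threshold_pos:
  assumes "L > 0" shows "omega_threshold L > 0"
proof -
  have "L < sqrt (L\<^sup>2 + 16 * pi\<^sup>2)" by (rule real_less_rsqrt) simp
  then have "1 / 8 < sqrt (L\<^sup>2 + 16 * pi\<^sup>2) / (8 * L)" using assms by (simp add: field_simps)
  moreover have "pi\<^sup>2 / L\<^sup>2 > 0" using assms by simp
  ultimately show ?thesis unfolding omega_threshold_def by linarith
qed

text \<open>Here \<open>D = 0\<close> and \<open>S = 3 a (2a + 1)\<close>, so \<open>J\<close> is
  the integral of a constant. The claim becomes \<open>2 pi^2 < L^2 a (2a + 1)\<close>, and this is
  what the threshold encodes.\<close>

lemma short_period_at_lower_end:
  assumes L: "L > 0" and \<omega>: "\<omega> > omega_threshold L" and a: "a > 0" "a + a\<^sup>2 = \<omega>"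
  shows "2 * sqrt 6 * elliptic_J (wave_S (a, \<omega>), wave_D (a, \<omega>)) < L"
    and "wave_D (a, \<omega>) = 0" and "wave_S (a, \<omega>) > 0"
proof -
  have "48 * \<omega> - 12 * a\<^sup>2 - 12 * a + 9 = (6 * a + 3)\<^sup>2"
    unfolding a(2)[symmetric] by (simp add: power2_eq_square algebra_simps)
  then have b: "wave_b (a, \<omega>) = 6 * a + 3" unfolding wave_b_def using a by simp
  show D: "wave_D (a, \<omega>) = 0"
    unfolding wave_D_def fst_conv snd_conv b unfolding a(2)[symmetric]
    by (simp add: power2_eq_square algebra_simps)
  have S: "wave_S (a, \<omega>) = 3 * (a * (2 * a + 1))"
    unfolding wave_S_def fst_conv snd_conv b unfolding a(2)[symmetric]
    by (simp add: power2_eq_square field_simps)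
  then show "wave_S (a, \<omega>) > 0" using a by simp
  define r where "r = sqrt (L\<^sup>2 + 16 * pi\<^sup>2) / L"
  \<comment> \<open>The positive root of \<open>2 c^2 + c = 2 pi^2 / L^2\<close>, with
    \<open>r\<close> the square root of the discriminant: the lower endpoint whose limiting period
    is exactly \<open>L\<close>. The threshold equals \<open>c + c^2\<close>.\<close>
  define c where "c = (r - 1) / 4"
  have r2: "r\<^sup>2 = 1 + 16 * (pi\<^sup>2 / L\<^sup>2)" unfolding r_def using L by (simp add: power_divide field_simps)
  have "L < sqrt (L\<^sup>2 + 16 * pi\<^sup>2)" by (rule real_less_rsqrt) simp
  then have c0: "c > 0" unfolding c_def r_def using L by simp
  have r: "r = 4 * c + 1" by (simp add: c_def field_simps)
  have c1: "c * (2 * c + 1) = 2 * (pi\<^sup>2 / L\<^sup>2)"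
  proof -
    have "(4 * c + 1)\<^sup>2 = 1 + 8 * (c * (2 * c + 1))" by (simp add: power2_eq_square algebra_simps)
    then show ?thesis using r2 unfolding r by linarith
  qed
  have "omega_threshold L = r / 8 + pi\<^sup>2 / L\<^sup>2 - 1 / 8"
    unfolding omega_threshold_def r_def by simp
  also have "\<dots> = c + c\<^sup>2" 
  proof -
    have "c * (2 * c + 1) = 2 * c\<^sup>2 + c" by (simp add: power2_eq_square algebra_simps)
    then show ?thesis using c1 r by linarith
  qed
  finally have "c * (1 + c) < a * (1 + a)"
    using \<omega> a(2) by (simp add: power2_eq_square algebra_simps)
  then have "c < a" using mult_mono[of a c "1 + a" "1 + c"] a c0 by (cases "c < a") auto
  then have "c * (2 * c + 1) < a * (2 * a + 1)" using c0 by (intro mult_strict_mono) auto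
  then have "2 * pi\<^sup>2 < L\<^sup>2 * (a * (2 * a + 1))"
    unfolding c1 using L by (simp add: field_simps)
  then have "(sqrt 6 * pi)\<^sup>2 < (L * sqrt (wave_S (a, \<omega>)))\<^sup>2"
  proof -
    have "(sqrt 6 * pi)\<^sup>2 = 6 * pi\<^sup>2" by (simp add: power_mult_distrib)
    moreover have "(L * sqrt (wave_S (a, \<omega>)))\<^sup>2 = L\<^sup>2 * wave_S (a, \<omega>)"
      using \<open>wave_S (a, \<omega>) > 0\<close> by (simp add: power_mult_distrib)
    moreover have "L\<^sup>2 * wave_S (a, \<omega>) = 3 * (L\<^sup>2 * (a * (2 * a + 1)))" unfolding S by simp
    ultimately show ?thesis using \<open>2 * pi\<^sup>2 < L\<^sup>2 * (a * (2 * a + 1))\<close> by linarith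
  qed
  then have "sqrt 6 * pi < L * sqrt (wave_S (a, \<omega>))"
    by (rule power2_less_imp_less) (use L S a in simp)
  moreover have "elliptic_J (wave_S (a, \<omega>), wave_D (a, \<omega>)) = pi / 2 / sqrt (wave_S (a, \<omega>))"
    unfolding elliptic_J_def D by simp
  then have "2 * sqrt 6 * elliptic_J (wave_S (a, \<omega>), wave_D (a, \<omega>)) = sqrt 6 * pi / sqrt (wave_S (a, \<omega>))"
    by simp
  ultimately show "2 * sqrt 6 * elliptic_J (wave_S (a, \<omega>), wave_D (a, \<omega>)) < L"
    using \<open>wave_S (a, \<omega>) > 0\<close> by (simp add: pos_divide_less_eq)
qed

text \<open>Existence is the intermediate value theorem from the closed lower end \<open>a0\<close>,
  where \<open>J\<close> is still continuous; the strict inequality there keeps the solution inside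
  the open range. Uniqueness is monotonicity of the period.\<close>

lemma ex1_alpha3:
  assumes L: "L > 0" and \<omega>: "\<omega> > omega_threshold L"
  shows "\<exists>!a. a \<in> alpha3_range \<omega> \<and> dn_T a \<omega> = L"
proof (rule ex_ex1I)
  have w0: "\<omega> > 0" using omega_threshold_pos[OF L] \<omega> by linarith
  show "a = a'" if "a \<in> alpha3_range \<omega> \<and> dn_T a \<omega> = L" "a' \<in> alpha3_range \<omega> \<and> dn_T a' \<omega> = L" for a a'
    using dn_T_strict_mono[OF w0] that by (metis less_irrefl linorder_neqE_linordered_idom)
  define a0 where "a0 = (sqrt (1 + 4 * \<omega>) - 1) / 2"
  have "1 < sqrt (1 + 4 * \<omega>)" using w0 by simp
  then have a0: "a0 > 0" by (simp add: a0_def)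
  have "2 * a0 + 1 = sqrt (1 + 4 * \<omega>)" by (simp add: a0_def field_simps)
  then have "(2 * a0 + 1)\<^sup>2 = 1 + 4 * \<omega>" using w0 by simp
  then have wa: "a0 + a0\<^sup>2 = \<omega>" by (simp add: power2_eq_square algebra_simps)
  have "2 * a0\<^sup>2 + 3 * a0 < 6 * \<omega>" using a0 unfolding wa[symmetric] by (simp add: add_pos_pos)
  then have up: "a0 < (sqrt (48 * \<omega> + 9) - 3) / 4" using alpha3_upper_iff[OF a0] by blast
  note low = short_period_at_lower_end[OF L \<omega> a0 wa]
  obtain a1 where a1: "a0 < a1" "a1 < (sqrt (48 * \<omega> + 9) - 3) / 4"
    "(a1, \<omega>) \<in> wave_dom \<longrightarrow> L / (2 * sqrt 6) < elliptic_J (wave_S (a1, \<omega>), wave_D (a1, \<omega>))"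
    using ex_long_period[OF w0 up] by blast
  have range: "x \<in> alpha3_range \<omega>" if "a0 < x" "x \<le> a1" for x
    using that a1 by (simp add: alpha3_range_def a0_def)
  have dom: "(x, \<omega>) \<in> wave_dom" if "a0 < x" "x \<le> a1" for x
    using range[OF that] alpha3_range_iff[OF w0] by blast
  let ?f = "\<lambda>x. elliptic_J (wave_S (x, \<omega>), wave_D (x, \<omega>))"
  have "continuous_on {a0..a1} ?f"
  proof (rule continuous_on_compose2[OF smooth_on_continuous_on[OF smooth_on_elliptic_J]])
    show "continuous_on {a0..a1} (\<lambda>x. (wave_S (x, \<omega>), wave_D (x, \<omega>)))"
      unfolding wave_S_def wave_D_def wave_b_def fst_conv snd_conv by (intro continuous_intros) auto
    show "(\<lambda>x. (wave_S (x, \<omega>), wave_D (x, \<omega>))) ` {a0..a1} \<subseteq> period_cone"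
    proof clarify
      fix x assume x: "x \<in> {a0..a1}"
      show "(wave_S (x, \<omega>), wave_D (x, \<omega>)) \<in> period_cone"
      proof (cases "x = a0")
        case True
        then show ?thesis using low(2,3) by (simp add: period_cone_def)
      next
        case False
        then show ?thesis using wave_SD_cone(2) dom x by simp
      qed
    qed
  qed
  moreover have "?f a0 \<le> L / (2 * sqrt 6)" using low(1) by (simp add: field_simps)
  moreover have "L / (2 * sqrt 6) \<le> ?f a1" using a1 dom by simp
  ultimately obtain x where x: "a0 \<le> x" "x \<le> a1" "?f x = L / (2 * sqrt 6)"
    using IVT'[of ?f a0 "L / (2 * sqrt 6)" a1] a1(1) by auto
  have "x \<noteq> a0" using low(1) x(3) by (auto simp: field_simps)
  then have "a0 < x" using x(1) by simp
  then have "x \<in> alpha3_range \<omega>" "dn_T x \<omega> = L"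
    using range dn_T_eq(2)[OF dom] x by simp_all
  then show "\<exists>a. a \<in> alpha3_range \<omega> \<and> dn_T a \<omega> = L" by blast
qed

definition period_alpha3 :: "real \<Rightarrow> real \<Rightarrow> real" where
  "period_alpha3 L \<omega> = (THE a. a \<in> alpha3_range \<omega> \<and> dn_T a \<omega> = L)"

lemma period_alpha3:
  assumes "L > 0" "\<omega> > omega_threshold L"
  shows "period_alpha3 L \<omega> \<in> alpha3_range \<omega>" "dn_T (period_alpha3 L \<omega>) \<omega> = L"
    "(period_alpha3 L \<omega>, \<omega>) \<in> wave_dom"
proof -
  show *: "period_alpha3 L \<omega> \<in> alpha3_range \<omega>" "dn_T (period_alpha3 L \<omega>) \<omega> = L"
    using theI'[OF ex1_alpha3[OF assms]] unfolding period_alpha3_def by auto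
  then show "(period_alpha3 L \<omega>, \<omega>) \<in> wave_dom"
    using alpha3_range_iff omega_threshold_pos[OF assms(1)] assms(2) by force
qed

text \<open>Uniqueness within the range supplies the global uniqueness premise of the implicit
  function theorem, and the positive \<open>a\<close>-derivative its nondegeneracy.\<close>

lemma smooth_on_period_alpha3:
  assumes L: "L > 0" shows "smooth_on {omega_threshold L<..} (period_alpha3 L)"
proof (rule smooth_on_implicit[OF _ open_wave_dom, where F =
      "\<lambda>p. 2 * sqrt 6 * elliptic_J (wave_S p, wave_D p) - L"])
  let ?F = "\<lambda>p. 2 * sqrt 6 * elliptic_J (wave_S p, wave_D p) - L"
  show sm: "smooth_on wave_dom ?F" by (intro smooth_intros smooth_on_wave_period)
  fix \<omega> assume "\<omega> \<in> {omega_threshold L<..}"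
  then have \<omega>: "\<omega> > omega_threshold L" by simp
  note a = period_alpha3[OF L \<omega>]
  have w0: "\<omega> > 0" using omega_threshold_pos[OF L] \<omega> by linarith
  show "(period_alpha3 L \<omega>, \<omega>) \<in> wave_dom" by (rule a)
  show "?F (period_alpha3 L \<omega>, \<omega>) = 0" using a(2) dn_T_eq(2)[OF a(3)] by simp
  show "t = period_alpha3 L \<omega>" if t: "(t, \<omega>) \<in> wave_dom" "?F (t, \<omega>) = 0" for t
    using ex1_alpha3[OF L \<omega>] a t dn_T_eq(2)[OF t(1)] alpha3_range_iff[OF w0, of t] by auto
  obtain d where d: "d > 0"
    "((\<lambda>a. elliptic_J (wave_S (a, \<omega>), wave_D (a, \<omega>))) has_real_derivative d) (at (period_alpha3 L \<omega>))"
    using wave_period_partial_pos[OF a(3)] by blast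
  have "((\<lambda>a. ?F (a, \<omega>)) has_real_derivative 2 * sqrt 6 * d - 0) (at (period_alpha3 L \<omega>))"
    by (intro DERIV_diff DERIV_cmult d(2) DERIV_const)
  then have "D1 ?F (period_alpha3 L \<omega>, \<omega>) = 2 * sqrt 6 * d - 0"
    using smooth_on_partial1[OF sm a(3)] DERIV_unique by blast
  then show "D1 ?F (period_alpha3 L \<omega>, \<omega>) \<noteq> 0" using d(1) by simp
qed auto

section \<open>The dnoidal wave\<close>

text \<open>After the common factor \<open>sqrt a * R / W^5\<close> is removed, the equation is an
  identity between quadratic polynomials in \<open>z\<close>, the square of \<open>sn\<close>;
  \<open>e0\<close>, \<open>e1\<close> and \<open>e2\<close> compare the coefficients of
  \<open>1\<close>, \<open>z\<close> and \<open>z^2\<close>.\<close>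

lemma rational_wave_solves_profile_ode:
  fixes a c m \<beta> \<omega> :: real
  assumes m: "0 < m" "m < 1" and \<beta>: "\<beta> \<ge> 0" and a: "a > 0"
    and e0: "- (c\<^sup>2 * (m + \<beta>)) = \<omega> - a - a\<^sup>2"
    and e1: "c\<^sup>2 * (m + \<beta>) * (2 + 2 * \<beta>) = 2 * \<omega> * \<beta> - a * (\<beta> - m) + 2 * a\<^sup>2 * m"
    and e2: "- (c\<^sup>2 * (m + \<beta>) * \<beta>) = \<omega> * \<beta>\<^sup>2 + a * m * \<beta> - a\<^sup>2 * m\<^sup>2"
  shows "solves_profile_ode \<omega> (\<lambda>x. sqrt a * sqrt (1 - m * (sin (jacobi_am (c * x) (sqrt m)))\<^sup>2)
    / sqrt (1 + \<beta> * (sin (jacobi_am (c * x) (sqrt m)))\<^sup>2))"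
proof -
  define \<theta> where "\<theta> = (\<lambda>x. jacobi_am (c * x) (sqrt m))"
  define S where "S = (\<lambda>x. sin (\<theta> x))"
  define C where "C = (\<lambda>x. cos (\<theta> x))"
  define R where "R = (\<lambda>x. sqrt (1 - m * (S x)\<^sup>2))"
  define W where "W = (\<lambda>x. sqrt (1 + \<beta> * (S x)\<^sup>2))"
  define \<phi> where "\<phi> = (\<lambda>x. sqrt a * R x / W x)"
  define \<phi>' where "\<phi>' = (\<lambda>x. - (sqrt a * c * (m + \<beta>)) * (S x * C x) / (W x) ^ 3)"
  define \<phi>'' where "\<phi>'' = (\<lambda>x. - (sqrt a * c * (m + \<beta>)) *
      (R x * c * (((C x)\<^sup>2 - (S x)\<^sup>2) * (W x)\<^sup>2 - 3 * \<beta> * (S x)\<^sup>2 * (C x)\<^sup>2)) / (W x) ^ 5)"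
  have Npos: "0 < 1 - m * (S x)\<^sup>2" for x
    using elliptic_integrand_pos[of "sqrt m" "\<theta> x"] m by (simp add: S_def)
  have Qpos: "0 < 1 + \<beta> * (S x)\<^sup>2" for x using \<beta> by (simp add: add_pos_nonneg)
  have R: "R x > 0" "(R x)\<^sup>2 = 1 - m * (S x)\<^sup>2" for x using Npos[of x] by (simp_all add: R_def)
  have W: "W x > 0" "(W x)\<^sup>2 = 1 + \<beta> * (S x)\<^sup>2" for x using Qpos[of x] by (simp_all add: W_def)
  have C2: "(C x)\<^sup>2 = 1 - (S x)\<^sup>2" for x by (simp add: C_def S_def cos_squared_eq)
  have "(\<theta> has_real_derivative sqrt (1 - (sqrt m)\<^sup>2 * (sin (\<theta> x))\<^sup>2) * (c * 1)) (at x)" for x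
    unfolding \<theta>_def
    by (intro DERIV_chain2[OF jacobi_am_deriv] DERIV_cmult DERIV_ident) (use m in auto)
  then have d\<theta>: "(\<theta> has_real_derivative R x * c) (at x)" for x
    using m by (simp add: R_def S_def)
  have dS: "(S has_real_derivative C x * (R x * c)) (at x)" for x
    unfolding S_def C_def by (intro DERIV_chain2[OF DERIV_sin] d\<theta>)
  have dC: "(C has_real_derivative - S x * (R x * c)) (at x)" for x
    unfolding S_def C_def by (intro DERIV_chain2[OF DERIV_cos] d\<theta>)
  have dS2: "((\<lambda>x. (S x)\<^sup>2) has_real_derivative 2 * S x * (C x * (R x * c))) (at x)" for x
    using DERIV_power[OF dS, of 2] by (simp add: mult_ac)
  have dR: "(R has_real_derivative - (m * S x * C x * c)) (at x)" for x
  proof -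
    have "((\<lambda>x. 1 - m * (S x)\<^sup>2) has_real_derivative (0 - m * (2 * S x * (C x * (R x * c))))) (at x)"
      by (intro DERIV_diff DERIV_const DERIV_cmult dS2)
    from DERIV_chain2[OF DERIV_real_sqrt[OF Npos] this]
    have "(R has_real_derivative inverse (R x) / 2 * (0 - m * (2 * S x * (C x * (R x * c))))) (at x)"
      unfolding R_def .
    moreover have "inverse (R x) / 2 * (0 - m * (2 * S x * (C x * (R x * c)))) = - (m * S x * C x * c)"
      using R(1)[of x] by (simp add: field_simps)
    ultimately show ?thesis by (rule DERIV_cong)
  qed
  have dW: "(W has_real_derivative \<beta> * S x * C x * R x * c / W x) (at x)" for x
  proof -
    have "((\<lambda>x. 1 + \<beta> * (S x)\<^sup>2) has_real_derivative (0 + \<beta> * (2 * S x * (C x * (R x * c))))) (at x)"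
      by (intro DERIV_add DERIV_const DERIV_cmult dS2)
    from DERIV_chain2[OF DERIV_real_sqrt[OF Qpos] this]
    have "(W has_real_derivative inverse (W x) / 2 * (0 + \<beta> * (2 * S x * (C x * (R x * c))))) (at x)"
      unfolding W_def .
    moreover have "inverse (W x) / 2 * (0 + \<beta> * (2 * S x * (C x * (R x * c)))) = \<beta> * S x * C x * R x * c / W x"
      by (simp add: field_simps)
    ultimately show ?thesis by (rule DERIV_cong)
  qed
  have d\<phi>: "(\<phi> has_real_derivative \<phi>' x) (at x)" for x
  proof -
    have W0: "W x \<noteq> 0" using W(1)[of x] by simp
    have "(\<phi> has_real_derivative (sqrt a * - (m * S x * C x * c) * W x
        - sqrt a * R x * (\<beta> * S x * C x * R x * c / W x)) / (W x * W x)) (at x)"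
      unfolding \<phi>_def by (intro DERIV_divide DERIV_cmult dR dW W0)
    moreover have "(sqrt a * - (m * S x * C x * c) * W x
        - sqrt a * R x * (\<beta> * S x * C x * R x * c / W x)) / (W x * W x)
      = - (sqrt a * c * (S x * C x)) * (m * (W x)\<^sup>2 + \<beta> * (R x)\<^sup>2) / (W x) ^ 3"
      using W0 by (simp add: field_simps power2_eq_square power3_eq_cube)
    \<comment> \<open>The dependence on \<open>x\<close> cancels here, which is why
      \<open>\<phi>'\<close> has only \<open>S x * C x\<close> in its numerator.\<close>
    moreover have "m * (W x)\<^sup>2 + \<beta> * (R x)\<^sup>2 = m + \<beta>"
      unfolding R(2) W(2) by (simp add: algebra_simps)
    ultimately show ?thesis by (simp add: \<phi>'_def mult_ac)
  qed
  have d\<phi>': "(\<phi>' has_real_derivative \<phi>'' x) (at x)" for x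
  proof -
    have W0: "W x \<noteq> 0" using W(1)[of x] by simp
    let ?K = "- (sqrt a * c * (m + \<beta>))"
    have "(\<phi>' has_real_derivative
       ((?K * (C x * (R x * c) * C x + - S x * (R x * c) * S x)) * W x ^ 3
        - ?K * (S x * C x) * (of_nat 3 * (\<beta> * S x * C x * R x * c / W x * W x ^ (3 - Suc 0)))) / (W x ^ 3 * W x ^ 3)) (at x)"
      unfolding \<phi>'_def
      by (intro DERIV_divide DERIV_cmult DERIV_mult DERIV_power dS dC dW) (use W0 in simp)
    moreover have "((?K * (C x * (R x * c) * C x + - S x * (R x * c) * S x)) * W x ^ 3
        - ?K * (S x * C x) * (of_nat 3 * (\<beta> * S x * C x * R x * c / W x * W x ^ (3 - Suc 0)))) / (W x ^ 3 * W x ^ 3) = \<phi>'' x"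
    proof -
      have "(K * (C' * (r * c) * C' + - s * (r * c) * s) * w ^ 3
        - K * (s * C') * (of_nat 3 * (\<beta> * s * C' * r * c / w * w ^ (3 - Suc 0)))) / (w ^ 3 * w ^ 3)
        = K * (r * c * ((C'\<^sup>2 - s\<^sup>2) * w\<^sup>2 - 3 * \<beta> * s\<^sup>2 * C'\<^sup>2)) / w ^ 5"
        if "w \<noteq> 0" for K C' r s w :: real
        using that by (simp add: divide_simps) (simp add: power_numeral_reduce algebra_simps)
      from this[OF W0] show ?thesis unfolding \<phi>''_def by blast
    qed
    ultimately show ?thesis by (rule DERIV_cong)
  qed
  have ode: "- \<phi>'' x + \<omega> * \<phi> x - \<phi> x ^ 3 - \<phi> x ^ 5 = 0" for x
  proof -
    have W0: "W x \<noteq> 0" using W(1)[of x] by simp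
    define z where "z = (S x)\<^sup>2"
    have p3: "\<phi> x ^ 3 = sqrt a * R x * (a * (R x)\<^sup>2 * (W x)\<^sup>2) / W x ^ 5"
    proof -
      have "\<phi> x ^ 3 = sqrt a ^ 3 * R x ^ 3 / W x ^ 3" by (simp add: \<phi>_def power_divide power_mult_distrib)
      moreover have "sqrt a ^ 3 = sqrt a * a" using a by (simp add: power3_eq_cube)
      ultimately show ?thesis using W0 by (simp add: divide_simps) (simp add: power_numeral_reduce algebra_simps)
    qed
    have p5: "\<phi> x ^ 5 = sqrt a * R x * (a\<^sup>2 * ((R x)\<^sup>2)\<^sup>2) / W x ^ 5"
    proof -
      have "\<phi> x ^ 5 = sqrt a ^ 5 * R x ^ 5 / W x ^ 5" by (simp add: \<phi>_def power_divide power_mult_distrib)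
      moreover have "sqrt a ^ 5 = sqrt a * a\<^sup>2"
      proof -
        have "x ^ 5 = x * (x\<^sup>2)\<^sup>2" for x :: real by (simp add: power_numeral_reduce)
        from this[of "sqrt a"] show ?thesis using a by simp
      qed
      ultimately show ?thesis by (simp add: power_numeral_reduce algebra_simps)
    qed
    have p1: "\<omega> * \<phi> x = sqrt a * R x * (\<omega> * ((W x)\<^sup>2)\<^sup>2) / W x ^ 5"
      using W0 by (simp add: \<phi>_def divide_simps) (simp add: power_numeral_reduce algebra_simps)
    have p2: "\<phi>'' x = sqrt a * R x * (- (c\<^sup>2 * (m + \<beta>)) *
        (((C x)\<^sup>2 - (S x)\<^sup>2) * (W x)\<^sup>2 - 3 * \<beta> * (S x)\<^sup>2 * (C x)\<^sup>2)) / W x ^ 5"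
      by (simp add: \<phi>''_def power2_eq_square algebra_simps)
    let ?e = "c\<^sup>2 * (m + \<beta>)"
    have "- ?e * ((1 - z - z) * (1 + \<beta> * z) - 3 * \<beta> * z * (1 - z))
        = - ?e + ?e * (2 + 2 * \<beta>) * z + - (?e * \<beta>) * z\<^sup>2"
      by (simp add: power2_eq_square algebra_simps)
    also have "\<dots> = (\<omega> - a - a\<^sup>2) + (2 * \<omega> * \<beta> - a * (\<beta> - m) + 2 * a\<^sup>2 * m) * z
        + (\<omega> * \<beta>\<^sup>2 + a * m * \<beta> - a\<^sup>2 * m\<^sup>2) * z\<^sup>2"
      unfolding e0 e1 e2 ..
    also have "\<dots> = \<omega> * (1 + \<beta> * z)\<^sup>2 - a * (1 - m * z) * (1 + \<beta> * z) - a\<^sup>2 * (1 - m * z)\<^sup>2"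
      by (simp add: power2_eq_square algebra_simps)
    finally have "\<phi>'' x = sqrt a * R x * (\<omega> * ((W x)\<^sup>2)\<^sup>2 - a * (R x)\<^sup>2 * (W x)\<^sup>2 - a\<^sup>2 * ((R x)\<^sup>2)\<^sup>2) / W x ^ 5"
      unfolding p2 C2 R(2) W(2) z_def by metis
    then show ?thesis unfolding p1 p3 p5 by (simp add: right_diff_distrib diff_divide_distrib)
  qed
  have "deriv \<phi> = \<phi>'" using DERIV_imp_deriv[OF d\<phi>] by blast
  moreover have "deriv \<phi>' = \<phi>''" using DERIV_imp_deriv[OF d\<phi>'] by blast
  moreover have "\<phi> differentiable (at x)" "\<phi>' differentiable (at x)" for x
    using d\<phi> d\<phi>' real_differentiable_def by blast+
  ultimately have "solves_profile_ode \<omega> \<phi>" unfolding solves_profile_ode_def using ode by simp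
  then show ?thesis unfolding \<phi>_def R_def W_def S_def \<theta>_def .
qed

section \<open>The wave with coefficients rational in \<open>a\<close> and \<open>b\<close>, up to
  square roots\<close>

definition wave_m :: "real \<times> real \<Rightarrow> real" where
  "wave_m p = 2 * wave_D p / (fst p * wave_b p)"

text \<open>This is \<open>(\<alpha>3 - \<alpha>2) / (\<alpha>2 - \<alpha>1)\<close>, the form of
  \<open>dn_betasq\<close> after the factor \<open>\<alpha>1\<close> of the squared modulus
  cancels.\<close>

definition wave_beta :: "real \<times> real \<Rightarrow> real" where
  "wave_beta p = (6 * fst p + 3 - wave_b p) / (2 * wave_b p)"

definition wave_c :: "real \<times> real \<Rightarrow> real" where
  "wave_c p = sqrt (fst p * wave_b p / 6)"

definition wave_profile :: "real \<times> real \<Rightarrow> real \<Rightarrow> real" where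
  "wave_profile p x = sqrt (fst p) * sqrt (1 - wave_m p * (sin (jacobi_am (wave_c p * x) (sqrt (wave_m p))))\<^sup>2)
    / sqrt (1 + wave_beta p * (sin (jacobi_am (wave_c p * x) (sqrt (wave_m p))))\<^sup>2)"

lemma wave_m_eq: "(a, \<omega>) \<in> wave_dom \<Longrightarrow> wave_m (a, \<omega>) = dn_ksq a \<omega>"
  by (simp add: wave_m_def dn_ksq_eq)

lemma wave_m_factored:
  assumes "p \<in> wave_dom"
  shows "wave_m p = (wave_b p + 2 * fst p + 3) * (6 * fst p + 3 - wave_b p) / (8 * (fst p * wave_b p))"
  unfolding wave_SD_identities(1)[OF assms, symmetric] wave_m_def by simp

lemma wave_m_bounds: "p \<in> wave_dom \<Longrightarrow> 0 < wave_m p \<and> wave_m p < 1"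
  using dn_ksq_bounds wave_m_eq by (cases p) metis

lemma wave_beta_pos: "p \<in> wave_dom \<Longrightarrow> 0 < wave_beta p"
  unfolding wave_beta_def using wave_b_bounds[of p] wave_dom_pos[of p]
  by (intro divide_pos_pos) auto

lemma wave_c_pos: "p \<in> wave_dom \<Longrightarrow> 0 < wave_c p"
  unfolding wave_c_def using wave_ab_pos[of p] by simp

lemma dnoidal_wave_eq:
  assumes "(a, \<omega>) \<in> wave_dom"
  shows "dnoidal_wave \<omega> a = wave_profile (a, \<omega>)"
proof -
  let ?b = "wave_b (a, \<omega>)"
  have a: "a > 0" using wave_dom_pos[OF assms] by simp
  have b: "?b > 0" using wave_b_bounds(2)[OF assms] a by simp
  have "dn_alpha2 a \<omega> - dn_alpha1 a \<omega> = ?b / 2"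
    unfolding dn_alpha1_def dn_alpha2_def dn_q_eq_wave_b by (simp add: field_simps)
  then have "2 / (sqrt 3 * dn_g a \<omega>) = sqrt (a * (?b / 2)) / sqrt 3" by (simp add: dn_g_def)
  also have "\<dots> = wave_c (a, \<omega>)" by (simp add: wave_c_def flip: real_sqrt_divide)
  finally have c: "2 / (sqrt 3 * dn_g a \<omega>) = wave_c (a, \<omega>)" .
  have "dn_betasq a \<omega> = 4 * a * dn_ksq a \<omega> / (?b + 2 * a + 3)"
    unfolding dn_betasq_def dn_alpha1_def dn_q_eq_wave_b using a b by (simp add: field_simps)
  moreover have "dn_ksq a \<omega> = (?b + 2 * a + 3) * (6 * a + 3 - ?b) / (8 * (a * ?b))"
    using wave_m_factored[OF assms] wave_m_eq[OF assms] by simp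
  ultimately have \<beta>: "dn_betasq a \<omega> = wave_beta (a, \<omega>)"
    using a b by (simp add: wave_beta_def divide_simps)
  have k: "dn_k a \<omega> = sqrt (wave_m (a, \<omega>))" unfolding dn_k_def wave_m_eq[OF assms] ..
  have "(sqrt (wave_m (a, \<omega>)))\<^sup>2 = wave_m (a, \<omega>)" using wave_m_bounds[OF assms] by simp
  then show ?thesis
    by (simp add: fun_eq_iff dnoidal_wave_def wave_profile_def jacobi_dn_def jacobi_sn_def c \<beta> k)
qed

lemma wave_profile_ode:
  assumes "(a, \<omega>) \<in> wave_dom"
  shows "solves_profile_ode \<omega> (wave_profile (a, \<omega>))"
proof -
  define b where "b = wave_b (a, \<omega>)"
  have a: "a > 0" using wave_dom_pos[OF assms] by simp
  have b: "b > 0" using wave_b_bounds(2)[OF assms] a by (simp add: b_def)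
  have m: "wave_m (a, \<omega>) = (b + 2 * a + 3) * (6 * a + 3 - b) / (8 * (a * b))"
    using wave_m_factored[OF assms] unfolding b_def by simp
  have \<beta>: "wave_beta (a, \<omega>) = (6 * a + 3 - b) / (2 * b)" by (simp add: wave_beta_def b_def)
  have c: "(wave_c (a, \<omega>))\<^sup>2 = a * b / 6"
    using wave_ab_pos[OF assms] by (simp add: wave_c_def b_def)
  have "b\<^sup>2 = 48 * \<omega> - 12 * a\<^sup>2 - 12 * a + 9" using wave_b_bounds(1)[OF assms] by (simp add: b_def)
  \<comment> \<open>Eliminating \<open>\<omega>\<close> in favour of \<open>b\<close> turns the
    three coefficient conditions into rational identities in the two quantities \<open>a\<close> and
    \<open>b\<close>.\<close>
  then have \<omega>: "\<omega> = (b\<^sup>2 + 12 * a\<^sup>2 + 12 * a - 9) / 48" by simp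
  define m' where "m' = wave_m (a, \<omega>)"
  define \<beta>' where "\<beta>' = wave_beta (a, \<omega>)"
  define c' where "c' = wave_c (a, \<omega>)"
  have sum: "c'\<^sup>2 * (m' + \<beta>') = (6 * a + 3 - b) * (b + 6 * a + 3) / 48"
    unfolding m'_def \<beta>'_def c'_def c m \<beta> using a b by (simp add: divide_simps) (simp add: algebra_simps)
  have "- (c'\<^sup>2 * (m' + \<beta>')) = \<omega> - a - a\<^sup>2"
    unfolding sum by (subst \<omega>) (simp add: power2_eq_square field_simps)
  moreover have "c'\<^sup>2 * (m' + \<beta>') * (2 + 2 * \<beta>') = 2 * \<omega> * \<beta>' - a * (\<beta>' - m') + 2 * a\<^sup>2 * m'"
    unfolding sum by (subst \<omega>) (use a b in \<open>simp add: m'_def \<beta>'_def m \<beta> power2_eq_square divide_simps\<close>,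
        simp add: algebra_simps)
  moreover have "- (c'\<^sup>2 * (m' + \<beta>') * \<beta>') = \<omega> * \<beta>'\<^sup>2 + a * m' * \<beta>' - a\<^sup>2 * m'\<^sup>2"
    unfolding sum by (subst \<omega>) (use a b in \<open>simp add: m'_def \<beta>'_def m \<beta> power2_eq_square divide_simps\<close>,
        simp add: algebra_simps)
  ultimately have "solves_profile_ode \<omega> (\<lambda>x. sqrt a * sqrt (1 - m' * (sin (jacobi_am (c' * x) (sqrt m')))\<^sup>2)
    / sqrt (1 + \<beta>' * (sin (jacobi_am (c' * x) (sqrt m')))\<^sup>2))"
    using wave_m_bounds[OF assms] wave_beta_pos[OF assms] a
    by (intro rational_wave_solves_profile_ode) (auto simp: m'_def \<beta>'_def)
  then show ?thesis unfolding m'_def \<beta>'_def c'_def wave_profile_def[abs_def] by simp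
qed

text \<open>Over one period the amplitude advances by \<open>pi\<close>, and the wave depends only
  on the squared sine. No shorter period exists, because the wave equals \<open>sqrt a\<close> only
  where the sine vanishes.\<close>

lemma wave_profile_periodic:
  assumes "(a, \<omega>) \<in> wave_dom"
  shows "fundamental_period (wave_profile (a, \<omega>)) (dn_T a \<omega>)"
proof -
  define m where "m = wave_m (a, \<omega>)"
  define \<beta> where "\<beta> = wave_beta (a, \<omega>)"
  define c where "c = wave_c (a, \<omega>)"
  define T where "T = dn_T a \<omega>"
  let ?K = "elliptic_K (sqrt m)"
  have m: "0 < m" "m < 1" using wave_m_bounds[OF assms] by (auto simp: m_def)
  have k: "(sqrt m)\<^sup>2 < 1" using m by simp
  have \<beta>: "\<beta> > 0" unfolding \<beta>_def by (rule wave_beta_pos[OF assms])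
  have c: "c > 0" unfolding c_def by (rule wave_c_pos[OF assms])
  have a: "a > 0" using wave_dom_pos[OF assms] by simp
  have "dn_T a \<omega> = 2 * sqrt 6 * ?K / sqrt (a * wave_b (a, \<omega>))"
    unfolding dn_T_eq(1)[OF assms] m_def wave_m_eq[OF assms] dn_k_def ..
  also have "sqrt (a * wave_b (a, \<omega>)) = sqrt 6 * c"
    unfolding c_def wave_c_def by (simp flip: real_sqrt_mult)
  finally have "T = 2 * ?K / c" unfolding T_def by simp
  then have cT: "c * T = 2 * ?K" using c by simp
  have K: "?K > 0" using elliptic_F_ge[OF k, of "pi / 2"] pi_gt_zero unfolding elliptic_K_eq_F by linarith
  have T: "T > 0" using \<open>T = 2 * ?K / c\<close> K c by simp
  let ?\<theta> = "\<lambda>x. jacobi_am (c * x) (sqrt m)"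
  have \<phi>: "wave_profile (a, \<omega>) x = sqrt a * sqrt (1 - m * (sin (?\<theta> x))\<^sup>2) / sqrt (1 + \<beta> * (sin (?\<theta> x))\<^sup>2)" for x
    by (simp add: wave_profile_def m_def \<beta>_def c_def)
  have shift: "?\<theta> (x + T) = ?\<theta> x + pi" for x
    using jacobi_am_add_period[OF k, of "c * x"] cT by (simp add: distrib_left)
  have "wave_profile (a, \<omega>) (x + T) = wave_profile (a, \<omega>) x" for x
    unfolding \<phi> shift by simp
  moreover have "\<not> (\<forall>x. wave_profile (a, \<omega>) (x + p) = wave_profile (a, \<omega>) x)" if p: "0 < p" "p < T" for p
  proof
    assume "\<forall>x. wave_profile (a, \<omega>) (x + p) = wave_profile (a, \<omega>) x"
    \<comment> \<open>A shorter period is tested at \<open>x = 0\<close>: the value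
      \<open>sqrt a\<close> would recur at \<open>p\<close>, although the amplitude there lies
      strictly between \<open>0\<close> and \<open>pi\<close>.\<close>
    then have "wave_profile (a, \<omega>) p = wave_profile (a, \<omega>) 0" by (metis add_0)
    moreover have \<theta>0: "?\<theta> 0 = 0" using jacobi_am_0[OF k] by simp
    ultimately have eq: "sqrt a * sqrt (1 - m * (sin (?\<theta> p))\<^sup>2) / sqrt (1 + \<beta> * (sin (?\<theta> p))\<^sup>2) = sqrt a"
      unfolding \<phi> by simp
    define z where "z = (sin (?\<theta> p))\<^sup>2"
    have "0 < ?\<theta> p" using jacobi_am_strict_mono[OF k, of "c * 0" "c * p"] p c \<theta>0 by simp
    moreover have "?\<theta> p < pi"
      using jacobi_am_strict_mono[OF k, of "c * p" "c * T"] p c shift[of 0] \<theta>0 by simp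
    ultimately have "sin (?\<theta> p) > 0" by (rule sin_gt_zero)
    then have z: "z > 0" by (simp add: z_def)
    have "1 + \<beta> * z > 0" using \<beta> z by (simp add: add_pos_pos)
    then have "sqrt (1 - m * z) = sqrt (1 + \<beta> * z)"
      using eq a unfolding z_def[symmetric] by (simp add: divide_simps)
    then have "(m + \<beta>) * z = 0" by (simp add: algebra_simps)
    then show False using m \<beta> z by simp
  qed
  ultimately show ?thesis unfolding fundamental_period_def T_def[symmetric] using T by blast
qed

lemma smooth_on_wave_profile:
  assumes A: "smooth_on I A" and dom: "\<And>\<omega>. \<omega> \<in> I \<Longrightarrow> (A \<omega>, \<omega>) \<in> wave_dom"
  shows "smooth_on (I \<times> UNIV) (\<lambda>q. wave_profile (A (fst q), fst q) (snd q))"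
proof -
  let ?U = "I \<times> (UNIV :: real set)"
  have p: "smooth_on ?U (\<lambda>q. (A (fst q), fst q))"
    by (intro smooth_intros smooth_on_compose[OF A]) auto
  have d: "(A (fst q), fst q) \<in> wave_dom" if "q \<in> ?U" for q using that dom by auto
  have bpos: "0 < wave_b p" if "p \<in> wave_dom" for p
    using wave_b_bounds(2)[OF that] wave_dom_pos[OF that] by linarith
  have nz: "fst p * wave_b p \<noteq> 0" "2 * wave_b p \<noteq> 0" "0 < fst p * wave_b p / 6" if "p \<in> wave_dom" for p
    using wave_ab_pos[OF that] bpos[OF that] by auto
  have "smooth_on wave_dom wave_m" unfolding wave_m_def[abs_def] by (intro smooth_intros nz)
  note m = smooth_on_compose[OF this p d]
  have "smooth_on wave_dom wave_beta" unfolding wave_beta_def[abs_def] by (intro smooth_intros nz)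
  note \<beta> = smooth_on_compose[OF this p d]
  have "smooth_on wave_dom wave_c" unfolding wave_c_def[abs_def] by (intro smooth_intros nz) simp
  note c = smooth_on_compose[OF this p d]
  have "smooth_on ?U (\<lambda>q. jacobi_am (fst (wave_c (A (fst q), fst q) * snd q, wave_m (A (fst q), fst q)))
      (sqrt (snd (wave_c (A (fst q), fst q) * snd q, wave_m (A (fst q), fst q)))))"
    by (rule smooth_on_compose[OF smooth_on_jacobi_am])
      (use wave_m_bounds d in \<open>auto intro!: smooth_intros c m\<close>)
  then have am: "smooth_on ?U (\<lambda>q. jacobi_am (wave_c (A (fst q), fst q) * snd q) (sqrt (wave_m (A (fst q), fst q))))"
    by simp
  have N: "0 < 1 - wave_m (A (fst q), fst q) * (sin t)\<^sup>2" if "q \<in> ?U" for q t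
    using elliptic_integrand_pos[of "sqrt (wave_m (A (fst q), fst q))" t] wave_m_bounds[OF d[OF that]]
    by simp
  have Q: "0 < 1 + wave_beta (A (fst q), fst q) * (sin t)\<^sup>2" if "q \<in> ?U" for q t
    using wave_beta_pos[OF d[OF that]] by (simp add: add_pos_nonneg)
  have Q': "sqrt (1 + wave_beta (A (fst q), fst q) * (sin t)\<^sup>2) \<noteq> 0" if "q \<in> ?U" for q t
    using Q[OF that, of t] by simp
  have pos: "0 < A (fst q)" if "q \<in> ?U" for q using wave_dom_pos[OF d[OF that]] by simp
  have "smooth_on ?U (\<lambda>q. A (fst q))" by (intro smooth_on_compose[OF A] smooth_intros) auto
  then show ?thesis
    unfolding wave_profile_def fst_conv by (intro smooth_intros m \<beta> am N Q Q' pos)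
qed

section \<open>Assembling the branch and the family of waves\<close>

lemma omega_threshold_eq:
  "L > 0 \<Longrightarrow> omega_threshold L = 1 / 8 * (sqrt (L\<^sup>2 + 16 * pi\<^sup>2) / L + 8 * pi\<^sup>2 / L\<^sup>2 - 1)"
  unfolding omega_threshold_def by (simp add: field_simps)

lemma smooth_dnoidal_family_period_alpha3:
  assumes L: "L > 0"
  shows "smooth_dnoidal_family L {omega_threshold L<..} (period_alpha3 L)"
proof -
  let ?I = "{omega_threshold L<..}" and ?A = "period_alpha3 L"
  have dom: "(?A \<omega>, \<omega>) \<in> wave_dom" and T: "dn_T (?A \<omega>) \<omega> = L" if "\<omega> \<in> ?I" for \<omega>
    using period_alpha3[OF L] that by auto
  have fp: "fundamental_period (dnoidal_wave \<omega> (?A \<omega>)) L" if "\<omega> \<in> ?I" for \<omega>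
    using wave_profile_periodic[OF dom[OF that]] unfolding T[OF that] dnoidal_wave_eq[OF dom[OF that]] .
  have "smooth_Hper_curve n L ?I (\<lambda>\<omega>. dnoidal_wave \<omega> (?A \<omega>))" for n
  proof (rule smooth_Hper_curveI[OF L])
    show "smooth_on (?I \<times> UNIV) (\<lambda>q. wave_profile (?A (fst q), fst q) (snd q))"
      by (rule smooth_on_wave_profile[OF smooth_on_period_alpha3[OF L] dom])
    fix \<omega> x assume w: "\<omega> \<in> ?I"
    then show "dnoidal_wave \<omega> (?A \<omega>) x = wave_profile (?A (fst (\<omega>, x)), fst (\<omega>, x)) (snd (\<omega>, x))"
      by (simp add: dnoidal_wave_eq[OF dom])
    show "wave_profile (?A (fst (\<omega>, x + L)), fst (\<omega>, x + L)) (snd (\<omega>, x + L))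
        = wave_profile (?A (fst (\<omega>, x)), fst (\<omega>, x)) (snd (\<omega>, x))"
      using fp[OF w] unfolding dnoidal_wave_eq[OF dom[OF w]] fundamental_period_def by simp
  qed simp
  then show ?thesis
    unfolding smooth_dnoidal_family_def
    using fp wave_profile_ode[OF dom] dnoidal_wave_eq[OF dom] by metis
qed

text \<open>The target interval can be the whole line because \<open>period_branch\<close> confines
  each value to \<open>alpha3_range \<omega>\<close>, where the period determines it
  pointwise.\<close>

lemma unique_period_branch_period_alpha3:
  assumes L: "L > 0" and \<omega>\<^sub>0: "\<omega>\<^sub>0 > omega_threshold L"
    and a\<^sub>0: "a\<^sub>0 \<in> alpha3_range \<omega>\<^sub>0" "dn_T a\<^sub>0 \<omega>\<^sub>0 = L"
  shows "unique_period_branch L \<omega>\<^sub>0 a\<^sub>0 {omega_threshold L<..} UNIV (period_alpha3 L)"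
  unfolding unique_period_branch_def
proof (intro conjI allI impI ballI)
  let ?I = "{omega_threshold L<..}" and ?A = "period_alpha3 L"
  show "open_interval_around \<omega>\<^sub>0 ?I" "open_interval_around a\<^sub>0 UNIV"
    using \<omega>\<^sub>0 by (auto simp: open_interval_around_def is_interval_1)
  have "?A \<omega>\<^sub>0 = a\<^sub>0" using ex1_alpha3[OF L \<omega>\<^sub>0] period_alpha3[OF L \<omega>\<^sub>0] a\<^sub>0 by blast
  then show "period_branch L \<omega>\<^sub>0 a\<^sub>0 ?I UNIV ?A"
    unfolding period_branch_def
    using smooth_on_imp_smooth_real_on[OF _ smooth_on_period_alpha3[OF L]] period_alpha3[OF L] dn_ksq_bounds
    by auto
  fix \<Lambda>' \<omega> assume "period_branch L \<omega>\<^sub>0 a\<^sub>0 ?I UNIV \<Lambda>'" "\<omega> \<in> ?I"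
  then show "\<Lambda>' \<omega> = ?A \<omega>"
    using ex1_alpha3[OF L] period_alpha3[OF L] unfolding period_branch_def by (metis greaterThan_iff)
qed

theorem theorem3p1:
  fixes L \<omega>\<^sub>0 :: real
  assumes "L > 0"
    and "\<omega>\<^sub>0 > 1 / 8 * (sqrt (L\<^sup>2 + 16 * pi\<^sup>2) / L + 8 * pi\<^sup>2 / L\<^sup>2 - 1)"
  shows "(\<exists>!a. a \<in> alpha3_range \<omega>\<^sub>0 \<and> dn_T a \<omega>\<^sub>0 = L) \<and>
    (\<forall>a\<^sub>0. a\<^sub>0 \<in> alpha3_range \<omega>\<^sub>0 \<and> dn_T a\<^sub>0 \<omega>\<^sub>0 = L \<longrightarrow>
      (\<exists>I\<^sub>1 I\<^sub>2 \<Lambda>. unique_period_branch L \<omega>\<^sub>0 a\<^sub>0 I\<^sub>1 I\<^sub>2 \<Lambda> \<and> smooth_dnoidal_family L I\<^sub>1 \<Lambda>) \<and>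
      (\<exists>I\<^sub>2 \<Lambda>. unique_period_branch L \<omega>\<^sub>0 a\<^sub>0 {omega_threshold L<..} I\<^sub>2 \<Lambda> \<and>
              smooth_dnoidal_family L {omega_threshold L<..} \<Lambda>))"
proof -
  have "\<omega>\<^sub>0 > omega_threshold L" using assms(2) omega_threshold_eq[OF assms(1)] by simp
  \<comment> \<open>The same half-line witnesses the interval of the local statement and that of the
    global one.\<close>
  then show ?thesis
    using ex1_alpha3[OF assms(1)] unique_period_branch_period_alpha3[OF assms(1)]
      smooth_dnoidal_family_period_alpha3[OF assms(1)] by blast
qed

end
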